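(* Let $\mathcal{E}_{1}$ be the set of even integers $w\ge 2$ such that the normalized extremal quasimodular form $G_{w}^{(1)}$ of weight $w$ and depth $1$ on $SL_{2}(\mathbb{Z})$ exists and has all its Fourier coefficients (in $q=e^{2\pi i\tau}$) in $\mathbb{Z}$. Then \[ \mathcal{E}_{1} = \{2,6,8,10,12,14,16,18,20,22,24,28,30,32,34,38,54,58,68,80,114,118 \}. \]
   Context: Let $q=e^{2\pi i\tau}$, $\tau$ in the upper half plane, $\sigma_k(n)=\sum_{d\mid n}d^k$, and let $E_2=1-24\sum_{n\ge1}\sigma_1(n)q^n$, $E_4=1+240\sum_{n\ge1}\sigma_3(n)q^n$, $E_6=1-504\sum_{n\ge1}\sigma_5(n)q^n$ be the Eisenstein series. The space $QM_{w}^{(r)}$ of quasimodular forms of weight $w$ and depth $\le r$ on $SL_2(\mathbb{Z})$ is the space of functions $\sum_{\ell=0}^{r}E_2^{\ell}f_\ell$ with $f_\ell$ a (holomorphic) modular form of weight $w-2\ell$ on $SL_2(\mathbb{Z})$; a nonzero such form has depth $r$ if $f_r\neq 0$ (i.e. it lies in $QM_w^{(r)}\setminus QM_w^{(r-1)}$). A form $f=\sum_{n\ge0}a_nq^n\in QM_w^{(r)}\setminus QM_w^{(r-1)}$ is called extremal if its order of vanishing at $q=0$ equals $m-1$ where $m=\dim_{\mathbb{C}}QM_w^{(r)}$, and normalized if moreover $a_{m-1}=1$. For depth $r=1$ such a normalized extremal form, when it exists, is unique; it is denoted $G_w^{(1)}$. (There is no quasimodular form of weight 4 and depth 1.) *)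

theory Defs
  imports "HOL-Complex_Analysis.Complex_Analysis" "HOL-Library.Function_Algebras"
begin

definition UHP :: "complex set" where
  "UHP = {\<tau>. Im \<tau> > 0}"

definition nome :: "complex \<Rightarrow> complex" where
  "nome \<tau> = exp (2 * of_real pi * \<i> * \<tau>)"

definition divisor_sigma :: "nat \<Rightarrow> nat \<Rightarrow> nat" where
  "divisor_sigma k n = (\<Sum>d\<in>{d. d dvd n}. d ^ k)"

definition E2 :: "complex \<Rightarrow> complex" where
  "E2 \<tau> = 1 - 24 * (\<Sum>n. of_nat (divisor_sigma 1 (Suc n)) * nome \<tau> ^ Suc n)"

text \<open>Holomorphic modular forms of (integer) weight k on SL_2(Z): holomorphic on the
  upper half plane, invariant under the generators T and S with the weight-k action, and
  holomorphic at the cusp (bounded on Im tau >= 1).\<close>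
definition modular_form :: "int \<Rightarrow> (complex \<Rightarrow> complex) \<Rightarrow> bool" where
  "modular_form k f \<longleftrightarrow>
     f holomorphic_on UHP \<and>
     (\<forall>\<tau>\<in>UHP. f (\<tau> + 1) = f \<tau>) \<and>
     (\<forall>\<tau>\<in>UHP. f (- 1 / \<tau>) = \<tau> powi k * f \<tau>) \<and>
     (\<exists>B. \<forall>\<tau>. Im \<tau> \<ge> 1 \<longrightarrow> norm (f \<tau>) \<le> B)"

text \<open>QM_w^{(r)}: quasimodular forms of weight w and depth at most r, i.e. functions
  sum_{l=0}^r E_2^l f_l on the upper half plane with f_l modular of weight w - 2l.
  Functions are taken to be 0 off the upper half plane so that QM is a genuine complex
  vector subspace of complex => complex.\<close>
definition QM :: "int \<Rightarrow> nat \<Rightarrow> (complex \<Rightarrow> complex) set" where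
  "QM w r = {F. \<exists>fs :: nat \<Rightarrow> complex \<Rightarrow> complex.
      (\<forall>l\<le>r. modular_form (w - 2 * int l) (fs l)) \<and>
      F = (\<lambda>\<tau>. if \<tau> \<in> UHP then (\<Sum>l\<le>r. E2 \<tau> ^ l * fs l \<tau>) else 0)}"

definition cdim :: "(complex \<Rightarrow> complex) set \<Rightarrow> nat" where
  "cdim V = vector_space.dim (\<lambda>c (f :: complex \<Rightarrow> complex) x. c * f x) V"

definition has_qexp :: "(complex \<Rightarrow> complex) \<Rightarrow> (nat \<Rightarrow> complex) \<Rightarrow> bool" where
  "has_qexp F a \<longleftrightarrow> (\<forall>\<tau>\<in>UHP. (\<lambda>n. a n * nome \<tau> ^ n) sums F \<tau>)"

definition normalized_extremal :: "int \<Rightarrow> nat \<Rightarrow> (complex \<Rightarrow> complex) \<Rightarrow> (nat \<Rightarrow> complex) \<Rightarrow> bool" where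
  "normalized_extremal w r F a \<longleftrightarrow>
     F \<in> QM w r \<and> (r = 0 \<or> F \<notin> QM w (r - 1)) \<and> F \<noteq> (\<lambda>_. 0) \<and>
     has_qexp F a \<and>
     (\<forall>n < cdim (QM w r) - 1. a n = 0) \<and> a (cdim (QM w r) - 1) = 1"

end

theory Submission
  imports Defs "HOL-Number_Theory.Cong"
begin

text \<open>
  Let \<open>w = 6 n + r\<close> with \<open>r\<close> in \<open>{0, 2, 4}\<close>. A Wronskian argument shows that a nonzero quasimodular
  form of weight \<open>w\<close> and depth at most 1 vanishes to order at most \<open>n\<close> at infinity; in particular the
  extremal form \<open>G\<close> of weight \<open>6 n\<close> satisfies the Kaneko-Zagier differential equation, because the
  defect is quasimodular of weight \<open>6 n + 4\<close> and vanishes to order at least \<open>n + 1\<close>. In the parameter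
  \<open>u = 1/j\<close> this equation is hypergeometric, so that
  \<open>G = E4^((6n-1)/4) u^n F(n/2 + 1/12, n/2 + 5/12; n + 1; 1728 u)\<close>. The extremal form of weight
  \<open>6 n + 2\<close> is a multiple of the Serre derivative of \<open>G\<close>, which replaces \<open>1/12\<close> by \<open>13/12\<close>, and that of
  weight \<open>6 n + 4\<close> is \<open>E4 G\<close>. Since \<open>u\<close> and the fourth root of \<open>E4\<close> have integral coefficients,
  integrality of the extremal form is integrality of all hypergeometric coefficients. The first two
  of them leave finitely many \<open>n\<close>, and for these the valuations are computed by counting the terms of
  the arithmetic progressions that are divisible by each prime power.

  The forms \<open>E4\<close> and \<open>E6\<close> are obtained from \<open>E2\<close> by differentiation, and \<open>\<Delta>\<close> is the solution of
  \<open>q d\<Delta>/dq = E2 \<Delta>\<close>, so the only analytic input is the transformation law of \<open>E2\<close>.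
\<close>

section \<open>Integrality of the hypergeometric coefficients\<close>

text \<open>With alpha = a/12 and beta = b/12 the coefficient of u^m is
  \<open>hyp_num / hyp_den\<close>: 1728^m against 12^m twice leaves 12^m. This 12^m carries the
  primes 2 and 3, at which all a + 12 i and b + 12 i are units, so there everything reduces to
  Legendre's bound for (n+m)! m! / n!. For p >= 5 a numerator progression has to meet 0 early enough
  modulo each prime power, which is automatic from 6 n + 13 on and a finite check below.

  The differential equation identifies G only once G is known to exist. Existence goes by induction
  on n: a combination of E4 times the Serre derivative of G and of E6 G loses its leading term, so
  it is quasimodular of weight 6 (n + 1) and order at least n + 1, and uniqueness makes it a
  multiple of the next hypergeometric solution. Multiplying by powers of \<Delta> then realises
  every order from 0 to n. Hence \<open>cdim\<close> is n + 1 and "extremal" means order n.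

  Composition with u = q + ... is triangular with ones on the diagonal, so integrality passes both
  ways between a form and its hypergeometric series.\<close>

definition hyp_num :: "nat \<Rightarrow> nat \<Rightarrow> nat \<Rightarrow> nat" where
  "hyp_num a b m = 12 ^ m * ((\<Prod>i<m. a + 12 * i) * (\<Prod>i<m. b + 12 * i))"

definition hyp_den :: "nat \<Rightarrow> nat \<Rightarrow> nat" where
  "hyp_den n m = (\<Prod>i<m. n + 1 + i) * (\<Prod>i<m. 1 + i)"

lemma hyp_den_pos: "hyp_den n m > 0"
  by (simp add: hyp_den_def prod_pos)

section \<open>Multiples of P in arithmetic progressions\<close>

lemma card_mod_eq:
  fixes P r m :: nat
  assumes "r < P"
  shows "card {i. i < m \<and> i mod P = r} = (m + (P - 1 - r)) div P"
proof (induction m)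
  case 0
  then show ?case using assms by simp
next
  case (Suc m)
  have *: "{i. i < Suc m \<and> i mod P = r} =
     (if m mod P = r then insert m {i. i < m \<and> i mod P = r} else {i. i < m \<and> i mod P = r})"
    by (auto simp: less_Suc_eq)
  have "(m mod P = r) \<longleftrightarrow> P dvd Suc m + (P - 1 - r)"
  proof -
    have "Suc m + (P - 1 - r) = m + (P - r)" using assms by linarith
    then have "P dvd Suc m + (P - 1 - r) \<longleftrightarrow> P dvd m + (P - r)" by (rule arg_cong)
    also have "\<dots> \<longleftrightarrow> int P dvd int m - int r"
    proof -
      have "int (m + (P - r)) = (int m - int r) + int P" using assms by auto
      then show ?thesis by (metis dvd_add_triv_right_iff int_dvd_int_iff)
    qed
    also have "\<dots> \<longleftrightarrow> int m mod int P = int r mod int P"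
      by (simp add: mod_eq_dvd_iff)
    also have "\<dots> \<longleftrightarrow> m mod P = r" using assms
      by (metis mod_less of_nat_eq_iff zmod_int)
    finally show ?thesis by simp
  qed
  moreover have "(Suc m + (P - 1 - r)) div P = (m + (P - 1 - r)) div P + (if P dvd Suc m + (P - 1 - r) then 1 else 0)"
    using div_Suc[of "m + (P - 1 - r)" P] by (auto simp: dvd_eq_mod_eq_0)
  ultimately show ?case using Suc * by auto
qed

lemma card_mod_antimono:
  fixes P r s m :: nat
  assumes "r \<le> s" "s < P"
  shows "card {i. i < m \<and> i mod P = s} \<le> card {i. i < m \<and> i mod P = r}"
  using assms by (simp add: card_mod_eq div_le_mono)

lemma dvd_progression_iff:
  fixes P a d r i :: nat
  assumes "P dvd a + d * r" "coprime P d" "r < P"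
  shows "P dvd a + d * i \<longleftrightarrow> i mod P = r"
proof -
  have "P dvd a + d * i \<longleftrightarrow> int P dvd int (a + d * i) - int (a + d * r)"
    using assms(1) by (metis dvd_diff_commute dvd_diff_left_iff int_dvd_int_iff)
  also have "int (a + d * i) - int (a + d * r) = int d * (int i - int r)"
    by (simp add: algebra_simps)
  also have "int P dvd \<dots> \<longleftrightarrow> int P dvd int i - int r"
    using assms(2) by (simp add: coprime_dvd_mult_right_iff)
  also have "\<dots> \<longleftrightarrow> int i mod int P = int r mod int P" by (simp add: mod_eq_dvd_iff)
  also have "\<dots> \<longleftrightarrow> i mod P = r" using assms(3)
      by (metis mod_less of_nat_eq_iff zmod_int)
  finally show ?thesis .
qed

lemma progression_root_exists:
  fixes P a d :: nat
  assumes "coprime P d" "P > 0"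
  obtains r where "r < P" "P dvd a + d * r"
proof -
  have "coprime (int d) (int P)" using assms by (simp add: coprime_commute)
  then obtain y where "[int d * y = 1] (mod int P)" using coprime_iff_invertible_int by blast
  then have "[int d * y * (- int a) = 1 * (- int a)] (mod int P)" by (rule cong_scalar_right)
  then obtain x where x: "(int d * x) mod int P = (- int a) mod int P"
    by (metis cong_def mult.assoc mult_1)
  define r where "r = nat (x mod int P)"
  have "int r = x mod int P" using assms by (simp add: r_def)
  then have "(int d * int r) mod int P = (- int a) mod int P" using x
    by (metis mod_mult_right_eq)
  then have "int P dvd int (a + d * r)"
    using mod_eq_dvd_iff[of "int d * int r" "int P" "- int a"] by (simp add: add.commute)
  then have "P dvd a + d * r" by (metis int_dvd_int_iff)
  moreover have "r < P" using \<open>int r = x mod int P\<close> assms(2)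
    by (metis of_nat_0_less_iff of_nat_less_iff pos_mod_bound)
  ultimately show ?thesis using that by blast
qed

text \<open>The first i with P dvd n + 1 + i is P - 1 - n mod P. The condition asks that some
  numerator factor be divisible by P no later than that; any witness i will do, so one number
  certifies it.\<close>

definition low_root :: "nat \<Rightarrow> nat \<Rightarrow> nat \<Rightarrow> nat \<Rightarrow> bool" where
  "low_root a b n P \<longleftrightarrow> (\<exists>i. i + n mod P < P \<and> (P dvd a + 12 * i \<or> P dvd b + 12 * i))"

text \<open>Each of the four progressions meets 0 modulo P in one residue class, and among i < m a
  smaller representative is met at least as often as a larger one. The class of 1 + i is the last
  one, P - 1, so either numerator class dominates it; the low root dominates the class of n + 1 +
  i.\<close>

lemma card_dvd_le_if_low_root:
  fixes P a b n m :: nat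
  assumes "coprime P 12" "P > 0" "low_root a b n P"
  shows "card {i. i < m \<and> P dvd n + 1 + i} + card {i. i < m \<and> P dvd 1 + i}
     \<le> card {i. i < m \<and> P dvd a + 12 * i} + card {i. i < m \<and> P dvd b + 12 * i}"
proof -
  obtain r where r: "r < P" "P dvd a + 12 * r" by (rule progression_root_exists[OF assms(1,2)])
  obtain s where s: "s < P" "P dvd b + 12 * s" by (rule progression_root_exists[OF assms(1,2)])
  define j where "j = P - 1 - n mod P"
  have nP: "n mod P < P" using assms(2) by simp
  have j: "j < P" using assms(2) by (simp add: j_def)
  have "n + 1 + j = (n div P) * P + P" using nP unfolding j_def
    using div_mult_mod_eq[of n P] by linarith
  then have "P dvd n + 1 + 1 * j" by simp
  from dvd_progression_iff[OF this _ j] have 1: "P dvd n + 1 + i \<longleftrightarrow> i mod P = j" for i by simp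
  have "P dvd 1 + 1 * (P - 1)" using assms(2) by simp
  from dvd_progression_iff[OF this] have 2: "P dvd 1 + i \<longleftrightarrow> i mod P = P - 1" for i using assms(2) by simp
  have 3: "P dvd a + 12 * i \<longleftrightarrow> i mod P = r" for i by (rule dvd_progression_iff) (use assms r in auto)
  have 4: "P dvd b + 12 * i \<longleftrightarrow> i mod P = s" for i by (rule dvd_progression_iff) (use assms s in auto)
  obtain i where i: "i + n mod P < P" "P dvd a + 12 * i \<or> P dvd b + 12 * i"
    using assms(3) unfolding low_root_def by blast
  then have "i mod P = i" by simp
  then have rs: "r \<le> j \<or> s \<le> j" using i 3[of i] 4[of i] by (auto simp: j_def)
  have "r \<le> P - 1" "s \<le> P - 1" using r s by auto
  from rs show ?thesis unfolding 1 2 3 4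
  proof
    assume "r \<le> j"
    with card_mod_antimono[OF this j, of m] card_mod_antimono[OF \<open>s \<le> P - 1\<close>, of P m] s(1) assms(2)
    show "card {i. i < m \<and> i mod P = j} + card {i. i < m \<and> i mod P = P - 1}
       \<le> card {i. i < m \<and> i mod P = r} + card {i. i < m \<and> i mod P = s}" by simp
  next
    assume "s \<le> j"
    with card_mod_antimono[OF this j, of m] card_mod_antimono[OF \<open>r \<le> P - 1\<close>, of P m] r(1) assms(2)
    show "card {i. i < m \<and> i mod P = j} + card {i. i < m \<and> i mod P = P - 1}
       \<le> card {i. i < m \<and> i mod P = r} + card {i. i < m \<and> i mod P = s}" by simp
  qed
qed

section \<open>Valuations at primes p >= 5\<close>

lemma multiplicity_eq_card:
  fixes p x E :: nat
  assumes "prime p" "x > 0" "x \<le> E"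
  shows "multiplicity p x = card {e\<in>{1..E}. p ^ e dvd x}"
proof -
  have "p ^ multiplicity p x \<le> x" using assms(2) by (intro dvd_imp_le multiplicity_dvd)
  moreover have "multiplicity p x < p ^ multiplicity p x"
    using assms(1) by (intro power_gt_expt) (simp add: prime_gt_Suc_0_nat)
  ultimately have le: "multiplicity p x \<le> E" using assms(3) by linarith
  have "{e\<in>{1..E}. p ^ e dvd x} = {1..multiplicity p x}"
    using assms le prime_gt_1_nat[OF assms(1)] by (auto simp: power_dvd_iff_le_multiplicity)
  then show ?thesis by simp
qed

lemma multiplicity_prod_eq_sum_card:
  fixes p m E :: nat and f :: "nat \<Rightarrow> nat"
  assumes "prime p" "\<And>i. i < m \<Longrightarrow> f i > 0" "\<And>i. i < m \<Longrightarrow> f i \<le> E"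
  shows "multiplicity p (\<Prod>i<m. f i) = (\<Sum>e\<in>{1..E}. card {i. i < m \<and> p ^ e dvd f i})"
proof -
  have "0 \<notin> f ` {..<m}" using assms(2) by (metis imageE lessThan_iff less_irrefl)
  then have "multiplicity p (\<Prod>i<m. f i) = (\<Sum>i<m. multiplicity p (f i))"
    using assms(1) by (intro prime_elem_multiplicity_prod_distrib) simp_all
  also have "\<dots> = (\<Sum>i<m. \<Sum>e\<in>{1..E}. if p ^ e dvd f i then 1 else 0)"
  proof (intro sum.cong refl)
    fix i assume "i \<in> {..<m}"
    then have "multiplicity p (f i) = card {e\<in>{1..E}. p ^ e dvd f i}"
      using assms by (intro multiplicity_eq_card) auto
    also have "\<dots> = (\<Sum>e\<in>{1..E}. if p ^ e dvd f i then 1 else 0)"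
      by (simp add: sum.If_cases Int_def)
    finally show "multiplicity p (f i) = (\<Sum>e\<in>{1..E}. if p ^ e dvd f i then 1 else 0)" .
  qed
  also have "\<dots> = (\<Sum>e\<in>{1..E}. \<Sum>i<m. if p ^ e dvd f i then 1 else 0)" by (rule sum.swap)
  also have "\<dots> = (\<Sum>e\<in>{1..E}. card {i. i < m \<and> p ^ e dvd f i})"
    by (intro sum.cong refl) (simp add: sum.If_cases Int_def)
  finally show ?thesis .
qed

lemma multiplicity_hyp_le_if_low_root:
  fixes p a b n m :: nat
  assumes p: "prime p" "coprime p 12" and "a > 0" "b > 0"
    and low: "\<And>e. e > 0 \<Longrightarrow> low_root a b n (p ^ e)"
  shows "multiplicity p (hyp_den n m) \<le> multiplicity p (hyp_num a b m)"
proof -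
  \<comment> \<open>A cutoff above every factor of all four products, so that both sides sum over
    the same exponents e and can be compared termwise.\<close>
  define E where "E = a + b + n + 1 + 12 * m"
  have pos: "(\<Prod>i<m. a + 12 * i) > 0" "(\<Prod>i<m. b + 12 * i) > 0"
    "(\<Prod>i<m. n + 1 + i) > 0" "(\<Prod>i<m. 1 + i) > 0" using assms by (simp_all add: prod_pos)
  have pe: "prime_elem p" using p by simp
  have "multiplicity p (hyp_den n m) =
     (\<Sum>e\<in>{1..E}. card {i. i < m \<and> p ^ e dvd n + 1 + i}) + (\<Sum>e\<in>{1..E}. card {i. i < m \<and> p ^ e dvd 1 + i})"
    unfolding hyp_den_def using pos
    by (subst prime_elem_multiplicity_mult_distrib[OF pe])
       (auto simp del: One_nat_def simp: multiplicity_prod_eq_sum_card[OF p(1), where E = E] E_def)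
  also have "\<dots> \<le> (\<Sum>e\<in>{1..E}. card {i. i < m \<and> p ^ e dvd a + 12 * i}) + (\<Sum>e\<in>{1..E}. card {i. i < m \<and> p ^ e dvd b + 12 * i})"
    unfolding sum.distrib[symmetric]
    by (intro sum_mono card_dvd_le_if_low_root low) (use p in \<open>auto simp: prime_gt_0_nat\<close>)
  also have "\<dots> = multiplicity p ((\<Prod>i<m. a + 12 * i) * (\<Prod>i<m. b + 12 * i))"
    using pos assms(3,4)
    by (subst prime_elem_multiplicity_mult_distrib[OF pe])
       (auto simp del: One_nat_def simp: multiplicity_prod_eq_sum_card[OF p(1), where E = E] E_def)
  also have "\<dots> \<le> multiplicity p (hyp_num a b m)"
    unfolding hyp_num_def using pos by (intro dvd_imp_multiplicity_le) auto
  finally show ?thesis .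
qed

text \<open>One of P and 7 P is congruent to a or to 6 n + 5 modulo 12: multiplication by 7 adds 6
  to an odd residue, and the two targets are {1, 5} or {7, 11} modulo 12. If c P = x + 12 i with c
  <= 7, then i < 7 P / 12, while n < P / 6, so i + n < P.\<close>

lemma low_root_if_large:
  fixes a n P :: nat
  assumes "coprime P 12" "P \<ge> 6 * n + 13" "a = 6 * n + 1 \<or> a = 6 * n + 13"
  shows "low_root a (6 * n + 5) n P"
proof -
  have "odd P" "P mod 3 \<noteq> 0"
  proof -
    show "odd P" using assms(1) by (metis coprime_common_divisor dvd_mult2 even_numeral numeral_Bit0 odd_one)
    show "P mod 3 \<noteq> 0"
    proof
      assume "P mod 3 = 0"
      then have "3 dvd P" "3 dvd (12::nat)" by auto
      with assms(1) show False by (metis coprime_common_divisor_nat numeral_eq_one_iff semiring_norm(86))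
    qed
  qed
  have nP: "n mod P = n" using assms(2) by simp
  have key: "low_root a (6 * n + 5) n P"
    if "c \<le> 7" "1 \<le> c" "x = a \<or> x = 6 * n + 5" "c * P mod 12 = x mod 12" for c x
  proof -
    have "x \<le> P" using that assms by auto
    then have "x \<le> c * P" using that(2) by (metis le_trans mult.commute mult_le_mono2 nat_mult_1_right)
    then have "12 dvd c * P - x" using that(4) by (metis mod_eq_dvd_iff_nat)
    then obtain i where i: "c * P - x = 12 * i" by blast
    then have ci: "c * P = x + 12 * i" using \<open>x \<le> c * P\<close> by simp
    then have "P dvd x + 12 * i" by (metis dvd_triv_right)
    have "c * P \<le> 7 * P" using that by simp
    then have "x + 12 * i \<le> 7 * P" using ci by simp
    then have "i + n < P" using that assms by auto
    then show ?thesis unfolding low_root_def nP using \<open>P dvd x + 12 * i\<close> that(3) by blast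
  qed
  have P12: "P mod 12 = 1 \<or> P mod 12 = 5 \<or> P mod 12 = 7 \<or> P mod 12 = 11"
  proof -
    have "P mod 12 mod 2 = P mod 2" "P mod 12 mod 3 = P mod 3" by (simp_all add: mod_mod_cancel)
    with \<open>odd P\<close> \<open>P mod 3 \<noteq> 0\<close> have "P mod 12 mod 2 = 1" "P mod 12 mod 3 \<noteq> 0"
      by (simp_all add: odd_iff_mod_2_eq_one)
    moreover have "P mod 12 \<in> {..<12}" by simp
    ultimately show ?thesis by (auto simp: lessThan_nat_numeral lessThan_Suc)
  qed
  have "7 * P mod 12 = (7 * (P mod 12)) mod 12" by (simp add: mod_mult_right_eq)
  with P12 have P7: "P mod 12 = 1 \<and> 7 * P mod 12 = 7 \<or> P mod 12 = 5 \<and> 7 * P mod 12 = 11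
    \<or> P mod 12 = 7 \<and> 7 * P mod 12 = 1 \<or> P mod 12 = 11 \<and> 7 * P mod 12 = 5" by auto
  have a12: "a mod 12 = (6 * n + 1) mod 12" using assms(3)
  proof
    assume "a = 6 * n + 13"
    then have "a = (6 * n + 1) + 12" by simp
    then show ?thesis by (metis mod_add_self2)
  qed auto
  have *: "6 * n = 6 * (n mod 2) + 12 * (n div 2)" by presburger
  have "n mod 2 = 0 \<or> n mod 2 = 1" by presburger
  then have n12: "(6 * n + 1) mod 12 = 1 \<and> (6 * n + 5) mod 12 = 5 \<or> (6 * n + 1) mod 12 = 7 \<and> (6 * n + 5) mod 12 = 11"
    by (subst (1 2 3 4) *, elim disjE) simp_all
  have k: "P mod 12 = a mod 12 \<Longrightarrow> low_root a (6 * n + 5) n P"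
    "P mod 12 = (6 * n + 5) mod 12 \<Longrightarrow> low_root a (6 * n + 5) n P"
    "7 * P mod 12 = a mod 12 \<Longrightarrow> low_root a (6 * n + 5) n P"
    "7 * P mod 12 = (6 * n + 5) mod 12 \<Longrightarrow> low_root a (6 * n + 5) n P"
    using key[of 1 a] key[of 1 "6 * n + 5"] key[of 7 a] key[of 7 "6 * n + 5"]
    by (metis le_refl mult_1 one_le_numeral)+
  show ?thesis using k unfolding a12 using n12 P7 by (metis (no_types, lifting))
qed

section \<open>Valuations at 2 and 3\<close>

lemma multiplicity_fact_eq_sum:
  fixes p m E :: nat
  assumes "prime p" "m \<le> E"
  shows "multiplicity p (fact m) = (\<Sum>e\<in>{1..E}. m div p ^ e)"
proof -
  have "fact m = (\<Prod>i<m. 1 + i)"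
    by (simp add: fact_prod_Suc atLeast0LessThan)
  then have "multiplicity p (fact m) = (\<Sum>e\<in>{1..E}. card {i. i < m \<and> p ^ e dvd 1 + i})"
    using assms by (simp only: ) (intro multiplicity_prod_eq_sum_card, auto)
  also have "\<dots> = (\<Sum>e\<in>{1..E}. m div p ^ e)"
  proof (intro sum.cong refl)
    fix e assume "e \<in> {1..E}"
    have pe: "p ^ e > 0" using assms by (simp add: prime_gt_0_nat)
    have "p ^ e dvd 1 + 1 * (p ^ e - 1)" using pe by simp
    from dvd_progression_iff[OF this] have "p ^ e dvd 1 + i \<longleftrightarrow> i mod p ^ e = p ^ e - 1" for i using pe by simp
    then show "card {i. i < m \<and> p ^ e dvd 1 + i} = m div p ^ e"
      using card_mod_eq[of "p ^ e - 1" "p ^ e" m] pe by simp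
  qed
  finally show ?thesis .
qed

text \<open>Legendre's inequality (p - 1) v(m!) <= m - 1. With k = m div p the sum for m is k plus
  the sum for k, and (p - 1) k + (k - 1) = p k - 1.\<close>

lemma sum_div_power_le:
  fixes p m E :: nat
  assumes "p \<ge> 2" "m \<ge> 1"
  shows "(p - 1) * (\<Sum>e\<in>{1..E}. m div p ^ e) \<le> m - 1"
  using assms(2)
proof (induction m arbitrary: E rule: less_induct)
  case (less m)
  define k where "k = m div p"
  show ?case
  proof (cases E)
    case (Suc E')
    have "(\<Sum>e\<in>{1..E}. m div p ^ e) = (\<Sum>e\<in>{0..E'}. m div p ^ (Suc e))"
      unfolding Suc One_nat_def by (subst sum.atLeast_Suc_atMost_Suc_shift) (simp add: o_def)
    also have "\<dots> = (\<Sum>e\<in>{0..E'}. k div p ^ e)"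
      by (simp add: k_def div_mult2_eq)
    also have "\<dots> = k + (\<Sum>e\<in>{1..E'}. k div p ^ e)"
      by (subst sum.atLeast_Suc_atMost) simp_all
    finally have eq: "(\<Sum>e\<in>{1..E}. m div p ^ e) = k + (\<Sum>e\<in>{1..E'}. k div p ^ e)" .
    show ?thesis
    proof (cases "k = 0")
      case False
      have "k < m" using less.prems assms(1) by (simp add: k_def)
      then have "(p - 1) * (\<Sum>e\<in>{1..E'}. k div p ^ e) \<le> k - 1" using False by (intro less.IH) auto
      then have "(p - 1) * (\<Sum>e\<in>{1..E}. m div p ^ e) \<le> (p - 1) * k + (k - 1)"
        unfolding eq by (simp add: distrib_left)
      also have "\<dots> = p * k - 1" using False assms(1) by (cases p) auto
      also have "\<dots> \<le> m - 1" by (simp add: k_def diff_le_mono)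
      finally show ?thesis .
    qed (use eq in simp)
  qed simp
qed

lemma multiplicity_fact_le:
  fixes p m :: nat
  assumes "prime p" "m \<ge> 1"
  shows "(p - 1) * multiplicity p (fact m) \<le> m - 1"
  using sum_div_power_le[OF prime_ge_2_nat[OF assms(1)] assms(2), of m]
  by (simp only: multiplicity_fact_eq_sum[OF assms(1) order.refl])

lemma hyp_den_fact: "fact n * hyp_den n m = (fact (n + m) * fact m :: nat)"
proof -
  have "(\<Prod>i<m. 1 + i) = (fact m :: nat)" by (simp add: fact_prod_Suc atLeast0LessThan)
  moreover have "fact n * (\<Prod>i<m. n + 1 + i) = (fact (n + m) :: nat)"
    by (induction m) (simp_all add: algebra_simps)
  ultimately show ?thesis by (simp add: hyp_den_def flip: mult.assoc)
qed

lemma multiplicity_hyp_den: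
  fixes p n m :: nat
  assumes "prime p"
  shows "multiplicity p (fact n) + multiplicity p (hyp_den n m)
     = multiplicity p (fact (n + m)) + multiplicity p (fact m)"
proof -
  have pe: "prime_elem p" using assms by simp
  have "hyp_den n m \<noteq> 0" using hyp_den_pos[of n m] by simp
  then have "multiplicity p (fact n) + multiplicity p (hyp_den n m) = multiplicity p (fact n * hyp_den n m)"
    by (subst prime_elem_multiplicity_mult_distrib[OF pe]) simp_all
  also have "\<dots> = multiplicity p (fact (n + m)) + multiplicity p (fact m)"
    unfolding hyp_den_fact by (subst prime_elem_multiplicity_mult_distrib[OF pe]) simp_all
  finally show ?thesis .
qed

lemma le_multiplicity_fact:
  fixes p n k :: nat
  assumes "prime p" "p ^ k dvd fact n"
  shows "k \<le> multiplicity p (fact n)"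
proof (rule multiplicity_geI[OF _ _ assms(2)])
  show "\<not> is_unit p" using assms(1) by (metis not_prime_unit)
qed simp

text \<open>Legendre bounds twice the valuation of (n+m)! m! / n! by (n + m - 1) + (m - 1) - 2 k <=
  2 m + 1, and rounding down gives m. The hypotheses force the ternary digit sum of n to be at most
  3.\<close>

lemma multiplicity_three_hyp_den:
  fixes n m k :: nat
  assumes "3 ^ k dvd (fact n :: nat)" "n \<le> 2 * k + 3"
  shows "multiplicity 3 (hyp_den n m) \<le> m"
proof (cases "m = 0")
  case False
  have 3: "prime (3::nat)" by simp
  show ?thesis
    using multiplicity_hyp_den[OF 3, of n m] le_multiplicity_fact[OF 3 assms(1)] assms(2) False
      multiplicity_fact_le[OF 3, of m] multiplicity_fact_le[OF 3, of "n + m"] by simp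
qed (simp add: hyp_den_def)

text \<open>For odd m the factorials of m and m - 1 have the same 2-part, which improves Legendre's
  bound by one.\<close>

lemma multiplicity_two_fact_odd_le:
  fixes m :: nat
  assumes "odd m" "m > 1"
  shows "multiplicity 2 (fact m :: nat) \<le> m - 2"
proof -
  have 2: "prime (2::nat)" by simp
  obtain l where l: "m = Suc l" using assms(2) by (cases m) auto
  have "multiplicity 2 (fact m :: nat) = multiplicity 2 (Suc l) + multiplicity 2 (fact l :: nat)"
    unfolding l fact_Suc of_nat_id
    by (subst prime_elem_multiplicity_mult_distrib) simp_all
  also have "multiplicity 2 (Suc l) = 0" using assms(1) l by (intro not_dvd_imp_multiplicity_0) simp
  finally show ?thesis using multiplicity_fact_le[OF 2, of l] l assms(2) by simp
qed

text \<open>The plain bound n + 2 m - 2 - k suffices for n <= k + 2. For n = k + 3 one factor 2 must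
  be saved. As n is odd, one of m and n + m is odd and \<open>multiplicity_two_fact_odd_le\<close>
  saves it, except for m = 1, where the valuation is that of n + 1 and has to be at most 2.\<close>

lemma multiplicity_two_hyp_den:
  fixes n m k :: nat
  assumes k: "2 ^ k dvd (fact n :: nat)"
    and n: "n \<le> k + 2 \<or> n \<le> k + 3 \<and> odd n \<and> \<not> 8 dvd n + 1"
  shows "multiplicity 2 (hyp_den n m) \<le> 2 * m"
proof (cases "m = 0")
  case False
  have 2: "prime (2::nat)" by simp
  note * = multiplicity_hyp_den[OF 2, of n m] le_multiplicity_fact[OF 2 k]
    multiplicity_fact_le[OF 2, of m] multiplicity_fact_le[OF 2, of "n + m"]
  show ?thesis
  proof (cases "n \<le> k + 2")
    case True
    then show ?thesis using * False by simp
  next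
    case nk: False
    then have n': "n \<le> k + 3" "odd n" "\<not> 8 dvd n + 1" using n by auto
    consider "m = 1" | "odd m" "m > 1" | "even m" "m > 0" using False by fastforce
    then show ?thesis
    proof cases
      case 1
      have "multiplicity 2 (n + 1) < 3"
        using n'(3) power_dvd_iff_le_multiplicity[of "n + 1" 2 3] by simp
      then show ?thesis using 1 by (simp add: hyp_den_def)
    next
      case 2
      then show ?thesis using * n' multiplicity_two_fact_odd_le[of m] by simp
    next
      case 3
      have "odd (n + m)" "n + m > 1" using 3 n'(2) by (auto elim!: oddE)
      then have "multiplicity 2 (fact (n + m) :: nat) \<le> n + m - 2"
        by (intro multiplicity_two_fact_odd_le)
      with * n' 3 \<open>n + m > 1\<close> show ?thesis by simp
    qed
  qed
qed (simp add: hyp_den_def)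

section \<open>All primes together, and the finite check of small moduli\<close>

lemma hyp_den_dvd_hyp_num:
  fixes a b n k l m :: nat
  assumes ab: "a > 0" "b > 0"
    and low: "\<And>P. coprime P 12 \<Longrightarrow> low_root a b n P"
    and two: "2 ^ k dvd (fact n :: nat)" "n \<le> k + 2 \<or> n \<le> k + 3 \<and> odd n \<and> \<not> 8 dvd n + 1"
    and three: "3 ^ l dvd (fact n :: nat)" "n \<le> 2 * l + 3"
  shows "hyp_den n m dvd hyp_num a b m"
proof (rule multiplicity_le_imp_dvd)
  show "hyp_den n m \<noteq> 0" using hyp_den_pos[of n m] by simp
  fix p :: nat assume p: "prime p"
  have pos: "hyp_num a b m \<noteq> 0" using ab by (simp add: hyp_num_def)
  \<comment> \<open>The factor 12^m of the numerator supplies 2^(2 m) and 3^m, exactly the bounds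
    proved for the denominator.\<close>
  have pow: "multiplicity q (q ^ (c * m)) \<le> multiplicity q (hyp_num a b m)" if "q ^ c dvd 12" "prime q" for q c :: nat
    using that(1) pos unfolding hyp_num_def power_mult
    by (intro dvd_imp_multiplicity_le dvd_mult2 dvd_power_same) auto
  consider "p = 2" | "p = 3" | "p \<noteq> 2" "p \<noteq> 3" by blast
  then show "multiplicity p (hyp_den n m) \<le> multiplicity p (hyp_num a b m)"
  proof cases
    case 1
    then show ?thesis using multiplicity_two_hyp_den[OF two, of m] pow[of 2 2] by simp
  next
    case 2
    then show ?thesis using multiplicity_three_hyp_den[OF three, of m] pow[of 3 1] by simp
  next
    case 3
    have "coprime p 2" "coprime p 3" using 3 p by (auto intro!: primes_coprime simp del: coprime_right_2_iff_odd)
    then have "coprime p (2 ^ 2 * 3)"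
      unfolding coprime_mult_right_iff coprime_power_right_iff by simp
    then have "coprime p 12" by simp
    then show ?thesis using p ab low by (intro multiplicity_hyp_le_if_low_root) auto
  qed
qed

text \<open>The list supplies one witness for each of the moduli \<open>P, P + 6, P + 12, \<dots>\<close>; the starting
  values 1 and 5 together cover all moduli coprime to 6.\<close>

primrec low_root_list :: "nat \<Rightarrow> nat \<Rightarrow> nat \<Rightarrow> nat list \<Rightarrow> bool" where
  "low_root_list a n P [] \<longleftrightarrow> True"
| "low_root_list a n P (i # is) \<longleftrightarrow> i + n mod P < P \<and>
     ((a + 12 * i) mod P = 0 \<or> (6 * n + 5 + 12 * i) mod P = 0) \<and> low_root_list a n (P + 6) is"

lemma low_root_listD:
  assumes "low_root_list a n P is" "k < length is"
  shows "low_root a (6 * n + 5) n (P + 6 * k)"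
  using assms
proof (induction "is" arbitrary: P k)
  case (Cons i "is")
  show ?case
  proof (cases k)
    case 0
    then show ?thesis using Cons.prems(1) unfolding low_root_def dvd_eq_mod_eq_0 by auto
  next
    case (Suc l)
    then have "low_root a (6 * n + 5) n (P + 6 + 6 * l)" using Cons.prems by (intro Cons.IH) auto
    then show ?thesis by (simp add: Suc algebra_simps)
  qed
qed simp

text \<open>A modulus coprime to 12 is 1 or 5 modulo 6. With n + 2 entries per class the lists reach
  every such modulus below 6 n + 13, where \<open>low_root_if_large\<close> takes over.\<close>

lemma low_root_if_small:
  assumes "low_root_list a n 1 L" "low_root_list a n 5 M" "length L = n + 2" "length M = n + 2"
    and "a = 6 * n + 1 \<or> a = 6 * n + 13" "coprime P 12"
  shows "low_root a (6 * n + 5) n P"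
proof (cases "P \<ge> 6 * n + 13")
  case True
  then show ?thesis using assms by (intro low_root_if_large)
next
  case False
  have "\<not> q dvd P" if "q dvd 12" "q \<noteq> 1" for q
    using that assms(6) by (metis coprime_common_divisor_nat)
  from this[of 2] this[of 3] have "P mod 2 \<noteq> 0" "P mod 3 \<noteq> 0"
    by (simp_all only: dvd_eq_mod_eq_0) simp_all
  moreover have "P mod 6 mod 2 = P mod 2" "P mod 6 mod 3 = P mod 3" by (simp_all add: mod_mod_cancel)
  moreover have "P mod 6 \<in> {..<6}" by simp
  ultimately have r: "P mod 6 = 1 \<or> P mod 6 = 5" by (auto simp: lessThan_nat_numeral lessThan_Suc)
  have P: "P = P mod 6 + 6 * (P div 6)" by simp
  then have "P div 6 < n + 2" using r False by linarith
  with r P show ?thesis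
    using low_root_listD[OF assms(1), of "P div 6"] low_root_listD[OF assms(2), of "P div 6"] assms(3,4)
    by metis
qed

text \<open>The k-th entries of the two lists are values of i for the moduli 1 + 6 k and 5 + 6
  k.\<close>

lemma low_root_first:
  assumes "n \<in> {1,2,3,4,5,9,19}" "coprime P 12"
  shows "low_root (6 * n + 1) (6 * n + 5) n P"
proof -
  have *: "low_root (6 * n + 1) (6 * n + 5) n P" if "low_root_list (6 * n + 1) n 1 L" "low_root_list (6 * n + 1) n 5 M"
    "length L = n + 2" "length M = n + 2" for L M
    using that assms(2) by (intro low_root_if_small[of _ _ L M]) auto
  consider "n = 1" | "n = 2" | "n = 3" | "n = 4" | "n = 5" | "n = 9" | "n = 19" using assms(1) by blast
  then show ?thesis
  proof cases
    case 1
    show ?thesis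
      by (rule *[of "[0, 0, 7]" "[2, 0, 9]"]) (simp_all add: 1)
  next
    case 2
    show ?thesis
      by (rule *[of "[0, 3, 0, 10]" "[1, 5, 0, 12]"]) (simp_all add: 2)
  next
    case 3
    show ?thesis
      by (rule *[of "[0, 1, 6, 0, 13]" "[1, 3, 8, 0, 15]"]) (simp_all add: 3)
  next
    case 4
    show ?thesis
      by (rule *[of "[0, 2, 3, 9, 0, 16]" "[0, 4, 5, 11, 0, 18]"]) (simp_all add: 4)
  next
    case 5
    show ?thesis
      by (rule *[of "[0, 0, 5, 5, 12, 0, 19]" "[0, 2, 7, 7, 14, 0, 21]"]) (simp_all add: 5)
  next
    case 6
    show ?thesis
      by (rule *[of "[0, 3, 3, 3, 10, 8, 17, 13, 24, 0, 31]" "[0, 0, 5, 5, 12, 10, 19, 15, 26, 0, 33]"]) (simp_all add: 6)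
  next
    case 7
    show ?thesis
      by (rule *[of "[0, 0, 2, 11, 5, 3, 12, 8, 19, 13, 26, 18, 33, 23, 40, 28, 47, 33, 54, 0, 61]" "[0, 2, 0, 0, 7, 5, 14, 10, 21, 15, 28, 20, 35, 25, 42, 30, 49, 35, 56, 0, 63]"]) (simp_all add: 7)
  qed
qed

lemma low_root_second:
  assumes "n \<in> {0,1,2,3,5,6,11,13}" "coprime P 12"
  shows "low_root (6 * n + 13) (6 * n + 5) n P"
proof -
  have *: "low_root (6 * n + 13) (6 * n + 5) n P" if "low_root_list (6 * n + 13) n 1 L" "low_root_list (6 * n + 13) n 5 M"
    "length L = n + 2" "length M = n + 2" for L M
    using that assms(2) by (intro low_root_if_small[of _ _ L M]) auto
  consider "n = 0" | "n = 1" | "n = 2" | "n = 3" | "n = 5" | "n = 6" | "n = 11" | "n = 13" using assms(1) by blast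
  then show ?thesis
  proof cases
    case 1
    show ?thesis
      by (rule *[of "[0, 3]" "[0, 6]"]) (simp_all add: 1)
  next
    case 2
    show ?thesis
      by (rule *[of "[0, 2, 6]" "[2, 0, 9]"]) (simp_all add: 2)
  next
    case 3
    show ?thesis
      by (rule *[of "[0, 2, 4, 9]" "[0, 5, 0, 12]"]) (simp_all add: 3)
  next
    case 4
    show ?thesis
      by (rule *[of "[0, 1, 5, 6, 12]" "[1, 2, 8, 0, 15]"]) (simp_all add: 4)
  next
    case 5
    show ?thesis
      by (rule *[of "[0, 0, 4, 5, 11, 10, 18]" "[0, 1, 7, 6, 14, 0, 21]"]) (simp_all add: 5)
  next
    case 6
    show ?thesis
      by (rule *[of "[0, 0, 2, 7, 7, 14, 12, 21]" "[2, 3, 3, 10, 8, 17, 0, 24]"]) (simp_all add: 6)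
  next
    case 7
    show ?thesis
      by (rule *[of "[0, 1, 1, 2, 8, 7, 15, 12, 22, 17, 29, 22, 36]" "[2, 6, 4, 3, 11, 8, 18, 13, 25, 18, 32, 0, 39]"]) (simp_all add: 7)
  next
    case 8
    show ?thesis
      by (rule *[of "[0, 0, 0, 1, 7, 6, 14, 11, 21, 16, 28, 21, 35, 26, 42]" "[1, 5, 3, 2, 10, 7, 17, 12, 24, 17, 31, 22, 38, 0, 45]"]) (simp_all add: 8)
  qed
qed

lemma hyp_den_dvd_hyp_num_first:
  assumes "n \<in> {1,2,3,4,5,9,19}"
  shows "hyp_den n m dvd hyp_num (6 * n + 1) (6 * n + 5) m"
proof (rule hyp_den_dvd_hyp_num)
  \<comment> \<open>\<open>k\<close> and \<open>l\<close> are exponents with 2^k and 3^l dividing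
    n!, large enough for the digit-sum conditions. The value of \<open>k\<close> is too large by one
    at n = 1, whence the correction in the goal.\<close>
  define k where "k = (if n < 4 then 1 else if n = 4 \<or> n = 5 then 3 else if n = 9 then 7 else 16 :: nat)"
  define l where "l = (if n < 4 then 0 else if n = 4 \<or> n = 5 then 1 else if n = 9 then 3 else 8 :: nat)"
  show "2 ^ (k - (if n = 1 then 1 else 0)) dvd (fact n :: nat)" "3 ^ l dvd (fact n :: nat)" "n \<le> 2 * l + 3"
    "n \<le> k - (if n = 1 then 1 else 0) + 2 \<or> n \<le> k - (if n = 1 then 1 else 0) + 3 \<and> odd n \<and> \<not> 8 dvd n + 1"
    using assms by (auto simp: k_def l_def fact_numeral)
  show "low_root (6 * n + 1) (6 * n + 5) n P" if "coprime P 12" for P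
    using assms that by (rule low_root_first)
qed auto

lemma hyp_den_dvd_hyp_num_second:
  assumes "n \<in> {0,1,2,3,5,6,11,13}"
  shows "hyp_den n m dvd hyp_num (6 * n + 13) (6 * n + 5) m"
proof (rule hyp_den_dvd_hyp_num)
  define k where "k = (if n < 2 then 0 else if n < 4 then 1 else if n = 5 then 3 else if n = 6 then 4 else if n = 11 then 8 else 10 :: nat)"
  define l where "l = (if n < 4 then 0 else if n = 5 then 1 else if n = 6 then 2 else if n = 11 then 4 else 5 :: nat)"
  show "2 ^ k dvd (fact n :: nat)" "3 ^ l dvd (fact n :: nat)" "n \<le> 2 * l + 3"
    "n \<le> k + 2 \<or> n \<le> k + 3 \<and> odd n \<and> \<not> 8 dvd n + 1"
    using assms by (auto simp: k_def l_def fact_numeral)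
  show "low_root (6 * n + 13) (6 * n + 5) n P" if "coprime P 12" for P
    using assms that by (rule low_root_second)
qed auto

section \<open>Necessary conditions from the first two coefficients\<close>

lemma hyp_den_1: "hyp_den n 1 = n + 1" and hyp_den_2: "hyp_den n 2 = (n + 1) * (n + 2) * 2"
  and hyp_num_1: "hyp_num a b 1 = 12 * (a * b)"
  and hyp_num_2: "hyp_num a b 2 = 144 * (a * (a + 12) * (b * (b + 12)))"
  by (simp_all add: hyp_den_def hyp_num_def numeral_2_eq_2 lessThan_Suc)

text \<open>Modulo n + 1 one has n = -1, so 12 (6 n + 1) (6 n + 5) becomes 12 * (-5) * (-1) and n +
  1 divides 60. The second coefficient then removes 11, 14, 29 and 59.\<close>

lemma hyp_first_only_if:
  fixes n :: nat
  assumes "n > 0" and 1: "hyp_den n 1 dvd hyp_num (6 * n + 1) (6 * n + 5) 1"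
    and 2: "hyp_den n 2 dvd hyp_num (6 * n + 1) (6 * n + 5) 2"
  shows "n \<in> {1,2,3,4,5,9,19}"
proof -
  have "12 * ((6 * n + 1) * (6 * n + 5)) = (n + 1) * (432 * n) + 60" by (simp add: algebra_simps)
  with 1 have "n + 1 dvd (n + 1) * (432 * n) + 60"
    unfolding hyp_den_1 hyp_num_1 by metis
  then have d: "n + 1 dvd 60" by (metis dvd_add_right_iff dvd_triv_left)
  \<comment> \<open>The passage to integers lets \<open>simp_from_to\<close> unfold the interval and
    list the divisors.\<close>
  have "int (n + 1) \<in> {1..60}" using dvd_imp_le[OF d] by simp
  moreover have "int (n + 1) dvd 60" using d int_dvd_int_iff[of "n + 1" 60] by simp
  moreover have "\<forall>d\<in>{1..60}. d dvd (60::int) \<longrightarrow> d \<in> {1,2,3,4,5,6,10,12,15,20,30,60}"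
    by (simp add: simp_from_to)
  ultimately have "int (n + 1) \<in> {1,2,3,4,5,6,10,12,15,20,30,60}" by blast
  then have "n + 1 \<in> {1,2,3,4,5,6,10,12,15,20,30,60}" by auto
  then have "n \<in> (\<lambda>k. k - 1) `  {1,2,3,4,5,6,10,12,15,20,30,60}" by (metis add_diff_cancel_right' imageI)
  then have "n \<in> {0,1,2,3,4,5,9,11,14,19,29,59}" by simp
  then show ?thesis using 2 assms(1) unfolding hyp_den_2 hyp_num_2 insert_iff empty_iff by (elim disjE) simp_all
qed

text \<open>Here n = -1 gives 12 * 7 * (-1), so n + 1 divides 84; the second coefficient removes 20,
  27, 41 and 83.\<close>

lemma hyp_second_only_if:
  fixes n :: nat
  assumes 1: "hyp_den n 1 dvd hyp_num (6 * n + 13) (6 * n + 5) 1"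
    and 2: "hyp_den n 2 dvd hyp_num (6 * n + 13) (6 * n + 5) 2"
  shows "n \<in> {0,1,2,3,5,6,11,13}"
proof -
  have "12 * ((6 * n + 13) * (6 * n + 5)) + 84 = (n + 1) * (432 * (n + 2))" by (simp add: algebra_simps)
  moreover have "n + 1 dvd 12 * ((6 * n + 13) * (6 * n + 5))" using 1 unfolding hyp_den_1 hyp_num_1 .
  ultimately have d: "n + 1 dvd 84" by (metis dvd_add_right_iff dvd_triv_left)
  have "int (n + 1) \<in> {1..84}" using dvd_imp_le[OF d] by simp
  moreover have "int (n + 1) dvd 84" using d int_dvd_int_iff[of "n + 1" 84] by simp
  moreover have "\<forall>d\<in>{1..84}. d dvd (84::int) \<longrightarrow> d \<in> {1,2,3,4,6,7,12,14,21,28,42,84}"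
    by (simp add: simp_from_to)
  ultimately have "int (n + 1) \<in> {1,2,3,4,6,7,12,14,21,28,42,84}" by blast
  then have "n + 1 \<in> {1,2,3,4,6,7,12,14,21,28,42,84}" by auto
  then have "n \<in> (\<lambda>k. k - 1) `  {1,2,3,4,6,7,12,14,21,28,42,84}" by (metis add_diff_cancel_right' imageI)
  then have "n \<in> {0,1,2,3,5,6,11,13,20,27,41,83}" by simp
  then show ?thesis using 2 unfolding hyp_den_2 hyp_num_2 insert_iff empty_iff by (elim disjE) simp_all
qed

section \<open>The weight 2 Eisenstein series\<close>

text \<open>Links unconditional sums over all integers to partial fraction series that converge only
  when summed symmetrically.\<close>

lemma has_sum_int_symmetric:
  fixes f :: "int \<Rightarrow> 'a :: {comm_monoid_add, topological_space}"
  assumes "(f has_sum S) UNIV"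
  shows "(\<lambda>M. \<Sum>k\<in>{- int M..int M}. f k) \<longlonglongrightarrow> S"
proof -
  have "filterlim (\<lambda>M. {- int M..int M}) (finite_subsets_at_top UNIV) sequentially"
    unfolding filterlim_finite_subsets_at_top
  proof (intro allI impI, elim conjE)
    fix X :: "int set" assume X: "finite X"
    define B where "B = Max (insert 0 (abs ` X))"
    have "\<bar>x\<bar> \<le> B" if "x \<in> X" for x unfolding B_def using X that by (intro Max_ge) auto
    then have "X \<subseteq> {- int M..int M}" if "M \<ge> nat B" for M
      using that by (force simp: abs_le_iff)
    then show "\<forall>\<^sub>F M in sequentially. finite {- int M..int M} \<and> X \<subseteq> {- int M..int M} \<and> {- int M..int M} \<subseteq> UNIV"
      by (auto intro!: eventually_sequentiallyI)
  qed
  with assms show ?thesis unfolding has_sum_def by (rule filterlim_compose)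
qed

lemma sum_int_symmetric_telescope:
  fixes h :: "int \<Rightarrow> 'a :: ab_group_add"
  shows "(\<Sum>k\<in>{- int M..int M}. h (k - 1) - h (k + 1)) = h (- int M - 1) + h (- int M) - h (int M) - h (int M + 1)"
proof (induction M)
  case (Suc M)
  have "{- int (Suc M)..int (Suc M)} = insert (- int M - 1) (insert (int M + 1) {- int M..int M})" by auto
  then have "(\<Sum>k\<in>{- int (Suc M)..int (Suc M)}. h (k - 1) - h (k + 1))
    = (h (- int M - 1 - 1) - h (- int M - 1 + 1)) + ((h (int M + 1 - 1) - h (int M + 1 + 1)) + (\<Sum>k\<in>{- int M..int M}. h (k - 1) - h (k + 1)))"
    by simp
  also have "\<dots> = h (- int (Suc M) - 1) + h (- int (Suc M)) - h (int (Suc M)) - h (int (Suc M) + 1)"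
  proof -
    have "h (- int M - 1) = h (- 1 - int M)" by (rule arg_cong) simp
    then show ?thesis unfolding Suc.IH by (simp add: algebra_simps)
  qed
  finally show ?case .
qed simp

lemma sum_int_symmetric_split:
  fixes f :: "int \<Rightarrow> 'a :: comm_monoid_add"
  shows "(\<Sum>k\<in>{- int M..int M}. f k) = f 0 + (\<Sum>m<M. f (int (Suc m)) + f (- int (Suc m)))"
proof (induction M)
  case (Suc M)
  have "{- int (Suc M)..int (Suc M)} = insert (- int (Suc M)) (insert (int (Suc M)) {- int M..int M})" by auto
  then show ?case by (simp add: Suc.IH add_ac)
qed simp

lemma summable_on_int_iff_nat:
  fixes f :: "int \<Rightarrow> real"
  assumes "summable (\<lambda>n. f (int n))" "summable (\<lambda>n. f (- int n))" "\<And>k. f k \<ge> 0"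
  shows "f summable_on UNIV"
proof -
  have 1: "f summable_on range int"
    by (subst summable_on_reindex) (use assms in \<open>auto simp: o_def summable_on_UNIV_nonneg_real_iff\<close>)
  have 2: "f summable_on range (\<lambda>n. - int n)"
    by (subst summable_on_reindex) (use assms in \<open>auto simp: o_def inj_on_def summable_on_UNIV_nonneg_real_iff\<close>)
  have "range int \<union> range (\<lambda>n. - int n) = UNIV"
  proof -
    have "k \<in> range int \<union> range (\<lambda>n. - int n)" for k by (cases k rule: int_cases2) auto
    then show ?thesis by auto
  qed
  with summable_on_union[OF 1 2] show ?thesis by simp
qed

lemma sin_pi_nonzero:
  fixes z :: complex
  assumes "z \<notin> \<int>"
  shows "sin (of_real pi * z) \<noteq> 0"
proof
  assume "sin (of_real pi * z) = 0"
  then obtain k :: int where "of_real pi * z = of_real (real_of_int k * pi)"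
    unfolding sin_eq_0 by (metis of_real_mult of_real_of_int_eq)
  then have "z = of_int k" by (simp add: mult.commute)
  then show False using assms by simp
qed

section \<open>Partial fractions of the cotangent and of the inverse squared sine\<close>

text \<open>Differentiate the constant function Gamma(z) Gamma(1 - z) sin(pi z) = pi.\<close>

lemma Digamma_reflection:
  fixes z :: complex
  assumes z: "z \<notin> \<int>"
  shows "Digamma (1 - z) - Digamma z = of_real pi * cot (of_real pi * z)"
proof -
  have z': "1 - z \<notin> \<int>" using z by (metis Ints_1 Ints_diff diff_diff_eq2 diff_self diff_zero add_diff_cancel_left')
  have n: "w \<notin> \<int>\<^sub>\<le>\<^sub>0" if "w \<notin> \<int>" for w :: complex using that nonpos_Ints_Int by blast
  define F where "F = (\<lambda>w :: complex. Gamma w * Gamma (1 - w) * sin (of_real pi * w))"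
  have "(F has_field_derivative (Gamma z * Digamma z * Gamma (1 - z) - Gamma z * (Gamma (1 - z) * Digamma (1 - z))) * sin (of_real pi * z)
      + Gamma z * Gamma (1 - z) * (cos (of_real pi * z) * of_real pi)) (at z)"
    unfolding F_def using n[OF z] n[OF z'] by (auto intro!: derivative_eq_intros simp: algebra_simps)
  moreover have "(F has_field_derivative 0) (at z)"
  proof -
    have "\<forall>\<^sub>F w in nhds z. w \<in> - \<int>"
      using z closed_Ints by (intro eventually_nhds_in_open) (auto simp: open_Compl)
    then have ev: "\<forall>\<^sub>F w in nhds z. F w = of_real pi"
    proof eventually_elim
      case (elim w)
      then show ?case using sin_pi_nonzero[of w] unfolding F_def by (simp add: Gamma_reflection_complex)
    qed
    show ?thesis by (subst DERIV_cong_ev[OF refl ev refl]) simp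
  qed
  ultimately have "(Gamma z * Digamma z * Gamma (1 - z) - Gamma z * (Gamma (1 - z) * Digamma (1 - z))) * sin (of_real pi * z)
      + Gamma z * Gamma (1 - z) * (cos (of_real pi * z) * of_real pi) = 0"
    by (rule DERIV_unique)
  then have "Gamma z * Gamma (1 - z) * ((Digamma z - Digamma (1 - z)) * sin (of_real pi * z) + cos (of_real pi * z) * of_real pi) = 0"
    by (simp add: algebra_simps)
  moreover have "Gamma z * Gamma (1 - z) \<noteq> 0" using Gamma_eq_zero_iff n z z' by auto
  ultimately have "(Digamma z - Digamma (1 - z)) * sin (of_real pi * z) + cos (of_real pi * z) * of_real pi = 0" by simp
  then show ?thesis using sin_pi_nonzero[OF z] by (simp add: cot_def field_simps)
qed

text \<open>In the limit formulas for \<open>Digamma (1 - z)\<close> and \<open>Digamma z\<close>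
  the logarithms cancel, and the two sums are the terms k < 0 and 0 <= k < M; the added null
  sequence supplies the missing term k = M.\<close>

lemma cot_partial_fractions:
  fixes z :: complex
  assumes z: "z \<notin> \<int>"
  shows "(\<lambda>M. \<Sum>k\<in>{- int M..int M}. inverse (z + of_int k)) \<longlonglongrightarrow> of_real pi * cot (of_real pi * z)"
proof -
  have z': "1 - z \<noteq> 0" "z \<noteq> 0" using z by auto
  have "(\<lambda>m. (of_real (ln (real m)) - (\<Sum>n<m. inverse (1 - z + of_nat n))) -
     (of_real (ln (real m)) - (\<Sum>n<m. inverse (z + of_nat n)))) \<longlonglongrightarrow> Digamma (1 - z) - Digamma z"
    by (intro tendsto_diff Digamma_LIMSEQ z')
  moreover have "(\<lambda>m. inverse (z + of_nat m)) \<longlonglongrightarrow> 0"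
    by (intro filterlim_compose[OF tendsto_inverse_0] tendsto_add_filterlim_at_infinity[OF tendsto_const] tendsto_of_nat)
  ultimately have "(\<lambda>m. (of_real (ln (real m)) - (\<Sum>n<m. inverse (1 - z + of_nat n))) -
     (of_real (ln (real m)) - (\<Sum>n<m. inverse (z + of_nat n))) + inverse (z + of_nat m))
     \<longlonglongrightarrow> of_real pi * cot (of_real pi * z)"
    using tendsto_add Digamma_reflection[OF z] by fastforce
  moreover have "(\<Sum>k\<in>{- int M..int M}. inverse (z + of_int k)) =
    (of_real (ln (real M)) - (\<Sum>n<M. inverse (1 - z + of_nat n))) -
     (of_real (ln (real M)) - (\<Sum>n<M. inverse (z + of_nat n))) + inverse (z + of_nat M)" for M
  proof -
    have *: "inverse (z + - of_nat (Suc n)) = - inverse (1 - z + of_nat n)" for n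
      by (metis (no_types, lifting) add.commute add_uminus_conv_diff diff_diff_eq2 inverse_minus_eq minus_diff_eq of_nat_Suc)
    have "(\<Sum>k\<in>{- int M..int M}. inverse (z + of_int k)) =
       inverse z + (\<Sum>m<M. inverse (z + of_nat (Suc m))) + (\<Sum>m<M. inverse (z + - of_nat (Suc m)))"
      by (simp add: sum_int_symmetric_split sum.distrib add.assoc)
    also have "inverse z + (\<Sum>m<M. inverse (z + of_nat (Suc m))) = (\<Sum>m<Suc M. inverse (z + of_nat m))"
      by (subst sum.lessThan_Suc_shift) simp
    finally show ?thesis unfolding * by (simp add: sum_negf)
  qed
  ultimately show ?thesis by simp
qed

lemma Trigamma_reflection:
  fixes z :: complex
  assumes z: "z \<notin> \<int>"
  shows "Polygamma 1 z + Polygamma 1 (1 - z) = (of_real pi / sin (of_real pi * z))\<^sup>2"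
proof -
  have n: "w \<notin> \<int>\<^sub>\<le>\<^sub>0" if "w \<notin> \<int>" for w :: complex using that nonpos_Ints_Int by blast
  have z': "1 - z \<notin> \<int>" using z by (metis Ints_1 Ints_diff diff_diff_eq2 diff_self diff_zero add_diff_cancel_left')
  note sz = sin_pi_nonzero[OF z]
  have "((\<lambda>w. Digamma (1 - w) - Digamma w) has_field_derivative - Polygamma 1 (1 - z) - Polygamma 1 z) (at z)"
    using n[OF z] n[OF z'] by (auto intro!: derivative_eq_intros)
  moreover have "((\<lambda>w. Digamma (1 - w) - Digamma w) has_field_derivative
      of_real pi * (- inverse ((sin (of_real pi * z))\<^sup>2) * of_real pi)) (at z)"
  proof -
    have ev: "\<forall>\<^sub>F w in nhds z. w \<in> - \<int>"
      using z closed_Ints by (intro eventually_nhds_in_open) (auto simp: open_Compl)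
    then have ev: "\<forall>\<^sub>F w in nhds z. Digamma (1 - w) - Digamma w = of_real pi * cot (of_real pi * w)"
      by eventually_elim (simp add: Digamma_reflection)
    have "((\<lambda>w. of_real pi * cot (of_real pi * w)) has_field_derivative
      of_real pi * (- inverse ((sin (of_real pi * z))\<^sup>2) * of_real pi)) (at z)"
      using sz by (auto intro!: derivative_eq_intros DERIV_chain2[OF DERIV_cot])
    then show ?thesis by (subst DERIV_cong_ev[OF refl ev refl])
  qed
  ultimately have "- Polygamma 1 (1 - z) - Polygamma 1 z = of_real pi * (- inverse ((sin (of_real pi * z))\<^sup>2) * of_real pi)"
    by (rule DERIV_unique)
  then show ?thesis by (simp add: power2_eq_square field_simps)
qed

lemma inverse_sin_squared_partial_fractions:
  fixes z :: complex
  assumes z: "z \<notin> \<int>"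
  shows "(\<lambda>M. \<Sum>k\<in>{- int M..int M}. inverse ((z + of_int k)\<^sup>2)) \<longlonglongrightarrow> (of_real pi / sin (of_real pi * z))\<^sup>2"
proof -
  have z': "1 - z \<noteq> 0" "z \<noteq> 0" using z by auto
  have "(\<lambda>M. (\<Sum>n<Suc M. inverse ((z + of_nat n)\<^sup>2)) + (\<Sum>n<M. inverse ((1 - z + of_nat n)\<^sup>2))) \<longlonglongrightarrow> Polygamma 1 z + Polygamma 1 (1 - z)"
  proof (rule tendsto_add)
    show "(\<lambda>M. \<Sum>n<Suc M. inverse ((z + of_nat n)\<^sup>2)) \<longlonglongrightarrow> Polygamma 1 z"
      using Polygamma_LIMSEQ[OF z'(2), of 1] unfolding sums_def by (intro LIMSEQ_Suc) (simp add: power2_eq_square)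
    show "(\<lambda>M. \<Sum>n<M. inverse ((1 - z + of_nat n)\<^sup>2)) \<longlonglongrightarrow> Polygamma 1 (1 - z)"
      using Polygamma_LIMSEQ[OF z'(1), of 1] unfolding sums_def by (simp add: power2_eq_square)
  qed
  moreover have "(\<Sum>k\<in>{- int M..int M}. inverse ((z + of_int k)\<^sup>2)) =
     (\<Sum>n<Suc M. inverse ((z + of_nat n)\<^sup>2)) + (\<Sum>n<M. inverse ((1 - z + of_nat n)\<^sup>2))" for M
  proof -
    have *: "(1 - z + of_nat n)\<^sup>2 = (z + - of_nat (Suc n))\<^sup>2" for n by (simp add: power2_eq_square algebra_simps)
    show ?thesis unfolding * sum.lessThan_Suc_shift
      by (simp add: sum_int_symmetric_split sum.distrib add.assoc)
  qed
  ultimately show ?thesis using Trigamma_reflection[OF z] by simp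
qed

text \<open>Lipschitz's formula in weight 2. With w = exp(2 pi i z) one has sin^2(pi z) = -(1 - w)^2
  / (4 w), and w / (1 - w)^2 is the derived geometric series.\<close>

lemma inverse_sin_squared_nome:
  fixes z :: complex
  assumes z: "Im z > 0"
  shows "(\<lambda>d. - 4 * of_real pi ^ 2 * (of_nat (Suc d) * nome z ^ Suc d)) sums ((of_real pi / sin (of_real pi * z))\<^sup>2)"
proof -
  define w where "w = nome z"
  define e where "e = exp (\<i> * (of_real pi * z))"
  have w: "w = e ^ 2" unfolding w_def e_def nome_def by (simp add: exp_of_nat_mult[symmetric] mult_ac flip: exp_double)
  have e0: "e \<noteq> 0" by (simp add: e_def)
  have "norm w < 1" using z by (simp add: w_def nome_def)
  then have "(\<lambda>n. of_nat (Suc n) * w ^ n) sums (1 / (1 - w)^2)" by (rule geometric_deriv_sums)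
  then have "(\<lambda>n. - 4 * of_real pi ^ 2 * w * (of_nat (Suc n) * w ^ n)) sums (- 4 * of_real pi ^ 2 * w * (1 / (1 - w)^2))"
    by (rule sums_mult)
  also have "(\<lambda>n. - 4 * of_real pi ^ 2 * w * (of_nat (Suc n) * w ^ n)) = (\<lambda>d. - 4 * of_real pi ^ 2 * (of_nat (Suc d) * w ^ Suc d))"
    by (simp add: fun_eq_iff mult_ac)
  also have "- 4 * of_real pi ^ 2 * w * (1 / (1 - w)^2) = (of_real pi / sin (of_real pi * z))\<^sup>2"
  proof -
    have "sin (of_real pi * z) = (e - inverse e) / (2 * \<i>)"
      unfolding e_def sin_exp_eq by (simp add: exp_minus)
    then have "sin (of_real pi * z) = (w - 1) / (2 * \<i> * e)" using e0 by (simp add: w power2_eq_square field_simps)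
    then have "(of_real pi / sin (of_real pi * z))\<^sup>2 = of_real pi ^ 2 * (2 * \<i> * e) ^ 2 / (w - 1) ^ 2"
      by (simp add: power_divide power_mult_distrib)
    then show ?thesis by (simp add: power_mult_distrib w power2_commute)
  qed
  finally show ?thesis unfolding w_def .
qed

section \<open>The regularised weight 2 lattice sum\<close>

lemma lattice_norm_lower_bound:
  assumes "Im \<tau> > 0"
  obtains c :: real where "c > 0"
    "\<And>m n :: int. c * (\<bar>of_int m\<bar> + \<bar>of_int n\<bar>) \<le> norm (of_int m * \<tau> + of_int n)"
proof -
  define D where "D = 1 / Im \<tau> + 1 + norm \<tau> / Im \<tau>"
  have D: "D > 0" unfolding D_def using assms by (intro add_pos_nonneg) auto
  have "\<bar>of_int m\<bar> + \<bar>of_int n\<bar> \<le> D * norm (of_int m * \<tau> + of_int n)" for m n :: int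
  proof -
    define z where "z = of_int m * \<tau> + of_int n"
    have "\<bar>Im z\<bar> \<le> norm z" by (rule abs_Im_le_cmod)
    then have 1: "\<bar>of_int m\<bar> \<le> norm z / Im \<tau>" using assms
      by (simp add: z_def abs_mult field_simps)
    have "norm (of_int n :: complex) \<le> norm z + norm (of_int m * \<tau>)"
      unfolding z_def by (metis add_diff_cancel_left' norm_triangle_ineq4 add.commute)
    also have "norm (of_int m * \<tau>) \<le> norm z / Im \<tau> * norm \<tau>"
      using mult_right_mono[OF 1, of "norm \<tau>"] by (simp add: norm_mult)
    finally have "\<bar>of_int n\<bar> \<le> norm z + norm z / Im \<tau> * norm \<tau>" by simp
    with 1 show ?thesis unfolding D_def z_def[symmetric] by (simp add: algebra_simps)
  qed
  then have "1 / D * (\<bar>of_int m\<bar> + \<bar>of_int n\<bar>) \<le> norm (of_int m * \<tau> + of_int n)" for m n :: int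
    using D by (simp add: field_simps)
  with D show ?thesis by (intro that[of "1 / D"]) auto
qed

text \<open>Subtracting a telescoping term turns the conditionally convergent double series
  for the weight 2 Eisenstein series into an absolutely convergent one, so that the order of
  summation may be exchanged.\<close>

definition eis_term :: "complex \<Rightarrow> int \<times> int \<Rightarrow> complex" where
  "eis_term \<tau> = (\<lambda>(m, n). inverse ((of_int m * \<tau> + of_int n)\<^sup>2)
     - (inverse (of_int m * \<tau> + of_int (n - 1)) / 2 - inverse (of_int m * \<tau> + of_int (n + 1)) / 2))"

text \<open>With z = m \<tau> + n the term is -1 / (z^2 (z - 1) (z + 1)), of size |z|^(-4); the
  excluded points are those at which z, z - 1 or z + 1 vanishes. Bounding s from below separately by
  |m| and by |n| makes the majorant a product, so that it can be summed over m and n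
  independently.\<close>

lemma norm_eis_term_le:
  assumes c: "c > 0" "\<And>m n :: int. c * (\<bar>of_int m\<bar> + \<bar>of_int n\<bar>) \<le> norm (of_int m * \<tau> + of_int n)"
    and mn: "m \<noteq> 0 \<or> n \<notin> {-1, 0, 1}"
  shows "norm (eis_term \<tau> (m, n)) \<le> 144 / c ^ 4 * (1 / (1 + \<bar>of_int m\<bar>)\<^sup>2 * (1 / (1 + \<bar>of_int n\<bar>)\<^sup>2))"
proof -
  define z where "z = of_int m * \<tau> + of_int n"
  define s :: real where "s = \<bar>of_int m\<bar> + \<bar>of_int n\<bar>"
  have s1: "s \<ge> 1" using mn by (auto simp: s_def)
  have b: "c * s / 3 \<le> norm (of_int m * \<tau> + of_int k)" if "k = n \<or> k = n - 1 \<or> k = n + 1" for k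
  proof -
    have "\<bar>of_int m :: real\<bar> + \<bar>of_int k\<bar> \<ge> 1"
    proof -
      have "\<bar>m\<bar> + \<bar>k\<bar> \<ge> 1" using mn that by auto
      then show ?thesis by (metis of_int_1_le_iff of_int_abs of_int_add)
    qed
    moreover have "\<bar>of_int n :: real\<bar> \<le> \<bar>of_int k\<bar> + 1" using that by auto
    ultimately have "s / 3 \<le> \<bar>of_int m\<bar> + \<bar>of_int k\<bar>" unfolding s_def by argo
    then have "c * (s / 3) \<le> c * (\<bar>of_int m\<bar> + \<bar>of_int k\<bar>)" using c(1) by (intro mult_left_mono) auto
    also have "\<dots> \<le> norm (of_int m * \<tau> + of_int k)" by (rule c(2))
    finally show ?thesis by simp
  qed
  have cs: "c * s / 3 > 0" using c(1) s1 by simp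
  have b0: "c * s \<le> norm z" unfolding z_def s_def by (rule c(2))
  have b1: "c * s / 3 \<le> norm (z - 1)" using b[of "n - 1"] by (simp add: z_def algebra_simps)
  have b2: "c * s / 3 \<le> norm (z + 1)" using b[of "n + 1"] by (simp add: z_def algebra_simps)
  have nz: "z \<noteq> 0" "z - 1 \<noteq> 0" "z + 1 \<noteq> 0" using b0 b1 b2 cs by auto
  have "eis_term \<tau> (m, n) = inverse (z\<^sup>2) - (inverse (z - 1) / 2 - inverse (z + 1) / 2)"
    by (simp add: eis_term_def z_def algebra_simps)
  also have "\<dots> = - 1 / (z * z * ((z - 1) * (z + 1)))"
  proof -
    have "inverse (z - 1) - inverse (z + 1) = - (inverse (z - 1) * ((z - 1) - (z + 1)) * inverse (z + 1))"
      by (rule inverse_diff_inverse[OF nz(2,3)])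
    also have "(z - 1) - (z + 1) = - 2" by simp
    finally have 1: "inverse (z - 1) - inverse (z + 1) = 2 * (inverse (z - 1) * inverse (z + 1))" by simp
    have 1: "inverse (z - 1) / 2 - inverse (z + 1) / 2 = inverse ((z - 1) * (z + 1))"
      unfolding diff_divide_distrib[symmetric] 1 inverse_mult_distrib by simp
    have "inverse (z\<^sup>2) - inverse ((z - 1) * (z + 1)) = - (inverse (z\<^sup>2) * (z\<^sup>2 - (z - 1) * (z + 1)) * inverse ((z - 1) * (z + 1)))"
      using nz by (intro inverse_diff_inverse) auto
    also have "z\<^sup>2 - (z - 1) * (z + 1) = 1" by (simp add: power2_eq_square algebra_simps)
    finally show ?thesis unfolding 1 by (simp add: power2_eq_square field_simps)
  qed
  finally have "norm (eis_term \<tau> (m, n)) = 1 / (norm z * norm z * (norm (z - 1) * norm (z + 1)))"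
    by (simp add: norm_divide norm_mult)
  also have "\<dots> \<le> 1 / ((c * s) * (c * s) * ((c * s / 3) * (c * s / 3)))"
    using cs b0 b1 b2 c(1) s1 nz by (intro divide_left_mono mult_mono mult_pos_pos) auto
  also have "\<dots> = 9 / c ^ 4 * (1 / s\<^sup>2 * (1 / s\<^sup>2))"
    by (simp add: power2_eq_square power4_eq_xxxx)
  also have "\<dots> \<le> 9 / c ^ 4 * (4 / (1 + \<bar>of_int m\<bar>)\<^sup>2 * (4 / (1 + \<bar>of_int n\<bar>)\<^sup>2))"
  proof -
    have "1 / s\<^sup>2 \<le> 4 / (1 + x)\<^sup>2" if "0 \<le> x" "x \<le> s" for x
    proof -
      have "(1 + x)\<^sup>2 \<le> (2 * s)\<^sup>2" using that s1 by (intro power_mono) auto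
      moreover have "(1 + x)\<^sup>2 > 0" using that by simp
      ultimately show ?thesis using s1 by (simp add: field_simps)
    qed
    then show ?thesis using c(1) by (intro mult_left_mono mult_mono) (auto simp: s_def)
  qed
  finally show ?thesis by (simp add: field_simps)
qed

lemma eis_term_summable:
  assumes "Im \<tau> > 0"
  shows "eis_term \<tau> summable_on UNIV"
proof -
  obtain c where c: "c > 0" "\<And>m n :: int. c * (\<bar>of_int m\<bar> + \<bar>of_int n\<bar>) \<le> norm (of_int m * \<tau> + of_int n)"
    using lattice_norm_lower_bound[OF assms] by blast
  define w :: "int \<Rightarrow> real" where "w = (\<lambda>k. 1 / (1 + \<bar>of_int k\<bar>)\<^sup>2)"
  have "summable (\<lambda>n. 1 / (1 + real n)\<^sup>2)"
    using sums_summable[OF inverse_squares_sums] by (simp add: add.commute)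
  then have ws: "w summable_on UNIV"
    by (intro summable_on_int_iff_nat) (auto simp: w_def)
  have "((\<lambda>n. w m * w n) has_sum w m * infsum w UNIV) UNIV" for m
    by (intro has_sum_cmult_right has_sum_infsum ws)
  then have "(\<lambda>(m, n). w m * w n) summable_on (UNIV \<times> UNIV)"
    using ws by (intro summable_on_SigmaI[where g = "\<lambda>m. w m * infsum w UNIV"] summable_on_cmult_left)
      (auto simp: w_def)
  then have "(\<lambda>x. 144 / c ^ 4 * (case x of (m, n) \<Rightarrow> w m * w n)) summable_on UNIV"
    by (intro summable_on_cmult_right) simp
  then have "(\<lambda>x. 144 / c ^ 4 * (case x of (m, n) \<Rightarrow> w m * w n)) summable_on (UNIV - {0} \<times> {-1, 0, 1})"
    by (rule summable_on_subset) auto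
  then have "(\<lambda>x. norm (eis_term \<tau> x)) summable_on (UNIV - {0} \<times> {-1, 0, 1})"
  proof (rule Infinite_Sum.abs_summable_on_comparison_test')
    fix x :: "int \<times> int" assume x: "x \<in> UNIV - {0} \<times> {-1, 0, 1}"
    obtain m n where mn: "x = (m, n)" by force
    then have "m \<noteq> 0 \<or> n \<notin> {-1, 0, 1}" using x by blast
    from norm_eis_term_le[OF c this]
    show "norm (eis_term \<tau> x) \<le> 144 / c ^ 4 * (case x of (m, n) \<Rightarrow> w m * w n)"
      unfolding mn prod.case w_def .
  qed
  then have "eis_term \<tau> summable_on (UNIV - {0} \<times> {-1, 0, 1})"
    by (rule abs_summable_summable)
  moreover have "eis_term \<tau> summable_on ({0} \<times> {-1, 0, 1})" by (rule summable_on_finite) auto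
  ultimately have "eis_term \<tau> summable_on ((UNIV - {0} \<times> {-1, 0, 1}) \<union> {0} \<times> {-1, 0, 1})"
    by (rule summable_on_union)
  moreover have "(UNIV - X) \<union> X = UNIV" for X :: "(int \<times> int) set" by blast
  ultimately show ?thesis by (simp only:)
qed

text \<open>The value at 0 is the sum of 1 / k^2 over all nonzero integers k: this is what the row m
  = 0 contributes, since \<open>inverse 0 = 0\<close> drops the term k = 0.\<close>

definition inv_sin_sq :: "complex \<Rightarrow> complex" where
  "inv_sin_sq z = (if z = 0 then of_real pi ^ 2 / 3 else (of_real pi / sin (of_real pi * z))\<^sup>2)"

lemma inv_sin_sq_minus: "inv_sin_sq (- z) = inv_sin_sq z"
  by (simp add: inv_sin_sq_def)

lemma inv_sin_sq_partial_fractions: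
  assumes "z = 0 \<or> Im z \<noteq> 0"
  shows "(\<lambda>M. \<Sum>k\<in>{- int M..int M}. inverse ((z + of_int k)\<^sup>2)) \<longlonglongrightarrow> inv_sin_sq z"
proof (cases "z = 0")
  case False
  then have "z \<notin> \<int>" using assms by (auto elim!: Ints_cases)
  then show ?thesis using inverse_sin_squared_partial_fractions[of z] False by (simp add: inv_sin_sq_def)
next
  case True
  have "(\<lambda>n. of_real (1 / (real n + 1)\<^sup>2) + of_real (1 / (real n + 1)\<^sup>2)) sums (of_real (pi\<^sup>2 / 6) + of_real (pi\<^sup>2 / 6) :: complex)"
    using inverse_squares_sums by (intro sums_add sums_of_real) (simp_all only: of_nat_power of_nat_add of_nat_1)
  then have "(\<lambda>M. \<Sum>n<M. of_real (1 / (real n + 1)\<^sup>2) + of_real (1 / (real n + 1)\<^sup>2)) \<longlonglongrightarrow> (of_real pi ^ 2 / 3 :: complex)"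
    unfolding sums_def by simp
  moreover have "(\<Sum>k\<in>{- int M..int M}. inverse ((of_int k)\<^sup>2)) =
     (\<Sum>n<M. of_real (1 / (real n + 1)\<^sup>2) + of_real (1 / (real n + 1)\<^sup>2) :: complex)" for M
    unfolding sum_int_symmetric_split by (simp add: field_simps power2_eq_square)
  ultimately show ?thesis using True by (simp add: inv_sin_sq_def)
qed

section \<open>Row sums, column sums and their difference\<close>

lemma tendsto_inverse_shift_0:
  "(\<lambda>N. inverse (z + of_int (int N + a)) :: complex) \<longlonglongrightarrow> 0"
  "(\<lambda>N. inverse (z + of_int (- int N + a)) :: complex) \<longlonglongrightarrow> 0"
proof -
  have 1: "(\<lambda>N. inverse (w + of_nat N) :: complex) \<longlonglongrightarrow> 0" for w
    by (intro filterlim_compose[OF tendsto_inverse_0] tendsto_add_filterlim_at_infinity[OF tendsto_const] tendsto_of_nat)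
  show "(\<lambda>N. inverse (z + of_int (int N + a)) :: complex) \<longlonglongrightarrow> 0"
    using 1[of "z + of_int a"] by (simp add: add_ac)
  have "(\<lambda>N. - inverse (- (z + of_int a) + of_nat N) :: complex) \<longlonglongrightarrow> - 0" by (intro tendsto_minus 1)
  moreover have "- inverse (- (z + of_int a) + of_nat N) = inverse (z + of_int (- int N + a))" for N
    by (subst inverse_minus_eq[symmetric]) (simp add: algebra_simps)
  ultimately show "(\<lambda>N. inverse (z + of_int (- int N + a)) :: complex) \<longlonglongrightarrow> 0" by simp
qed

text \<open>Along a row the correction telescopes to values at the two ends, which tend to 0, so the
  correction leaves the row sum unchanged.\<close>

lemma eis_term_row_has_sum:
  assumes "Im \<tau> > 0"
  shows "((\<lambda>n. eis_term \<tau> (m, n)) has_sum inv_sin_sq (of_int m * \<tau>)) UNIV"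
proof -
  define z where "z = of_int m * \<tau>"
  define h where "h = (\<lambda>k :: int. inverse (z + of_int k) / 2)"
  have "eis_term \<tau> summable_on ({m} \<times> UNIV)"
    using eis_term_summable[OF assms] by (rule summable_on_subset) auto
  then have "(\<lambda>n. eis_term \<tau> (m, n)) summable_on UNIV"
    using summable_on_SigmaD1[of "\<lambda>a b. eis_term \<tau> (a, b)" "{m}" "\<lambda>_. UNIV" m] by simp
  then obtain S where S: "((\<lambda>n. eis_term \<tau> (m, n)) has_sum S) UNIV" by (auto simp: summable_on_def)
  then have "(\<lambda>M. \<Sum>n\<in>{- int M..int M}. eis_term \<tau> (m, n)) \<longlonglongrightarrow> S" by (rule has_sum_int_symmetric)
  moreover have "(\<lambda>M. \<Sum>n\<in>{- int M..int M}. eis_term \<tau> (m, n)) \<longlonglongrightarrow> inv_sin_sq z - (0 / 2 + 0 / 2 - 0 / 2 - 0 / 2)"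
  proof -
    have "(\<lambda>M. (\<Sum>k\<in>{- int M..int M}. inverse ((z + of_int k)\<^sup>2))
        - (h (- int M - 1) + h (- int M) - h (int M) - h (int M + 1))) \<longlonglongrightarrow> inv_sin_sq z - (0 / 2 + 0 / 2 - 0 / 2 - 0 / 2)"
      unfolding h_def
      using tendsto_inverse_shift_0[of z 0] tendsto_inverse_shift_0(2)[of z "-1"] tendsto_inverse_shift_0(1)[of z 1]
      by (intro tendsto_diff tendsto_add tendsto_divide tendsto_const inv_sin_sq_partial_fractions)
         (use assms in \<open>auto simp: z_def\<close>)
    moreover have "(\<Sum>n\<in>{- int M..int M}. eis_term \<tau> (m, n)) = (\<Sum>k\<in>{- int M..int M}. inverse ((z + of_int k)\<^sup>2))
        - (h (- int M - 1) + h (- int M) - h (int M) - h (int M + 1))" for M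
      unfolding sum_int_symmetric_telescope[symmetric] sum_subtractf[symmetric]
      by (simp add: eis_term_def h_def z_def)
    ultimately show ?thesis by simp
  qed
  ultimately have "S = inv_sin_sq z - (0 / 2 + 0 / 2 - 0 / 2 - 0 / 2)" by (rule LIMSEQ_unique)
  then show ?thesis using S by (simp add: z_def)
qed

definition eis_sum :: "complex \<Rightarrow> complex" where
  "eis_sum \<tau> = infsum (eis_term \<tau>) UNIV"

lemma eis_sum_rows:
  assumes "Im \<tau> > 0"
  shows "((\<lambda>m. inv_sin_sq (of_int m * \<tau>)) has_sum eis_sum \<tau>) UNIV"
proof -
  have "(eis_term \<tau> has_sum eis_sum \<tau>) (UNIV \<times> UNIV)"
    using eis_term_summable[OF assms] by (simp add: eis_sum_def)
  then show ?thesis by (rule has_sum_SigmaD) (rule eis_term_row_has_sum[OF assms])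
qed

text \<open>The sum of 1 / (m \<tau> + n) over m in symmetric order. At n = 0 the convention for
  division by zero gives \<open>cot 0 = 0\<close>, which is the correct value.\<close>

definition cot_sum :: "complex \<Rightarrow> int \<Rightarrow> complex" where
  "cot_sum \<tau> n = of_real pi / \<tau> * cot (of_real pi * (of_int n / \<tau>))"

lemma cot_sum_minus: "cot_sum \<tau> (- n) = - cot_sum \<tau> n"
  by (simp add: cot_sum_def)

lemma cot_sum_partial_fractions:
  assumes "Im \<tau> > 0"
  shows "(\<lambda>M. \<Sum>m\<in>{- int M..int M}. inverse (of_int m * \<tau> + of_int n)) \<longlonglongrightarrow> cot_sum \<tau> n"
proof (cases "n = 0")
  case True
  have "(\<Sum>m\<in>{- int M..int M}. inverse (of_int m * \<tau>)) = 0" for M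
    by (simp only: sum_int_symmetric_split of_int_minus mult_minus_left inverse_minus_eq add.right_inverse) simp
  then show ?thesis using True by (simp add: cot_sum_def)
next
  case False
  have \<tau>: "\<tau> \<noteq> 0" using assms by auto
  have "Im (of_int n / \<tau>) \<noteq> 0" using False assms \<tau> by (simp add: Im_divide complex_eq_iff)
  then have "of_int n / \<tau> \<notin> \<int>" by (auto elim!: Ints_cases)
  then have "(\<lambda>M. inverse \<tau> * (\<Sum>m\<in>{- int M..int M}. inverse (of_int n / \<tau> + of_int m))) \<longlonglongrightarrow>
     inverse \<tau> * (of_real pi * cot (of_real pi * (of_int n / \<tau>)))"
    by (intro tendsto_mult tendsto_const cot_partial_fractions)
  moreover have "inverse \<tau> * inverse (of_int n / \<tau> + of_int m) = inverse (of_int m * \<tau> + of_int n)" for m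
    using \<tau> by (subst inverse_mult_distrib[symmetric]) (simp add: algebra_simps)
  ultimately show ?thesis by (simp add: cot_sum_def sum_distrib_left field_simps)
qed

text \<open>The points n / \<tau> run into the lower half plane, where the cotangent tends to \<i>;
  the rate is given by powers of \<open>v\<close>, which lies in the unit disc.\<close>

lemma cot_sum_tendsto:
  assumes "Im \<tau> > 0"
  shows "(\<lambda>N. cot_sum \<tau> (int N)) \<longlonglongrightarrow> of_real pi / \<tau> * \<i>"
proof -
  have \<tau>: "\<tau> \<noteq> 0" using assms by auto
  define v where "v = exp (- (2 * \<i> * (of_real pi / \<tau>)))"
  have "Re (- (2 * \<i> * x)) = 2 * Im x" for x by simp
  then have "Re (- (2 * \<i> * (of_real pi / \<tau>))) = 2 * Im (of_real pi / \<tau>)" .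
  also have "\<dots> = - (2 * (pi * Im \<tau> / (norm \<tau>)\<^sup>2))" by (simp add: Im_divide cmod_power2)
  also have "\<dots> < 0" using assms \<tau> by simp
  finally have "norm v < 1" by (simp add: v_def)
  then have v0: "(\<lambda>N. v ^ N) \<longlonglongrightarrow> 0" by (rule LIMSEQ_power_zero)
  have c: "cot (of_real pi * (of_int (int N) / \<tau>)) = \<i> * ((1 + v ^ N) / (1 - v ^ N))" for N
  proof -
    define w where "w = of_real pi * (of_int (int N) / \<tau>)"
    define e where "e = exp (\<i> * w)"
    have e: "e \<noteq> 0" by (simp add: e_def)
    have "v ^ N = exp (- (2 * (\<i> * w)))" unfolding v_def w_def exp_of_nat_mult[symmetric]
      by (simp add: field_simps)
    also have "\<dots> = inverse (e * e)" unfolding e_def exp_minus by (simp add: exp_double power2_eq_square)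
    finally have vN: "v ^ N = inverse e * inverse e" by simp
    have "cot w = ((e + inverse e) / 2) / ((e - inverse e) / (2 * \<i>))"
      unfolding cot_def cos_exp_eq sin_exp_eq e_def by (simp add: exp_minus)
    also have "\<dots> = \<i> * ((e + inverse e) / (e - inverse e))"
    proof -
      have "a / 2 / (b / (2 * \<i>)) = \<i> * (a / b)" for a b :: complex by (cases "b = 0") (simp_all add: field_simps)
      then show ?thesis .
    qed
    also have "(e + inverse e) / (e - inverse e) = (inverse e * (e + inverse e)) / (inverse e * (e - inverse e))"
      using e by simp
    also have "\<dots> = (1 + v ^ N) / (1 - v ^ N)" unfolding vN using e by (simp add: algebra_simps)
    finally show ?thesis unfolding w_def .
  qed
  have "(\<lambda>N. of_real pi / \<tau> * (\<i> * ((1 + v ^ N) / (1 - v ^ N)))) \<longlonglongrightarrow> of_real pi / \<tau> * (\<i> * ((1 + 0) / (1 - 0)))"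
    by (intro tendsto_intros v0) auto
  then show ?thesis unfolding cot_sum_def c by simp
qed

text \<open>Pulling \<tau> out of m \<tau> + n turns a column into a row for -1/\<tau>. This time
  the correction does not telescope and leaves a difference of two cotangents.\<close>

lemma eis_term_column_has_sum:
  assumes "Im \<tau> > 0"
  shows "((\<lambda>m. eis_term \<tau> (m, n)) has_sum
     (inv_sin_sq (of_int n * (- 1 / \<tau>)) / \<tau>\<^sup>2 - (cot_sum \<tau> (n - 1) / 2 - cot_sum \<tau> (n + 1) / 2))) UNIV"
    (is "(_ has_sum ?C) _")
proof -
  have \<tau>: "\<tau> \<noteq> 0" using assms by auto
  have "(\<lambda>(n, m). eis_term \<tau> (m, n)) summable_on (UNIV \<times> UNIV)"
    using eis_term_summable[OF assms] summable_on_swap[of "eis_term \<tau>" UNIV UNIV] by simp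
  then have "(\<lambda>(n, m). eis_term \<tau> (m, n)) summable_on ({n} \<times> UNIV)"
    by (rule summable_on_subset) auto
  then have "(\<lambda>m. eis_term \<tau> (m, n)) summable_on UNIV"
    using summable_on_SigmaD1[of "\<lambda>a b. eis_term \<tau> (b, a)" "{n}" "\<lambda>_. UNIV" n] by simp
  then obtain S where S: "((\<lambda>m. eis_term \<tau> (m, n)) has_sum S) UNIV" by (auto simp: summable_on_def)
  then have "(\<lambda>M. \<Sum>m\<in>{- int M..int M}. eis_term \<tau> (m, n)) \<longlonglongrightarrow> S" by (rule has_sum_int_symmetric)
  moreover have "(\<lambda>M. \<Sum>m\<in>{- int M..int M}. eis_term \<tau> (m, n)) \<longlonglongrightarrow> ?C"
  proof -
    have "(\<lambda>M. (\<Sum>m\<in>{- int M..int M}. inverse ((of_int n / \<tau> + of_int m)\<^sup>2)) / \<tau>\<^sup>2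
        - ((\<Sum>m\<in>{- int M..int M}. inverse (of_int m * \<tau> + of_int (n - 1))) / 2
         - (\<Sum>m\<in>{- int M..int M}. inverse (of_int m * \<tau> + of_int (n + 1))) / 2)) \<longlonglongrightarrow>
       inv_sin_sq (of_int n / \<tau>) / \<tau>\<^sup>2 - (cot_sum \<tau> (n - 1) / 2 - cot_sum \<tau> (n + 1) / 2)"
      by (intro tendsto_diff tendsto_divide tendsto_const inv_sin_sq_partial_fractions cot_sum_partial_fractions assms)
         (use assms \<tau> in \<open>auto simp: Im_divide sum_power2_eq_zero_iff\<close>)
    moreover have "inverse ((of_int n / \<tau> + of_int m)\<^sup>2) / \<tau>\<^sup>2 = inverse ((of_int m * \<tau> + of_int n)\<^sup>2)" for m
    proof -
      have "of_int m * \<tau> + of_int n = \<tau> * (of_int n / \<tau> + of_int m)" using \<tau> by (simp add: algebra_simps)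
      then show ?thesis by (simp only: power_mult_distrib inverse_mult_distrib divide_inverse mult.commute)
    qed
    moreover have "inv_sin_sq (of_int n * (- 1 / \<tau>)) = inv_sin_sq (of_int n / \<tau>)"
      using inv_sin_sq_minus[of "of_int n / \<tau>"] by simp
    ultimately show ?thesis
      by (simp add: eis_term_def sum_divide_distrib sum_subtractf)
  qed
  ultimately have "S = ?C" by (rule LIMSEQ_unique)
  then show ?thesis using S by simp
qed

text \<open>Summing the columns over n makes the cotangents telescope. Their limits at both ends add
  up to 2 pi \<i> / \<tau>, which is the failure of E2 to be modular.\<close>

lemma eis_sum_transformation:
  assumes "Im \<tau> > 0"
  shows "eis_sum (- 1 / \<tau>) = \<tau>\<^sup>2 * eis_sum \<tau> - 2 * of_real pi * \<i> * \<tau>"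
proof -
  have \<tau>: "\<tau> \<noteq> 0" using assms by auto
  have im: "Im (- 1 / \<tau>) > 0" using assms \<tau> by (simp add: Im_divide complex_eq_iff sum_power2_gt_zero_iff)
  have "((\<lambda>(n, m). eis_term \<tau> (m, n)) has_sum eis_sum \<tau>) (UNIV \<times> UNIV)"
    using has_sum_infsum[OF eis_term_summable[OF assms]] has_sum_swap[where f = "eis_term \<tau>" and A = UNIV and B = UNIV]
    unfolding eis_sum_def by (simp only: UNIV_Times_UNIV)
  then have "((\<lambda>n. inv_sin_sq (of_int n * (- 1 / \<tau>)) / \<tau>\<^sup>2 - (cot_sum \<tau> (n - 1) / 2 - cot_sum \<tau> (n + 1) / 2)) has_sum eis_sum \<tau>) UNIV"
    by (rule has_sum_SigmaD) (use eis_term_column_has_sum[OF assms] in auto)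
  then have "(\<lambda>N. \<Sum>n\<in>{- int N..int N}. inv_sin_sq (of_int n * (- 1 / \<tau>)) / \<tau>\<^sup>2 - (cot_sum \<tau> (n - 1) / 2 - cot_sum \<tau> (n + 1) / 2)) \<longlonglongrightarrow> eis_sum \<tau>"
    by (rule has_sum_int_symmetric)
  also have "(\<lambda>N. \<Sum>n\<in>{- int N..int N}. inv_sin_sq (of_int n * (- 1 / \<tau>)) / \<tau>\<^sup>2 - (cot_sum \<tau> (n - 1) / 2 - cot_sum \<tau> (n + 1) / 2))
    = (\<lambda>N. (\<Sum>n\<in>{- int N..int N}. inv_sin_sq (of_int n * (- 1 / \<tau>))) / \<tau>\<^sup>2 + (cot_sum \<tau> (int N) + cot_sum \<tau> (int (Suc N))))"
  proof
    fix N
    have "(\<Sum>n\<in>{- int N..int N}. cot_sum \<tau> (n - 1) / 2 - cot_sum \<tau> (n + 1) / 2) = - (cot_sum \<tau> (int N) + cot_sum \<tau> (int (Suc N)))"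
      unfolding sum_int_symmetric_telescope[of "\<lambda>n. cot_sum \<tau> n / 2"]
    proof -
      have "- int N - 1 = - (int N + 1)" "int (Suc N) = int N + 1" by simp_all
      then show "cot_sum \<tau> (- int N - 1) / 2 + cot_sum \<tau> (- int N) / 2 - cot_sum \<tau> (int N) / 2 - cot_sum \<tau> (int N + 1) / 2
          = - (cot_sum \<tau> (int N) + cot_sum \<tau> (int (Suc N)))"
        by (simp only: cot_sum_minus) (simp add: field_simps)
    qed
    then show "(\<Sum>n\<in>{- int N..int N}. inv_sin_sq (of_int n * (- 1 / \<tau>)) / \<tau>\<^sup>2 - (cot_sum \<tau> (n - 1) / 2 - cot_sum \<tau> (n + 1) / 2))
      = (\<Sum>n\<in>{- int N..int N}. inv_sin_sq (of_int n * (- 1 / \<tau>))) / \<tau>\<^sup>2 + (cot_sum \<tau> (int N) + cot_sum \<tau> (int (Suc N)))"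
      by (simp add: sum_subtractf sum_divide_distrib)
  qed
  finally have "(\<lambda>N. (\<Sum>n\<in>{- int N..int N}. inv_sin_sq (of_int n * (- 1 / \<tau>))) / \<tau>\<^sup>2 + (cot_sum \<tau> (int N) + cot_sum \<tau> (int (Suc N)))) \<longlonglongrightarrow> eis_sum \<tau>" .
  moreover have "(\<lambda>N. (\<Sum>n\<in>{- int N..int N}. inv_sin_sq (of_int n * (- 1 / \<tau>))) / \<tau>\<^sup>2 + (cot_sum \<tau> (int N) + cot_sum \<tau> (int (Suc N))))
     \<longlonglongrightarrow> eis_sum (- 1 / \<tau>) / \<tau>\<^sup>2 + (of_real pi / \<tau> * \<i> + of_real pi / \<tau> * \<i>)"
    using \<tau> by (intro tendsto_intros has_sum_int_symmetric eis_sum_rows[OF im] cot_sum_tendsto[OF assms]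
        LIMSEQ_Suc[OF cot_sum_tendsto[OF assms]]) auto
  ultimately have "eis_sum \<tau> = eis_sum (- 1 / \<tau>) / \<tau>\<^sup>2 + (of_real pi / \<tau> * \<i> + of_real pi / \<tau> * \<i>)"
    by (rule LIMSEQ_unique)
  then show ?thesis using \<tau> by (simp add: field_simps power2_eq_square)
qed

section \<open>Lambert series and the transformation of E2\<close>

text \<open>The double series of d q^(m d) converges absolutely, so it may be regrouped by the
  product m d along the bijection (m, d) -> (m d, d). Positive integers are coded by their
  predecessors throughout.\<close>

lemma sums_divisor_sigma:
  fixes q :: complex
  assumes q: "norm q < 1" and g: "\<And>m. (\<lambda>d. of_nat (Suc d) * q ^ (Suc m * Suc d)) sums g m"
  shows "\<exists>S. g sums S \<and> (\<lambda>n. of_nat (divisor_sigma 1 (Suc n)) * q ^ Suc n) sums S"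
proof -
  define f where "f = (\<lambda>(m, d). of_nat (Suc d) * q ^ (Suc m * Suc d))"
  define r where "r = norm q"
  have r: "0 \<le> r" "r < 1" using q by (auto simp: r_def)
  have sr: "summable (\<lambda>d. real (Suc d) * r ^ d)" using geometric_deriv_sums[of r] r by (simp add: sums_iff)
  have sr': "summable (\<lambda>m. r ^ m)" using r by (simp add: summable_geometric)
  have bound: "norm (f (m, d)) \<le> r ^ m * (real (Suc d) * r ^ d)" for m d
  proof -
    have "r ^ (Suc m * Suc d) \<le> r ^ (m + d)" using r by (intro power_decreasing) auto
    then have "real (Suc d) * r ^ (Suc m * Suc d) \<le> real (Suc d) * r ^ (m + d)" by (intro mult_left_mono) auto
    then show ?thesis
      by (simp only: f_def prod.case norm_mult norm_power r_def[symmetric] norm_of_nat power_add mult_ac)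
  qed
  have "((\<lambda>d. r ^ m * (real (Suc d) * r ^ d)) has_sum r ^ m * infsum (\<lambda>d. real (Suc d) * r ^ d) UNIV) UNIV" for m
    using sr r by (intro has_sum_cmult_right has_sum_infsum) (subst summable_on_UNIV_nonneg_real_iff, auto)
  moreover have "(\<lambda>m. r ^ m * infsum (\<lambda>d. real (Suc d) * r ^ d) UNIV) summable_on UNIV"
    using sr' r by (intro summable_on_cmult_left) (subst summable_on_UNIV_nonneg_real_iff, auto)
  ultimately have "(\<lambda>(m, d). r ^ m * (real (Suc d) * r ^ d)) summable_on (UNIV \<times> UNIV)"
    using r by (intro summable_on_SigmaI[where g = "\<lambda>m. r ^ m * infsum (\<lambda>d. real (Suc d) * r ^ d) UNIV"]) auto
  then have "(\<lambda>x. norm (f x)) summable_on (UNIV \<times> UNIV)"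
  proof (rule Infinite_Sum.abs_summable_on_comparison_test')
    fix x :: "nat \<times> nat"
    show "norm (f x) \<le> (case x of (m, d) \<Rightarrow> r ^ m * (real (Suc d) * r ^ d))"
      using bound by (cases x) auto
  qed
  then have fs: "f summable_on (UNIV \<times> UNIV)" by (rule abs_summable_summable)
  define S where "S = infsum f (UNIV \<times> UNIV)"
  have S: "(f has_sum S) (UNIV \<times> UNIV)" using fs by (simp add: S_def)
  have "((\<lambda>d. f (m, d)) has_sum g m) UNIV" for m
  proof -
    have "f summable_on ({m} \<times> UNIV)" using fs by (rule summable_on_subset) auto
    then have "(\<lambda>d. f (m, d)) summable_on UNIV"
      using summable_on_SigmaD1[of "\<lambda>a b. f (a, b)" "{m}" "\<lambda>_. UNIV" m] by simp
    then obtain s where s: "((\<lambda>d. f (m, d)) has_sum s) UNIV" by (auto simp: summable_on_def)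
    then have "(\<lambda>d. f (m, d)) sums s" by (rule has_sum_imp_sums)
    then show ?thesis using s g[of m] by (auto simp: f_def dest: sums_unique2)
  qed
  then have "(g has_sum S) UNIV" using S by (intro has_sum_SigmaD[OF S]) auto
  then have 1: "g sums S" by (rule has_sum_imp_sums)
  define h where "h = (\<lambda>(n, d). of_nat d * q ^ Suc n)"
  have bij: "bij_betw (\<lambda>(m, d). (Suc m * Suc d - 1, Suc d)) (UNIV \<times> UNIV) (Sigma UNIV (\<lambda>n. {d. d dvd Suc n}))"
  proof (rule bij_betwI[where g = "\<lambda>(n, d). (Suc n div d - 1, d - 1)"])
    show "(\<lambda>(m, d). (Suc m * Suc d - 1, Suc d)) \<in> UNIV \<times> UNIV \<rightarrow> Sigma UNIV (\<lambda>n. {d. d dvd Suc n})"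
    proof (rule Pi_I)
      fix x :: "nat \<times> nat"
      obtain m d where x: "x = (m, d)" by force
      have "Suc (Suc m * Suc d - 1) = Suc m * Suc d" by simp
      then have "Suc d dvd Suc (Suc m * Suc d - 1)" by (metis dvd_triv_right)
      then show "(case x of (m, d) \<Rightarrow> (Suc m * Suc d - 1, Suc d)) \<in> Sigma UNIV (\<lambda>n. {d. d dvd Suc n})"
        unfolding x prod.case by blast
    qed
    fix x :: "nat \<times> nat"
    obtain m d where x: "x = (m, d)" by force
    have "Suc (Suc m * Suc d - 1) = Suc m * Suc d" by simp
    then show "(\<lambda>(n, d). (Suc n div d - 1, d - 1)) ((\<lambda>(m, d). (Suc m * Suc d - 1, Suc d)) x) = x"
      unfolding x prod.case by (simp only: nonzero_mult_div_cancel_right) simp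
  next
    fix y assume "y \<in> Sigma UNIV (\<lambda>n. {d. d dvd Suc n})"
    then obtain n d k where y: "y = (n, d)" "Suc n = d * k" by (auto elim!: dvdE)
    then have "d > 0" "k > 0" by (auto intro!: Nat.gr0I)
    moreover from this y have "Suc n div d = k" by simp
    moreover have "Suc (k - 1) * Suc (d - 1) - 1 = n" using calculation y(2) by (simp add: mult.commute)
    ultimately show "(\<lambda>(m, d). (Suc m * Suc d - 1, Suc d)) ((\<lambda>(n, d). (Suc n div d - 1, d - 1)) y) = y"
      unfolding y(1) prod.case by simp
  qed auto
  have "(h has_sum S) (Sigma UNIV (\<lambda>n. {d. d dvd Suc n}))"
  proof (subst has_sum_reindex_bij_betw[OF bij, symmetric])
    have "h (case x of (m, d) \<Rightarrow> (Suc m * Suc d - 1, Suc d)) = f x" for x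
      by (cases x) (simp add: h_def f_def)
    then show "((\<lambda>x. h (case x of (m, d) \<Rightarrow> (Suc m * Suc d - 1, Suc d))) has_sum S) (UNIV \<times> UNIV)"
      using S by simp
  qed
  then have "((\<lambda>n. \<Sum>d\<in>{d. d dvd Suc n}. h (n, d)) has_sum S) UNIV"
    by (rule has_sum_SigmaD) (auto intro!: has_sum_finite)
  then have "(\<lambda>n. \<Sum>d\<in>{d. d dvd Suc n}. h (n, d)) sums S" by (rule has_sum_imp_sums)
  also have "(\<lambda>n. \<Sum>d\<in>{d. d dvd Suc n}. h (n, d)) = (\<lambda>n. of_nat (divisor_sigma 1 (Suc n)) * q ^ Suc n)"
    by (simp add: h_def divisor_sigma_def sum_distrib_right)
  finally show ?thesis using 1 by blast
qed

lemma norm_nome_less_1: "Im \<tau> > 0 \<Longrightarrow> norm (nome \<tau>) < 1"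
  by (simp add: nome_def)

text \<open>The row m = 0 gives pi^2 / 3 and the rows m and -m agree, so the total is pi^2 / 3 - 8
  pi^2 times the Lambert series. Running this for every \<tau> also yields convergence of the series
  in the definition of \<open>E2\<close>.\<close>

lemma E2_eq_eis_sum:
  assumes "Im \<tau> > 0"
  shows "eis_sum \<tau> = of_real pi ^ 2 / 3 * E2 \<tau>"
    and "summable (\<lambda>n. of_nat (divisor_sigma 1 (Suc n)) * nome \<tau> ^ Suc n)"
proof -
  have \<tau>: "\<tau> \<noteq> 0" using assms by auto
  define q where "q = nome \<tau>"
  define g where "g = (\<lambda>m. - inv_sin_sq (of_nat (Suc m) * \<tau>) / (4 * of_real pi ^ 2))"
  have "(\<lambda>d. of_nat (Suc d) * q ^ (Suc m * Suc d)) sums g m" for m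
  proof -
    have "Im (of_nat (Suc m) * \<tau>) > 0" using assms by (simp add: add_pos_nonneg)
    then have "(\<lambda>d. - 4 * of_real pi ^ 2 * (of_nat (Suc d) * nome (of_nat (Suc m) * \<tau>) ^ Suc d)) sums inv_sin_sq (of_nat (Suc m) * \<tau>)"
      using inverse_sin_squared_nome \<tau> by (simp add: inv_sin_sq_def del: of_nat_Suc power_Suc)
    moreover have "nome (of_nat (Suc m) * \<tau>) = q ^ Suc m"
      unfolding q_def nome_def exp_of_nat_mult[symmetric] by (simp add: mult_ac)
    ultimately have "(\<lambda>d. - 4 * of_real pi ^ 2 * (of_nat (Suc d) * q ^ (Suc m * Suc d))) sums inv_sin_sq (of_nat (Suc m) * \<tau>)"
      by (simp only: power_mult)
    then have "(\<lambda>d. (- 4 * of_real pi ^ 2 * (of_nat (Suc d) * q ^ (Suc m * Suc d))) / (- 4 * of_real pi ^ 2)) sums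
       (inv_sin_sq (of_nat (Suc m) * \<tau>) / (- 4 * of_real pi ^ 2))"
      by (rule sums_divide)
    then show ?thesis by (simp add: g_def)
  qed
  then obtain S where S: "g sums S" "(\<lambda>n. of_nat (divisor_sigma 1 (Suc n)) * q ^ Suc n) sums S"
    using sums_divisor_sigma[of q g] norm_nome_less_1[OF assms] unfolding q_def by blast
  show "summable (\<lambda>n. of_nat (divisor_sigma 1 (Suc n)) * nome \<tau> ^ Suc n)"
    using S(2) unfolding q_def by (rule sums_summable)
  have "(\<lambda>M. of_real pi ^ 2 / 3 + (- 8 * of_real pi ^ 2) * (\<Sum>m<M. g m)) \<longlonglongrightarrow> of_real pi ^ 2 / 3 + (- 8 * of_real pi ^ 2) * S"
    using S(1) unfolding sums_def by (intro tendsto_intros)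
  moreover have "(\<Sum>m\<in>{- int M..int M}. inv_sin_sq (of_int m * \<tau>)) = of_real pi ^ 2 / 3 + (- 8 * of_real pi ^ 2) * (\<Sum>m<M. g m)" for M
  proof -
    have "inv_sin_sq (of_int (int (Suc m)) * \<tau>) + inv_sin_sq (of_int (- int (Suc m)) * \<tau>) = - 8 * of_real pi ^ 2 * g m" for m
    proof -
      have "inv_sin_sq (of_int (- int (Suc m)) * \<tau>) = inv_sin_sq (of_nat (Suc m) * \<tau>)"
        by (simp only: of_int_minus of_int_of_nat_eq mult_minus_left inv_sin_sq_minus)
      then show ?thesis by (simp only: g_def of_int_of_nat_eq) (simp add: field_simps)
    qed
    then show ?thesis unfolding sum_int_symmetric_split sum_distrib_left
      by (simp add: inv_sin_sq_def del: of_nat_Suc)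
  qed
  ultimately have "eis_sum \<tau> = of_real pi ^ 2 / 3 + (- 8 * of_real pi ^ 2) * S"
    using has_sum_int_symmetric[OF eis_sum_rows[OF assms]] LIMSEQ_unique by fastforce
  also have "S = (\<Sum>n. of_nat (divisor_sigma 1 (Suc n)) * nome \<tau> ^ Suc n)"
    using S(2) by (simp add: sums_iff q_def)
  also have "of_real pi ^ 2 / 3 + (- 8 * of_real pi ^ 2) * \<dots> = of_real pi ^ 2 / 3 * E2 \<tau>"
    unfolding E2_def by (simp add: field_simps)
  finally show "eis_sum \<tau> = of_real pi ^ 2 / 3 * E2 \<tau>" .
qed

theorem E2_transformation:
  assumes "Im \<tau> > 0"
  shows "E2 (- 1 / \<tau>) = \<tau>\<^sup>2 * E2 \<tau> + 6 * \<tau> / (of_real pi * \<i>)"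
proof -
  have \<tau>: "\<tau> \<noteq> 0" using assms by auto
  have im: "Im (- 1 / \<tau>) > 0" using assms \<tau> by (simp add: Im_divide complex_eq_iff sum_power2_gt_zero_iff)
  have "of_real pi ^ 2 / 3 * E2 (- 1 / \<tau>) = \<tau>\<^sup>2 * (of_real pi ^ 2 / 3 * E2 \<tau>) - 2 * of_real pi * \<i> * \<tau>"
    using eis_sum_transformation[OF assms] E2_eq_eis_sum(1)[OF assms] E2_eq_eis_sum(1)[OF im] by simp
  then have "E2 (- 1 / \<tau>) = \<tau>\<^sup>2 * E2 \<tau> - 6 * \<i> * \<tau> / of_real pi"
  proof -
    have "of_real pi ^ 2 / 3 * (\<tau>\<^sup>2 * E2 \<tau> - 6 * \<i> * \<tau> / of_real pi)
        = \<tau>\<^sup>2 * (of_real pi ^ 2 / 3 * E2 \<tau>) - 2 * of_real pi * \<i> * \<tau>"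
      by (simp add: field_simps power2_eq_square)
    with \<open>of_real pi ^ 2 / 3 * E2 (- 1 / \<tau>) = _\<close>
    have "of_real pi ^ 2 / 3 * E2 (- 1 / \<tau>) = of_real pi ^ 2 / 3 * (\<tau>\<^sup>2 * E2 \<tau> - 6 * \<i> * \<tau> / of_real pi)"
      by simp
    then show ?thesis by (subst (asm) mult_left_cancel) auto
  qed
  moreover have "6 * \<tau> / (of_real pi * \<i>) = - (6 * \<i> * \<tau> / of_real pi)" by (simp add: field_simps)
  ultimately show ?thesis by simp
qed

section \<open>Modular forms as power series\<close>

unbundle no vec_syntax

section \<open>The nome and power series on the unit disc\<close>

lemma open_UHP: "open UHP" and convex_UHP: "convex UHP"
  unfolding UHP_def by (simp_all add: open_halfspace_Im_gt convex_halfspace_Im_gt)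

lemma UHP_nonzero: "\<tau> \<in> UHP \<Longrightarrow> \<tau> \<noteq> 0" by (auto simp: UHP_def)

lemma UHP_minus_inverse: "\<tau> \<in> UHP \<Longrightarrow> - 1 / \<tau> \<in> UHP"
  by (auto simp: UHP_def Im_divide complex_eq_iff sum_power2_gt_zero_iff)

lemma UHP_minus_inverse' [simp]: "\<tau> \<in> UHP \<Longrightarrow> - (1 / \<tau>) \<in> UHP"
  using UHP_minus_inverse[of \<tau>] by simp

lemma norm_nome: "norm (nome \<tau>) = exp (- 2 * pi * Im \<tau>)"
  by (simp add: nome_def)

lemma norm_nome_UHP: "\<tau> \<in> UHP \<Longrightarrow> norm (nome \<tau>) < 1"
  by (simp add: UHP_def norm_nome_less_1)

lemma nome_nonzero [simp]: "nome \<tau> \<noteq> 0" by (simp add: nome_def)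

lemma nome_plus_1: "nome (\<tau> + 1) = nome \<tau>"
  by (simp add: nome_def exp_add distrib_left exp_Euler cos_of_real sin_of_real)

lemma nome_eq_iff: "nome x = nome y \<longleftrightarrow> (\<exists>k :: int. x = y + of_int k)"
proof -
  have "nome x = nome y \<longleftrightarrow> (\<exists>n :: int. 2 * of_real pi * \<i> * x = 2 * of_real pi * \<i> * y + of_int (2 * n) * pi * \<i>)"
    unfolding nome_def exp_eq by simp
  also have "\<dots> \<longleftrightarrow> (\<exists>k :: int. x = y + of_int k)"
  proof (intro ex_cong1)
    fix k :: int
    have "2 * of_real pi * \<i> * y + of_int (2 * k) * pi * \<i> = 2 * of_real pi * \<i> * (y + of_int k)"
      by (simp add: algebra_simps)
    then show "(2 * of_real pi * \<i> * x = 2 * of_real pi * \<i> * y + of_int (2 * k) * pi * \<i>) = (x = y + of_int k)"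
      by (simp only: mult_left_cancel[of "2 * of_real pi * \<i> :: complex"]) simp
  qed
  finally show ?thesis .
qed

definition log_nome :: "complex \<Rightarrow> complex" where
  "log_nome z = Ln z / (2 * of_real pi * \<i>)"

lemma nome_log_nome: "z \<noteq> 0 \<Longrightarrow> nome (log_nome z) = z"
  by (simp add: nome_def log_nome_def)

lemma log_nome_UHP:
  assumes "z \<noteq> 0" "norm z < 1"
  shows "log_nome z \<in> UHP"
proof -
  have "norm (nome (log_nome z)) < 1" using assms by (simp add: nome_log_nome)
  then show ?thesis unfolding norm_nome UHP_def by (simp add: mult_less_0_iff zero_less_mult_iff)
qed

text \<open>Forms are handled as formal power series in q rather than as functions: orders at
  infinity, division by q and integrality become algebraic, and \<open>eval_nome\<close> is an
  injective evaluation back to functions.\<close>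

definition unit_disc_fps :: "complex fps set" where
  "unit_disc_fps = {A. fps_conv_radius A \<ge> 1}"

definition eval_nome :: "complex fps \<Rightarrow> complex \<Rightarrow> complex" where
  "eval_nome A \<tau> = eval_fps A (nome \<tau>)"

lemma unit_disc_fps_radius:
  "A \<in> unit_disc_fps \<Longrightarrow> norm z < 1 \<Longrightarrow> ereal (norm z) < fps_conv_radius A"
  unfolding unit_disc_fps_def by (metis ereal_less(3) less_le_trans mem_Collect_eq)

lemma unit_disc_fps_const [simp, intro]: "fps_const c \<in> unit_disc_fps"
  and unit_disc_fps_0 [simp, intro]: "0 \<in> unit_disc_fps"
  and unit_disc_fps_1 [simp, intro]: "1 \<in> unit_disc_fps"
  and unit_disc_fps_numeral [simp, intro]: "numeral k \<in> unit_disc_fps"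
  and unit_disc_fps_X [simp, intro]: "fps_X \<in> unit_disc_fps"
  by (simp_all add: unit_disc_fps_def)

lemma unit_disc_fps_add [intro]: "A \<in> unit_disc_fps \<Longrightarrow> B \<in> unit_disc_fps \<Longrightarrow> A + B \<in> unit_disc_fps"
  and unit_disc_fps_diff [intro]: "A \<in> unit_disc_fps \<Longrightarrow> B \<in> unit_disc_fps \<Longrightarrow> A - B \<in> unit_disc_fps"
  and unit_disc_fps_mult [intro]: "A \<in> unit_disc_fps \<Longrightarrow> B \<in> unit_disc_fps \<Longrightarrow> A * B \<in> unit_disc_fps"
  and unit_disc_fps_deriv [intro]: "A \<in> unit_disc_fps \<Longrightarrow> fps_deriv A \<in> unit_disc_fps"
  and unit_disc_fps_power [intro]: "A \<in> unit_disc_fps \<Longrightarrow> A ^ n \<in> unit_disc_fps"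
  unfolding unit_disc_fps_def mem_Collect_eq
  using fps_conv_radius_add[of A B] fps_conv_radius_diff[of A B] fps_conv_radius_mult[of A B]
    fps_conv_radius_deriv[of A] fps_conv_radius_power[of A n]
  by (auto intro: order_trans simp: min_def split: if_splits)

lemma eval_nome_const [simp]: "eval_nome (fps_const c) \<tau> = c"
  and eval_nome_0 [simp]: "eval_nome 0 \<tau> = 0"
  and eval_nome_1 [simp]: "eval_nome 1 \<tau> = 1"
  and eval_nome_numeral [simp]: "eval_nome (numeral k) \<tau> = numeral k"
  and eval_nome_X [simp]: "eval_nome fps_X \<tau> = nome \<tau>"
  by (simp_all add: eval_nome_def)

lemma eval_nome_add: "A \<in> unit_disc_fps \<Longrightarrow> B \<in> unit_disc_fps \<Longrightarrow> \<tau> \<in> UHP \<Longrightarrow> eval_nome (A + B) \<tau> = eval_nome A \<tau> + eval_nome B \<tau>"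
  and eval_nome_diff: "A \<in> unit_disc_fps \<Longrightarrow> B \<in> unit_disc_fps \<Longrightarrow> \<tau> \<in> UHP \<Longrightarrow> eval_nome (A - B) \<tau> = eval_nome A \<tau> - eval_nome B \<tau>"
  and eval_nome_mult: "A \<in> unit_disc_fps \<Longrightarrow> B \<in> unit_disc_fps \<Longrightarrow> \<tau> \<in> UHP \<Longrightarrow> eval_nome (A * B) \<tau> = eval_nome A \<tau> * eval_nome B \<tau>"
  and eval_nome_power: "A \<in> unit_disc_fps \<Longrightarrow> \<tau> \<in> UHP \<Longrightarrow> eval_nome (A ^ n) \<tau> = eval_nome A \<tau> ^ n"
  unfolding eval_nome_def
  by (simp_all add: eval_fps_add eval_fps_diff eval_fps_mult eval_fps_power unit_disc_fps_radius norm_nome_UHP)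

text \<open>The nome only reaches the punctured disc. After multiplication by \<open>fps_X\<close>
  both series also agree at the origin, namely with value 0.\<close>

lemma eval_nome_inject:
  assumes "A \<in> unit_disc_fps" "B \<in> unit_disc_fps" "\<And>\<tau>. \<tau> \<in> UHP \<Longrightarrow> eval_nome A \<tau> = eval_nome B \<tau>"
  shows "A = B"
proof -
  have *: "eval_fps (fps_X * A) z = eval_fps (fps_X * B) z" if "norm z < 1" for z
  proof (cases "z = 0")
    case False
    then have "eval_fps A z = eval_fps B z"
      using assms(3)[OF log_nome_UHP[OF False that]] by (simp add: eval_nome_def nome_log_nome)
    then show ?thesis using assms(1,2) that by (simp add: eval_fps_mult unit_disc_fps_radius)
  qed (simp add: eval_fps_at_0)
  have "fps_X * A = fps_X * B"
  proof (rule eval_fps_eqD)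
    show "0 < fps_conv_radius (fps_X * A)" "0 < fps_conv_radius (fps_X * B)"
      using unit_disc_fps_radius[of "fps_X * A" 0] unit_disc_fps_radius[of "fps_X * B" 0] assms(1,2)
      by (auto simp: zero_ereal_def)
    have "\<forall>\<^sub>F z in nhds 0. z \<in> ball 0 (1 :: real)" by (intro eventually_nhds_in_open) auto
    then show "\<forall>\<^sub>F z in nhds 0. eval_fps (fps_X * A) z = eval_fps (fps_X * B) z"
      by eventually_elim (simp add: *)
  qed
  then show ?thesis by simp
qed

definition fps_theta :: "complex fps \<Rightarrow> complex fps" where
  "fps_theta A = fps_X * fps_deriv A"

lemma fps_theta_nth [simp]: "fps_theta A $ n = of_nat n * A $ n"
  by (cases n) (simp_all add: fps_theta_def)

lemma fps_theta_add: "fps_theta (A + B) = fps_theta A + fps_theta B"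
  and fps_theta_diff: "fps_theta (A - B) = fps_theta A - fps_theta B"
  and fps_theta_mult: "fps_theta (A * B) = fps_theta A * B + A * fps_theta B"
  and fps_theta_const [simp]: "fps_theta (fps_const c) = 0"
  and fps_theta_0 [simp]: "fps_theta 0 = 0"
  and fps_theta_1 [simp]: "fps_theta 1 = 0"
  and fps_theta_numeral [simp]: "fps_theta (numeral k) = 0"
  and fps_theta_X [simp]: "fps_theta fps_X = fps_X"
  by (simp_all add: fps_theta_def algebra_simps)

lemma unit_disc_fps_theta [intro]: "A \<in> unit_disc_fps \<Longrightarrow> fps_theta A \<in> unit_disc_fps"
  unfolding fps_theta_def by auto

lemma has_field_derivative_eval_nome:
  assumes A: "A \<in> unit_disc_fps" and \<tau>: "\<tau> \<in> UHP"
  shows "(eval_nome A has_field_derivative 2 * of_real pi * \<i> * eval_nome (fps_theta A) \<tau>) (at \<tau>)"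
proof -
  have 1: "(nome has_field_derivative nome \<tau> * (2 * of_real pi * \<i>)) (at \<tau>)"
    unfolding nome_def by (auto intro!: derivative_eq_intros)
  have 2: "(eval_fps A has_field_derivative eval_fps (fps_deriv A) (nome \<tau>)) (at (nome \<tau>))"
    using A \<tau> by (intro has_field_derivative_eval_fps unit_disc_fps_radius norm_nome_UHP)
  have "((\<lambda>x. eval_fps A (nome x)) has_field_derivative eval_fps (fps_deriv A) (nome \<tau>) * (nome \<tau> * (2 * of_real pi * \<i>))) (at \<tau>)"
    using DERIV_chain2[OF 2 1] .
  moreover have "eval_nome (fps_theta A) \<tau> = nome \<tau> * eval_fps (fps_deriv A) (nome \<tau>)"
    using A \<tau> unfolding fps_theta_def by (subst eval_nome_mult) (auto simp: eval_nome_def)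
  ultimately show ?thesis unfolding eval_nome_def[abs_def] by (simp add: mult_ac)
qed

lemma eval_nome_holomorphic: "A \<in> unit_disc_fps \<Longrightarrow> eval_nome A holomorphic_on UHP"
  using has_field_derivative_eval_nome open_UHP by (auto simp: holomorphic_on_open)

lemma eval_nome_plus_1: "eval_nome A (\<tau> + 1) = eval_nome A \<tau>"
  by (simp add: eval_nome_def nome_plus_1)

text \<open>Differentiates a known inversion law \<open>\<Phi>\<close>: the derivative of -1/\<tau>
  is 1/\<tau>^2, and d/d\<tau> is 2 pi \<i> times \<open>fps_theta\<close>.\<close>

lemma eval_nome_theta_transformation:
  assumes A: "A \<in> unit_disc_fps" and \<tau>: "\<tau> \<in> UHP"
    and eq: "\<And>x. x \<in> UHP \<Longrightarrow> eval_nome A (- 1 / x) = \<Phi> x"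
    and der: "(\<Phi> has_field_derivative d) (at \<tau>)"
  shows "eval_nome (fps_theta A) (- 1 / \<tau>) = \<tau>\<^sup>2 * d / (2 * of_real pi * \<i>)"
proof -
  have \<tau>0: "\<tau> \<noteq> 0" using \<tau> by (rule UHP_nonzero)
  have 1: "((\<lambda>x. - 1 / x) has_field_derivative 1 / \<tau>\<^sup>2) (at \<tau>)"
    using \<tau>0 by (auto intro!: derivative_eq_intros simp: power2_eq_square)
  have "((\<lambda>x. eval_nome A (- 1 / x)) has_field_derivative
      2 * of_real pi * \<i> * eval_nome (fps_theta A) (- 1 / \<tau>) * (1 / \<tau>\<^sup>2)) (at \<tau>)"
    by (rule DERIV_chain2[OF has_field_derivative_eval_nome[OF A UHP_minus_inverse[OF \<tau>]] 1])
  moreover have "((\<lambda>x. eval_nome A (- 1 / x)) has_field_derivative d) (at \<tau>)"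
  proof -
    have "\<forall>\<^sub>F x in nhds \<tau>. x \<in> UHP" using open_UHP \<tau> by (rule eventually_nhds_in_open)
    then have ev: "\<forall>\<^sub>F x in nhds \<tau>. eval_nome A (- 1 / x) = \<Phi> x" by eventually_elim (rule eq)
    show ?thesis using der by (subst DERIV_cong_ev[OF refl ev refl])
  qed
  ultimately have "2 * of_real pi * \<i> * eval_nome (fps_theta A) (- 1 / \<tau>) * (1 / \<tau>\<^sup>2) = d" by (rule DERIV_unique)
  then show ?thesis using \<tau>0 by (simp add: field_simps)
qed

lemma unit_disc_fps_exists:
  assumes "g holomorphic_on ball 0 1"
  obtains A where "A \<in> unit_disc_fps" "\<And>z. norm z < 1 \<Longrightarrow> eval_fps A z = g z"
proof
  have *: "g holomorphic_on eball 0 1" using assms by (simp add: one_ereal_def)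
  show "fps_expansion g 0 \<in> unit_disc_fps"
    using conv_radius_fps_expansion[OF *] by (simp add: unit_disc_fps_def)
  show "eval_fps (fps_expansion g 0) z = g z" if "norm z < 1" for z
    using eval_fps_expansion'[OF *, of z] that by (simp add: one_ereal_def)
qed

lemma periodic_int:
  fixes f :: "complex \<Rightarrow> 'a"
  assumes per: "\<And>\<tau>. \<tau> \<in> UHP \<Longrightarrow> f (\<tau> + 1) = f \<tau>" and \<tau>: "\<tau> \<in> UHP"
  shows "f (\<tau> + of_int k) = f \<tau>"
proof -
  have nat: "f (x + of_nat n) = f x" if "x \<in> UHP" for x n
  proof (induction n)
    case (Suc n)
    have "x + of_nat n \<in> UHP" using that by (simp add: UHP_def)
    from per[OF this] Suc show ?case by (simp add: add_ac)
  qed simp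
  show ?thesis
  proof (cases k rule: int_cases2)
    case (nonneg n)
    then show ?thesis using nat[OF \<tau>] by simp
  next
    case (nonpos n)
    have "\<tau> + of_int k \<in> UHP" using \<tau> by (simp add: UHP_def)
    from nat[OF this, of n] show ?thesis using nonpos by simp
  qed
qed

text \<open>By periodicity f factors through the nome as g = f o \<open>log_nome\<close>. The
  principal logarithm is holomorphic off the negative axis; off the positive axis the branch from
  log(-z), shifted by half a period, gives the same g. The two slit discs cover the punctured disc,
  and boundedness removes the singularity at 0.\<close>

lemma q_expansion_exists:
  assumes hol: "f holomorphic_on UHP" and per: "\<And>\<tau>. \<tau> \<in> UHP \<Longrightarrow> f (\<tau> + 1) = f \<tau>"
    and bdd: "\<And>\<tau>. Im \<tau> \<ge> 1 \<Longrightarrow> norm (f \<tau>) \<le> B"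
  obtains A where "A \<in> unit_disc_fps" "\<And>\<tau>. \<tau> \<in> UHP \<Longrightarrow> f \<tau> = eval_nome A \<tau>"
proof -
  define g where "g = (\<lambda>z. f (log_nome z))"
  have g: "g z = f \<tau>" if "nome \<tau> = z" "\<tau> \<in> UHP" for z \<tau>
  proof -
    have "nome (log_nome z) = nome \<tau>" using that nome_log_nome[of z] by auto
    then obtain k :: int where "log_nome z = \<tau> + of_int k" by (auto simp: nome_eq_iff)
    then show ?thesis using periodic_int[of f, OF per that(2)] by (simp add: g_def)
  qed
  define S1 :: "complex set" where "S1 = ball 0 1 - \<real>\<^sub>\<le>\<^sub>0"
  define S2 :: "complex set" where "S2 = ball 0 1 - {z. - z \<in> \<real>\<^sub>\<le>\<^sub>0}"
  have op1: "open S1" unfolding S1_def by (intro open_Diff open_ball closed_nonpos_Reals_complex)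
  have "closed (uminus -` (\<real>\<^sub>\<le>\<^sub>0 :: complex set))"
    by (intro closed_vimage closed_nonpos_Reals_complex continuous_intros)
  then have op2: "open S2" unfolding S2_def vimage_def by (intro open_Diff open_ball)
  have "g holomorphic_on S1" unfolding g_def
  proof (rule holomorphic_on_compose_gen[OF _ hol, unfolded o_def])
    show "log_nome holomorphic_on S1" unfolding log_nome_def S1_def by (intro holomorphic_intros) auto
    show "log_nome ` S1 \<subseteq> UHP" unfolding S1_def by (auto intro!: log_nome_UHP)
  qed
  moreover have "g holomorphic_on S2"
  proof -
    have "(\<lambda>z. f (log_nome (- z) + 1 / 2)) holomorphic_on S2"
    proof (rule holomorphic_on_compose_gen[OF _ hol, unfolded o_def])
      show "(\<lambda>z. log_nome (- z) + 1 / 2) holomorphic_on S2" unfolding log_nome_def S2_def by (intro holomorphic_intros) auto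
      show "(\<lambda>z. log_nome (- z) + 1 / 2) ` S2 \<subseteq> UHP" unfolding S2_def
      proof (rule image_subsetI)
        fix z :: complex assume "z \<in> ball 0 1 - {z. - z \<in> \<real>\<^sub>\<le>\<^sub>0}"
        then have "norm z < 1" "z \<noteq> 0" by auto
        then have "log_nome (- z) \<in> UHP" by (intro log_nome_UHP) auto
        then show "log_nome (- z) + 1 / 2 \<in> UHP" by (simp add: UHP_def)
      qed
    qed
    moreover have "f (log_nome (- z) + 1 / 2) = g z" if "z \<in> S2" for z
    proof (rule g[symmetric])
      have z: "z \<noteq> 0" "norm z < 1" using that by (auto simp: S2_def)
      then have "log_nome (- z) \<in> UHP" by (intro log_nome_UHP) auto
      then show "log_nome (- z) + 1 / 2 \<in> UHP" by (simp add: UHP_def)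
      have "nome (log_nome (- z) + 1 / 2) = nome (log_nome (- z)) * exp (of_real pi * \<i>)"
        unfolding nome_def by (simp add: exp_add distrib_left mult_ac)
      then show "nome (log_nome (- z) + 1 / 2) = z" using z by (simp add: nome_log_nome)
    qed
    ultimately show ?thesis by (rule holomorphic_transform)
  qed
  ultimately have "g holomorphic_on (S1 \<union> S2)" using op1 op2 by (rule holomorphic_on_Un)
  moreover have "S1 \<union> S2 = ball 0 1 - {0}"
    unfolding S1_def S2_def by (auto simp: complex_nonpos_Reals_iff complex_eq_iff)
  ultimately have gh: "g holomorphic_on (ball 0 1 - {0})" by simp
  have "\<exists>B. \<forall>\<^sub>F z in at 0. norm (g z) \<le> B"
  proof -
    have "\<forall>\<^sub>F z in at (0 :: complex). z \<in> ball 0 (exp (- 2 * pi)) - {0}"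
      by (intro eventually_at_in_open) auto
    then have "\<forall>\<^sub>F z in at 0. norm (g z) \<le> B"
    proof eventually_elim
      case (elim z)
      then have "norm (nome (log_nome z)) < exp (- 2 * pi)" by (simp add: nome_log_nome)
      then have "Im (log_nome z) \<ge> 1" unfolding norm_nome by simp
      then show ?case unfolding g_def by (rule bdd)
    qed
    then show ?thesis by blast
  qed
  then obtain G where G: "G holomorphic_on ball 0 1" "\<And>z. z \<in> ball 0 1 - {0} \<Longrightarrow> G z = g z"
    using holomorphic_on_extend_bounded[OF gh] by auto
  obtain A where A: "A \<in> unit_disc_fps" "\<And>z. norm z < 1 \<Longrightarrow> eval_fps A z = G z"
    using unit_disc_fps_exists[OF G(1)] by blast
  have "f \<tau> = eval_nome A \<tau>" if "\<tau> \<in> UHP" for \<tau>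
    using A(2)[of "nome \<tau>"] G(2)[of "nome \<tau>"] g[OF refl that] norm_nome_UHP[OF that] by (simp add: eval_nome_def)
  with A(1) show ?thesis by (rule that)
qed

section \<open>Modular forms through their q-expansions\<close>

text \<open>Holomorphy, periodicity and the cusp condition are built into a power series in the
  nome, so only inversion remains to be required.\<close>

definition MF :: "int \<Rightarrow> complex fps set" where
  "MF k = {A \<in> unit_disc_fps. \<forall>\<tau>\<in>UHP. eval_nome A (- 1 / \<tau>) = \<tau> powi k * eval_nome A \<tau>}"

lemma MF_unit_disc [dest]: "A \<in> MF k \<Longrightarrow> A \<in> unit_disc_fps"
  by (simp add: MF_def)

lemma MF_transformation: "A \<in> MF k \<Longrightarrow> \<tau> \<in> UHP \<Longrightarrow> eval_nome A (- 1 / \<tau>) = \<tau> powi k * eval_nome A \<tau>"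
  by (simp add: MF_def)

lemma MF_0 [simp, intro]: "0 \<in> MF k"
  by (simp add: MF_def)

lemma MF_const [simp, intro]: "fps_const c \<in> MF 0" and MF_1 [simp, intro]: "1 \<in> MF 0"
  by (simp_all add: MF_def)

lemma MF_add: "A \<in> MF k \<Longrightarrow> B \<in> MF k \<Longrightarrow> A + B \<in> MF k"
  and MF_diff: "A \<in> MF k \<Longrightarrow> B \<in> MF k \<Longrightarrow> A - B \<in> MF k"
  and MF_cmult: "A \<in> MF k \<Longrightarrow> fps_const c * A \<in> MF k"
  by (auto simp: MF_def eval_nome_add eval_nome_diff eval_nome_mult UHP_minus_inverse algebra_simps)

lemma MF_mult:
  assumes "A \<in> MF k" "B \<in> MF l"
  shows "A * B \<in> MF (k + l)"
  using assms by (auto simp: MF_def eval_nome_mult UHP_minus_inverse power_int_add UHP_nonzero mult_ac)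

lemma MF_power: "A \<in> MF k \<Longrightarrow> A ^ n \<in> MF (int n * k)"
proof (induction n)
  case (Suc n)
  then have "A * A ^ n \<in> MF (k + int n * k)" by (intro MF_mult)
  then show ?case by (simp add: algebra_simps)
qed simp

lemma modular_form_iff_MF:
  "modular_form k f \<longleftrightarrow> (\<exists>A\<in>MF k. \<forall>\<tau>\<in>UHP. f \<tau> = eval_nome A \<tau>)"
proof
  assume f: "modular_form k f"
  then obtain B where "\<forall>\<tau>. Im \<tau> \<ge> 1 \<longrightarrow> norm (f \<tau>) \<le> B" unfolding modular_form_def by blast
  then obtain A where A: "A \<in> unit_disc_fps" "\<And>\<tau>. \<tau> \<in> UHP \<Longrightarrow> f \<tau> = eval_nome A \<tau>"
    using f unfolding modular_form_def by (metis q_expansion_exists)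
  have "eval_nome A (- 1 / \<tau>) = \<tau> powi k * eval_nome A \<tau>" if "\<tau> \<in> UHP" for \<tau>
    using f that A(2)[OF that] A(2)[OF UHP_minus_inverse[OF that]] unfolding modular_form_def by simp
  then have "A \<in> MF k" using A(1) unfolding MF_def by simp
  then show "\<exists>A\<in>MF k. \<forall>\<tau>\<in>UHP. f \<tau> = eval_nome A \<tau>" using A(2) by blast
next
  assume "\<exists>A\<in>MF k. \<forall>\<tau>\<in>UHP. f \<tau> = eval_nome A \<tau>"
  then obtain A where A: "A \<in> MF k" "\<And>\<tau>. \<tau> \<in> UHP \<Longrightarrow> f \<tau> = eval_nome A \<tau>" by blast
  have disc: "A \<in> unit_disc_fps" using A(1) by auto
  have "f holomorphic_on UHP"
    by (rule holomorphic_transform[OF eval_nome_holomorphic[OF disc]]) (simp add: A(2))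
  moreover have "f (\<tau> + 1) = f \<tau>" if "\<tau> \<in> UHP" for \<tau>
  proof -
    have "\<tau> + 1 \<in> UHP" using that by (simp add: UHP_def)
    then show ?thesis using that by (simp add: A(2) eval_nome_plus_1)
  qed
  moreover have "f (- 1 / \<tau>) = \<tau> powi k * f \<tau>" if "\<tau> \<in> UHP" for \<tau>
    using MF_transformation[OF A(1) that] that by (simp add: A(2) UHP_minus_inverse)
  moreover have "\<exists>B. \<forall>\<tau>. Im \<tau> \<ge> 1 \<longrightarrow> norm (f \<tau>) \<le> B"
  proof -
    \<comment> \<open>Im \<tau> >= 1 means that the nome lies in a compact disc of radius exp(-2 pi)
      < 1, on which the power series is bounded.\<close>
    have "continuous_on (cball 0 (exp (- 2 * pi))) (eval_fps A)"
    proof (rule continuous_on_subset[OF continuous_on_eval_fps], rule subsetI)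
      fix z :: complex assume "z \<in> cball 0 (exp (- 2 * pi))"
      then have "norm z \<le> exp (- 2 * pi)" by simp
      also have "exp (- 2 * pi) < 1" by simp
      finally show "z \<in> eball 0 (fps_conv_radius A)" using unit_disc_fps_radius[OF disc] by simp
    qed
    then have "compact (eval_fps A ` cball 0 (exp (- 2 * pi)))" by (intro compact_continuous_image compact_cball)
    then obtain B where B: "\<And>w. w \<in> eval_fps A ` cball 0 (exp (- 2 * pi)) \<Longrightarrow> norm w \<le> B"
      using bounded_iff compact_imp_bounded by metis
    have "norm (f \<tau>) \<le> B" if "Im \<tau> \<ge> 1" for \<tau>
    proof -
      have "f \<tau> = eval_fps A (nome \<tau>)" using A(2)[of \<tau>] that by (simp add: UHP_def eval_nome_def)
      moreover have "nome \<tau> \<in> cball 0 (exp (- 2 * pi))" using that by (simp add: norm_nome)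
      ultimately show ?thesis using B by simp
    qed
    then show ?thesis by blast
  qed
  ultimately show "modular_form k f" unfolding modular_form_def by blast
qed

section \<open>Eisenstein series and the Serre derivative\<close>

definition sigma_fps :: "complex fps" where
  "sigma_fps = Abs_fps (\<lambda>n. if n = 0 then 0 else of_nat (divisor_sigma 1 n))"

definition E2_fps :: "complex fps" where
  "E2_fps = 1 - 24 * sigma_fps"

lemma sigma_fps_sums:
  assumes "norm z < 1"
  shows "summable (\<lambda>n. sigma_fps $ n * z ^ n)"
proof (cases "z = 0")
  case False
  have "Im (log_nome z) > 0" using log_nome_UHP[OF False assms] by (simp add: UHP_def)
  from E2_eq_eis_sum(2)[OF this] have "summable (\<lambda>n. of_nat (divisor_sigma 1 (Suc n)) * z ^ Suc n)"
    by (simp only: nome_log_nome[OF False])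
  then have "summable (\<lambda>n. sigma_fps $ Suc n * z ^ Suc n)" by (simp add: sigma_fps_def)
  then show ?thesis by (subst (asm) summable_Suc_iff)
qed (simp add: summable_0_powser)

lemma unit_disc_fpsI:
  assumes "\<And>z. norm z < 1 \<Longrightarrow> summable (\<lambda>n. A $ n * z ^ n)"
  shows "A \<in> unit_disc_fps"
  unfolding unit_disc_fps_def mem_Collect_eq fps_conv_radius_def
proof (rule conv_radius_geI_ex')
  fix r :: real assume "0 < r" "ereal r < 1"
  then show "summable (\<lambda>n. A $ n * of_real r ^ n)" by (intro assms) simp
qed

lemma sigma_fps_unit_disc [intro]: "sigma_fps \<in> unit_disc_fps"
  by (intro unit_disc_fpsI sigma_fps_sums)

lemma E2_fps_unit_disc [intro]: "E2_fps \<in> unit_disc_fps"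
  unfolding E2_fps_def by auto

lemma E2_eq_eval_nome:
  assumes "\<tau> \<in> UHP"
  shows "E2 \<tau> = eval_nome E2_fps \<tau>"
proof -
  have "(\<lambda>n. sigma_fps $ n * nome \<tau> ^ n) sums eval_nome sigma_fps \<tau>"
    unfolding eval_nome_def by (intro sums_eval_fps unit_disc_fps_radius norm_nome_UHP assms sigma_fps_unit_disc)
  then have "(\<lambda>n. sigma_fps $ Suc n * nome \<tau> ^ Suc n) sums eval_nome sigma_fps \<tau>"
    by (subst sums_Suc_iff) (simp add: sigma_fps_def)
  then have "(\<Sum>n. of_nat (divisor_sigma 1 (Suc n)) * nome \<tau> ^ Suc n) = eval_nome sigma_fps \<tau>"
    by (simp add: sigma_fps_def sums_iff)
  then show ?thesis unfolding E2_def E2_fps_def using assms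
    by (subst eval_nome_diff) (auto simp: eval_nome_mult sigma_fps_unit_disc)
qed

lemma E2_fps_transformation:
  assumes "\<tau> \<in> UHP"
  shows "eval_nome E2_fps (- 1 / \<tau>) = \<tau>\<^sup>2 * eval_nome E2_fps \<tau> + 12 / (2 * of_real pi * \<i>) * \<tau>"
proof -
  have "eval_nome E2_fps (- 1 / \<tau>) = \<tau>\<^sup>2 * eval_nome E2_fps \<tau> + 6 * \<tau> / (of_real pi * \<i>)"
    using E2_transformation[of \<tau>] assms
    unfolding E2_eq_eval_nome[OF assms] E2_eq_eval_nome[OF UHP_minus_inverse[OF assms]] by (simp add: UHP_def)
  also have "6 * \<tau> / (of_real pi * \<i>) = 12 / (2 * of_real pi * \<i>) * \<tau>" by simp
  finally show ?thesis .
qed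

definition serre :: "complex \<Rightarrow> complex fps \<Rightarrow> complex fps" where
  "serre k A = fps_theta A - fps_const (k / 12) * E2_fps * A"

text \<open>Differentiating \<tau>^k produces the extra term k \<tau>^(k-1) A, and k / 12 times the
  inhomogeneous term of E2 cancels it.\<close>

lemma MF_serre:
  assumes "A \<in> MF k"
  shows "serre (of_int k) A \<in> MF (k + 2)"
  unfolding MF_def mem_Collect_eq
proof (intro conjI ballI)
  have disc: "A \<in> unit_disc_fps" using assms by auto
  then show "serre (of_int k) A \<in> unit_disc_fps" unfolding serre_def by auto
  fix \<tau> assume \<tau>: "\<tau> \<in> UHP"
  then have \<tau>0: "\<tau> \<noteq> 0" by (rule UHP_nonzero)
  have "((\<lambda>x. x powi k * eval_nome A x) has_field_derivative
     of_int k * \<tau> powi (k - 1) * eval_nome A \<tau> + 2 * of_real pi * \<i> * eval_nome (fps_theta A) \<tau> * \<tau> powi k) (at \<tau>)"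
    using \<tau>0 by (auto intro!: derivative_eq_intros has_field_derivative_eval_nome disc \<tau>)
  from eval_nome_theta_transformation[OF disc \<tau> MF_transformation[OF assms] this]
  have th: "eval_nome (fps_theta A) (- 1 / \<tau>) = \<tau>\<^sup>2 * (of_int k * \<tau> powi (k - 1) * eval_nome A \<tau> +
      2 * of_real pi * \<i> * eval_nome (fps_theta A) \<tau> * \<tau> powi k) / (2 * of_real pi * \<i>)" .
  have ev: "eval_nome (serre (of_int k) A) x = eval_nome (fps_theta A) x - of_int k / 12 * eval_nome E2_fps x * eval_nome A x"
    if "x \<in> UHP" for x
    unfolding serre_def using disc that by (subst eval_nome_diff) (auto simp: eval_nome_mult unit_disc_fps_mult E2_fps_unit_disc)
  have p1: "\<tau> powi (k - 1) = \<tau> powi k / \<tau>" using \<tau>0 by (simp add: power_int_diff)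
  have p2: "\<tau> powi (k + 2) = \<tau> powi k * \<tau>\<^sup>2" using \<tau>0 by (simp add: power_int_add)
  show "eval_nome (serre (of_int k) A) (- 1 / \<tau>) = \<tau> powi (k + 2) * eval_nome (serre (of_int k) A) \<tau>"
    unfolding ev[OF \<tau>] ev[OF UHP_minus_inverse[OF \<tau>]] th MF_transformation[OF assms \<tau>] E2_fps_transformation[OF \<tau>] p1 p2
    using \<tau>0 by (simp add: field_simps power2_eq_square)
qed

text \<open>Ramanujan's formula for the derivative of E2, solved for E4; E6 comes from his formula
  for E4 in the same way.\<close>

definition E4_fps :: "complex fps" where
  "E4_fps = E2_fps\<^sup>2 - 12 * fps_theta E2_fps"

definition E6_fps :: "complex fps" where
  "E6_fps = E2_fps * E4_fps - 3 * fps_theta E4_fps"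

lemma E4_fps_MF: "E4_fps \<in> MF 4"
  unfolding MF_def mem_Collect_eq
proof (intro conjI ballI)
  show "E4_fps \<in> unit_disc_fps" unfolding E4_fps_def by auto
  fix \<tau> assume \<tau>: "\<tau> \<in> UHP"
  then have \<tau>0: "\<tau> \<noteq> 0" by (rule UHP_nonzero)
  define c :: complex where "c = 2 * of_real pi * \<i>"
  have c: "c \<noteq> 0" by (simp add: c_def)
  have "((\<lambda>x. x\<^sup>2 * eval_nome E2_fps x + 12 / c * x) has_field_derivative
     2 * \<tau> * eval_nome E2_fps \<tau> + c * eval_nome (fps_theta E2_fps) \<tau> * \<tau>\<^sup>2 + 12 / c) (at \<tau>)"
    unfolding c_def by (auto intro!: derivative_eq_intros has_field_derivative_eval_nome \<tau>)
  from eval_nome_theta_transformation[OF E2_fps_unit_disc \<tau> _ this] E2_fps_transformation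
  have th: "eval_nome (fps_theta E2_fps) (- 1 / \<tau>) =
     \<tau>\<^sup>2 * (2 * \<tau> * eval_nome E2_fps \<tau> + c * eval_nome (fps_theta E2_fps) \<tau> * \<tau>\<^sup>2 + 12 / c) / c"
    unfolding c_def by blast
  have ev: "eval_nome E4_fps x = (eval_nome E2_fps x)\<^sup>2 - 12 * eval_nome (fps_theta E2_fps) x" if "x \<in> UHP" for x
    unfolding E4_fps_def using that by (subst eval_nome_diff) (auto simp: eval_nome_mult eval_nome_power unit_disc_fps_theta E2_fps_unit_disc)
  have p: "\<tau> powi 4 = \<tau>\<^sup>2 * \<tau>\<^sup>2" by (simp add: power4_eq_xxxx power2_eq_square mult_ac flip: power_int_numeral)
  show "eval_nome E4_fps (- 1 / \<tau>) = \<tau> powi 4 * eval_nome E4_fps \<tau>"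
    unfolding ev[OF \<tau>] ev[OF UHP_minus_inverse[OF \<tau>]] th E2_fps_transformation[OF \<tau>, folded c_def] p
    using \<tau>0 c by (simp add: field_simps power2_eq_square)
qed

lemma E6_fps_eq_serre: "E6_fps = fps_const (- 3) * serre 4 E4_fps"
proof -
  have a: "fps_const (-3) * fps_const (4/12) = (-1 :: complex fps)"
    unfolding fps_const_mult by (simp add: numeral_fps_const)
  have b: "fps_const (-3) = (-3 :: complex fps)" by (simp only: fps_const_neg[symmetric] numeral_fps_const)
  have "fps_const (- 3) * serre 4 E4_fps = fps_const (- 3) * fps_theta E4_fps - (fps_const (- 3) * fps_const (4 / 12)) * (E2_fps * E4_fps)"
    unfolding serre_def by (simp only: right_diff_distrib mult.assoc)
  then show ?thesis unfolding E6_fps_def a b by simp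
qed

lemma E6_fps_MF: "E6_fps \<in> MF 6"
  using MF_cmult[OF MF_serre[OF E4_fps_MF], of "-3"] by (simp add: E6_fps_eq_serre)

section \<open>The discriminant\<close>

text \<open>The logarithm of \<Delta> / q, obtained by integrating E2 - 1 coefficientwise. Defining
  \<Delta> through an exponential makes it visibly free of zeros on the upper half plane.\<close>

definition delta_log :: "complex fps" where
  "delta_log = Abs_fps (\<lambda>n. if n = 0 then 0 else - 24 * sigma_fps $ n / of_nat n)"

definition delta_fun :: "complex \<Rightarrow> complex" where
  "delta_fun z = z * exp (eval_fps delta_log z)"

definition Delta_fps :: "complex fps" where
  "Delta_fps = fps_expansion delta_fun 0"

lemma fps_theta_delta_log: "fps_theta delta_log = E2_fps - 1"
  by (rule fps_ext) (auto simp: delta_log_def E2_fps_def sigma_fps_def numeral_fps_const)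

lemma delta_log_unit_disc: "delta_log \<in> unit_disc_fps"
proof (rule unit_disc_fpsI, rule summable_norm_cancel)
  fix z :: complex assume z: "norm z < 1"
  have "summable (\<lambda>n. norm (sigma_fps $ n * z ^ n))"
    by (intro norm_summable_fps unit_disc_fps_radius z sigma_fps_unit_disc)
  then have "summable (\<lambda>n. 24 * norm (sigma_fps $ n * z ^ n))" by (rule summable_mult)
  then show "summable (\<lambda>n. norm (delta_log $ n * z ^ n))"
  proof (rule summable_comparison_test')
    fix n :: nat
    show "norm (norm (delta_log $ n * z ^ n)) \<le> 24 * norm (sigma_fps $ n * z ^ n)"
    proof (cases n)
      case (Suc m)
      have "norm (delta_log $ n * z ^ n) = 24 * norm (sigma_fps $ n * z ^ n) / real n"
        by (simp add: Suc delta_log_def norm_mult norm_divide del: of_nat_Suc)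
      also have "\<dots> \<le> 24 * norm (sigma_fps $ n * z ^ n) / 1" by (intro divide_left_mono) (auto simp: Suc)
      finally show ?thesis by simp
    qed (simp add: delta_log_def)
  qed
qed

lemma delta_fun_holomorphic: "delta_fun holomorphic_on ball 0 1"
  and exp_delta_log_holomorphic: "(\<lambda>z. exp (- eval_fps delta_log z)) holomorphic_on ball 0 1"
proof -
  have "eval_fps delta_log holomorphic_on ball 0 1"
    by (rule holomorphic_on_eval_fps) (use unit_disc_fps_radius[OF delta_log_unit_disc] in auto)
  then show "delta_fun holomorphic_on ball 0 1" "(\<lambda>z. exp (- eval_fps delta_log z)) holomorphic_on ball 0 1"
    unfolding delta_fun_def[abs_def] by (auto intro!: holomorphic_intros)
qed

lemma Delta_fps_unit_disc [intro]: "Delta_fps \<in> unit_disc_fps"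
  and eval_Delta_fps: "norm z < 1 \<Longrightarrow> eval_fps Delta_fps z = delta_fun z"
proof -
  have *: "delta_fun holomorphic_on eball 0 1" using delta_fun_holomorphic by (simp add: one_ereal_def)
  show "Delta_fps \<in> unit_disc_fps"
    using conv_radius_fps_expansion[OF *] by (simp add: unit_disc_fps_def Delta_fps_def)
  show "eval_fps Delta_fps z = delta_fun z" if "norm z < 1"
    using eval_fps_expansion'[OF *, of z] that by (simp add: one_ereal_def Delta_fps_def)
qed

lemma eval_nome_Delta: "\<tau> \<in> UHP \<Longrightarrow> eval_nome Delta_fps \<tau> = nome \<tau> * exp (eval_nome delta_log \<tau>)"
  by (simp add: eval_nome_def eval_Delta_fps norm_nome_UHP delta_fun_def)

lemma eval_nome_Delta_nonzero: "\<tau> \<in> UHP \<Longrightarrow> eval_nome Delta_fps \<tau> \<noteq> 0"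
  by (simp add: eval_nome_Delta)

lemma fps_theta_Delta: "fps_theta Delta_fps = E2_fps * Delta_fps"
proof (rule eval_nome_inject)
  show "fps_theta Delta_fps \<in> unit_disc_fps" "E2_fps * Delta_fps \<in> unit_disc_fps" by auto
  fix \<tau> assume \<tau>: "\<tau> \<in> UHP"
  define c :: complex where "c = 2 * of_real pi * \<i>"
  have n: "(nome has_field_derivative nome \<tau> * c) (at \<tau>)"
    unfolding nome_def c_def by (auto intro!: derivative_eq_intros)
  have "((\<lambda>x. nome x * exp (eval_nome delta_log x)) has_field_derivative
     nome \<tau> * c * exp (eval_nome delta_log \<tau>) + nome \<tau> * (exp (eval_nome delta_log \<tau>) * (c * eval_nome (fps_theta delta_log) \<tau>))) (at \<tau>)"
    using n has_field_derivative_eval_nome[OF delta_log_unit_disc \<tau>] unfolding c_def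
    by (auto intro!: derivative_eq_intros)
  moreover have "((\<lambda>x. nome x * exp (eval_nome delta_log x)) has_field_derivative c * eval_nome (fps_theta Delta_fps) \<tau>) (at \<tau>)"
  proof -
    have "\<forall>\<^sub>F x in nhds \<tau>. x \<in> UHP" using open_UHP \<tau> by (rule eventually_nhds_in_open)
    then have ev: "\<forall>\<^sub>F x in nhds \<tau>. nome x * exp (eval_nome delta_log x) = eval_nome Delta_fps x"
      by eventually_elim (simp add: eval_nome_Delta)
    show ?thesis using has_field_derivative_eval_nome[OF Delta_fps_unit_disc \<tau>] unfolding c_def
      by (subst DERIV_cong_ev[OF refl ev refl])
  qed
  ultimately have "nome \<tau> * c * exp (eval_nome delta_log \<tau>) + nome \<tau> * (exp (eval_nome delta_log \<tau>) * (c * eval_nome (fps_theta delta_log) \<tau>))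
     = c * eval_nome (fps_theta Delta_fps) \<tau>" by (rule DERIV_unique)
  moreover have "eval_nome (fps_theta delta_log) \<tau> = eval_nome E2_fps \<tau> - 1"
    unfolding fps_theta_delta_log using \<tau> by (subst eval_nome_diff) auto
  ultimately have "c * (eval_nome E2_fps \<tau> * (nome \<tau> * exp (eval_nome delta_log \<tau>))) = c * eval_nome (fps_theta Delta_fps) \<tau>"
    by (simp add: algebra_simps)
  moreover have "c \<noteq> 0" by (simp add: c_def)
  ultimately show "eval_nome (fps_theta Delta_fps) \<tau> = eval_nome (E2_fps * Delta_fps) \<tau>"
    using \<tau> by (simp add: eval_nome_mult E2_fps_unit_disc Delta_fps_unit_disc eval_nome_Delta)
qed

lemma Delta_fps_nth: "Delta_fps $ 0 = 0" "Delta_fps $ 1 = 1"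
proof -
  have "eval_fps Delta_fps 0 = delta_fun 0" by (rule eval_Delta_fps) simp
  then show "Delta_fps $ 0 = 0" by (simp add: eval_fps_at_0 delta_fun_def)
  have "Delta_fps $ 1 = deriv delta_fun 0" unfolding Delta_fps_def by (simp add: fps_expansion_def)
  also have "(delta_fun has_field_derivative 1) (at 0)"
  proof -
    have "(eval_fps delta_log has_field_derivative eval_fps (fps_deriv delta_log) 0) (at 0)"
      by (intro has_field_derivative_eval_fps unit_disc_fps_radius delta_log_unit_disc) simp
    then have "(delta_fun has_field_derivative 0 * (exp (eval_fps delta_log 0) * eval_fps (fps_deriv delta_log) 0) + 1 * exp (eval_fps delta_log 0)) (at 0)"
      unfolding delta_fun_def[abs_def] by (intro DERIV_mult' DERIV_fun_exp DERIV_ident)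
    then show ?thesis by (simp add: eval_fps_at_0 delta_log_def)
  qed
  then have "deriv delta_fun 0 = 1" by (rule DERIV_imp_deriv)
  finally show "Delta_fps $ 1 = 1" .
qed

text \<open>The quotient \<open>\<phi>\<close> of both sides has derivative 0, because the
  logarithmic derivative of \<Delta> is E2 and the extra term of E2 matches the logarithmic
  derivative of \<tau>^12. Its constant value is read off at the fixed point \<i>, where \<i>^12 =
  1.\<close>

lemma Delta_fps_MF: "Delta_fps \<in> MF 12"
proof -
  define c :: complex where "c = 2 * of_real pi * \<i>"
  have c: "c \<noteq> 0" by (simp add: c_def)
  define \<phi> where "\<phi> = (\<lambda>\<tau>. eval_nome Delta_fps (- 1 / \<tau>) / (\<tau> ^ 12 * eval_nome Delta_fps \<tau>))"
  have E: "eval_nome (fps_theta Delta_fps) x = eval_nome E2_fps x * eval_nome Delta_fps x" if "x \<in> UHP" for x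
    using that by (simp add: fps_theta_Delta eval_nome_mult E2_fps_unit_disc Delta_fps_unit_disc)
  have "(\<phi> has_field_derivative 0) (at \<tau>)" if \<tau>: "\<tau> \<in> UHP" for \<tau>
  proof -
    note \<tau>0 = UHP_nonzero[OF \<tau>] and D0 = eval_nome_Delta_nonzero[OF \<tau>] and \<tau>' = UHP_minus_inverse[OF \<tau>]
    have 1: "((\<lambda>x. - 1 / x) has_field_derivative 1 / \<tau>\<^sup>2) (at \<tau>)"
      using \<tau>0 by (auto intro!: derivative_eq_intros simp: power2_eq_square)
    have 2: "((\<lambda>x. eval_nome Delta_fps (- 1 / x)) has_field_derivative
       c * (eval_nome E2_fps (- 1 / \<tau>) * eval_nome Delta_fps (- 1 / \<tau>)) * (1 / \<tau>\<^sup>2)) (at \<tau>)"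
      using DERIV_chain2[OF has_field_derivative_eval_nome[OF Delta_fps_unit_disc \<tau>'] 1]
      unfolding E[OF \<tau>'] c_def .
    have 3: "((\<lambda>x. x ^ 12 * eval_nome Delta_fps x) has_field_derivative
       12 * \<tau> ^ 11 * eval_nome Delta_fps \<tau> + c * (eval_nome E2_fps \<tau> * eval_nome Delta_fps \<tau>) * \<tau> ^ 12) (at \<tau>)"
      using has_field_derivative_eval_nome[OF Delta_fps_unit_disc \<tau>]
      by (auto intro!: derivative_eq_intros simp: E[OF \<tau>] c_def)
    have "(\<phi> has_field_derivative
       (c * (eval_nome E2_fps (- 1 / \<tau>) * eval_nome Delta_fps (- 1 / \<tau>)) * (1 / \<tau>\<^sup>2) * (\<tau> ^ 12 * eval_nome Delta_fps \<tau>) -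
        eval_nome Delta_fps (- 1 / \<tau>) * (12 * \<tau> ^ 11 * eval_nome Delta_fps \<tau> + c * (eval_nome E2_fps \<tau> * eval_nome Delta_fps \<tau>) * \<tau> ^ 12))
        / ((\<tau> ^ 12 * eval_nome Delta_fps \<tau>) * (\<tau> ^ 12 * eval_nome Delta_fps \<tau>))) (at \<tau>)"
      unfolding \<phi>_def using DERIV_divide[OF 2 3] \<tau>0 D0 by simp
    moreover have "c * (eval_nome E2_fps (- 1 / \<tau>) * X) * (1 / \<tau>\<^sup>2) * (\<tau> ^ 12 * Y) = X * (12 * \<tau> ^ 11 * Y + c * (eval_nome E2_fps \<tau> * Y) * \<tau> ^ 12)" for X Y
    proof -
      have "c * (eval_nome E2_fps (- 1 / \<tau>) * X) * (1 / \<tau>\<^sup>2) * (\<tau> ^ 12 * Y) = (c * eval_nome E2_fps (- 1 / \<tau>)) * (\<tau> ^ 12 / \<tau>\<^sup>2) * X * Y"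
        by (simp add: field_simps)
      also have "\<tau> ^ 12 / \<tau>\<^sup>2 = \<tau> ^ 10" using \<tau>0 by (simp flip: power_diff)
      also have "c * eval_nome E2_fps (- 1 / \<tau>) = c * \<tau>\<^sup>2 * eval_nome E2_fps \<tau> + 12 * \<tau>"
        unfolding E2_fps_transformation[OF \<tau>, folded c_def] using c by (simp add: field_simps)
      also have "(c * \<tau>\<^sup>2 * eval_nome E2_fps \<tau> + 12 * \<tau>) * \<tau> ^ 10 * X * Y = X * (12 * (\<tau> * \<tau> ^ 10) * Y + c * (eval_nome E2_fps \<tau> * Y) * (\<tau>\<^sup>2 * \<tau> ^ 10))"
        by (simp only: algebra_simps)
      also have "\<tau> * \<tau> ^ 10 = \<tau> ^ 11" by (simp flip: power_Suc)
      also have "\<tau>\<^sup>2 * \<tau> ^ 10 = \<tau> ^ 12" by (simp flip: power_add)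
      finally show ?thesis .
    qed
    ultimately show ?thesis by simp
  qed
  then obtain C where C: "\<And>\<tau>. \<tau> \<in> UHP \<Longrightarrow> \<phi> \<tau> = C"
    using has_field_derivative_zero_constant[OF convex_UHP, of \<phi>] has_field_derivative_at_within by blast
  have i: "\<i> \<in> UHP" by (simp add: UHP_def)
  have "\<i> ^ 12 = (\<i> ^ 4) ^ 3" by (subst power_mult[symmetric]) simp
  also have "\<i> ^ 4 = 1" by (simp add: power4_eq_xxxx)
  finally have "\<i> ^ 12 = 1" by simp
  moreover have "- 1 / \<i> = \<i>" by simp
  ultimately have "\<phi> \<i> = 1" using eval_nome_Delta_nonzero[OF i] unfolding \<phi>_def by simp
  then have "C = 1" using C[OF i] by simp
  then have "eval_nome Delta_fps (- 1 / \<tau>) = \<tau> powi 12 * eval_nome Delta_fps \<tau>" if "\<tau> \<in> UHP" for \<tau>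
    using C[OF that] UHP_nonzero[OF that] eval_nome_Delta_nonzero[OF that] by (simp add: \<phi>_def flip: power_int_numeral)
  then show ?thesis by (auto simp: MF_def)
qed

section \<open>Orders at infinity and the valence bound\<close>

lemma fps_X_power_dvd_iff: "fps_X ^ n dvd (A :: 'a :: comm_ring_1 fps) \<longleftrightarrow> (\<forall>i<n. A $ i = 0)"
proof
  assume "\<forall>i<n. A $ i = 0"
  then have "A = fps_X ^ n * fps_shift n A"
    by (intro fps_ext) (simp add: fps_X_power_mult_nth)
  then show "fps_X ^ n dvd A" by (rule dvdI)
qed (auto simp: fps_X_power_mult_nth elim!: dvdE)

text \<open>A coarse reduction theory: after a translation to |Re| <= 1/2, a point with Im < 1/2
  satisfies |\<tau>|^2 <= 1/2, so inversion at least doubles Im. The lower bound 1 / 2^N limits the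
  number of rounds.\<close>

lemma MF_0_reduce:
  assumes "\<tau> \<in> UHP"
  shows "\<exists>\<tau>'. Im \<tau>' \<ge> 1 / 2 \<and> (\<forall>A\<in>MF 0. eval_nome A \<tau>' = eval_nome A \<tau>)"
proof -
  obtain N where "1 / Im \<tau> < 2 ^ N" using real_arch_pow[of 2 "1 / Im \<tau>"] by auto
  then have "Im \<tau> \<ge> 1 / 2 ^ N" using assms by (simp add: UHP_def field_simps)
  then show ?thesis using assms
  proof (induction N arbitrary: \<tau>)
    case 0
    then show ?case by (intro exI[of _ \<tau>]) auto
  next
    case (Suc N)
    show ?case
    proof (cases "Im \<tau> \<ge> 1 / 2")
      case False
      define \<tau>1 where "\<tau>1 = \<tau> + of_int (- round (Re \<tau>))"
      have \<tau>1: "\<tau>1 \<in> UHP" using Suc.prems by (simp add: \<tau>1_def UHP_def)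
      have y: "Im \<tau>1 = Im \<tau>" "Im \<tau> > 0" "Im \<tau> < 1 / 2" using Suc.prems False by (auto simp: \<tau>1_def UHP_def)
      have "\<bar>Re \<tau>1\<bar> \<le> 1 / 2" using of_int_round_abs_le[of "Re \<tau>"] by (simp add: \<tau>1_def abs_minus_commute)
      then have "\<bar>Re \<tau>1\<bar>\<^sup>2 \<le> (1 / 2)\<^sup>2" by (intro power_mono) auto
      moreover have "(Im \<tau>1)\<^sup>2 \<le> (1 / 2)\<^sup>2" using y by (intro power_mono) auto
      ultimately have le: "(Re \<tau>1)\<^sup>2 + (Im \<tau>1)\<^sup>2 \<le> 1 / 2" by (simp add: power2_eq_square)
      have pos: "(Re \<tau>1)\<^sup>2 + (Im \<tau>1)\<^sup>2 > 0" using y by (simp add: sum_power2_gt_zero_iff)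
      have "2 * Im \<tau> = Im \<tau>1 / (1 / 2)" using y by simp
      also have "\<dots> \<le> Im \<tau>1 / ((Re \<tau>1)\<^sup>2 + (Im \<tau>1)\<^sup>2)" using le pos y by (intro divide_left_mono) auto
      also have "\<dots> = Im (- 1 / \<tau>1)" by (simp add: Im_divide)
      finally have "Im (- 1 / \<tau>1) \<ge> 2 * Im \<tau>" .
      moreover have "1 / 2 ^ N \<le> 2 * Im \<tau>" using Suc.prems(1) by simp
      ultimately have "1 / 2 ^ N \<le> Im (- 1 / \<tau>1)" by linarith
      from Suc.IH[OF this UHP_minus_inverse[OF \<tau>1]] obtain \<tau>' where
        \<tau>': "Im \<tau>' \<ge> 1 / 2" "\<And>A. A \<in> MF 0 \<Longrightarrow> eval_nome A \<tau>' = eval_nome A (- 1 / \<tau>1)" by blast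
      have "eval_nome A (- 1 / \<tau>1) = eval_nome A \<tau>" if "A \<in> MF 0" for A
        using MF_transformation[OF that \<tau>1] periodic_int[of "eval_nome A" \<tau> "- round (Re \<tau>)"] Suc.prems(2)
        by (simp add: eval_nome_plus_1 \<tau>1_def)
      with \<tau>' show ?thesis by auto
    qed (intro exI[of _ \<tau>], auto)
  qed
qed

text \<open>By \<open>MF_0_reduce\<close> every value on the punctured disc is already taken on the
  closed disc of radius exp(-pi). So the modulus has an interior maximum and the maximum principle
  applies.\<close>

lemma MF_weight_0_const:
  assumes A: "A \<in> MF 0"
  shows "A = fps_const (A $ 0)"
proof -
  have disc: "A \<in> unit_disc_fps" using A by auto
  define r where "r = exp (- pi)"
  have r: "0 < r" "r < 1" by (auto simp: r_def)
  have hol: "eval_fps A holomorphic_on ball 0 1"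
    by (rule holomorphic_on_eval_fps) (use unit_disc_fps_radius[OF disc] in auto)
  then have cont: "continuous_on (cball 0 r) (\<lambda>z. norm (eval_fps A z))"
    using r by (intro continuous_on_norm holomorphic_on_imp_continuous_on holomorphic_on_subset[OF hol]) auto
  have "cball (0 :: complex) r \<noteq> {}" using r by simp
  then obtain z0 where z0: "z0 \<in> cball 0 r" "\<And>z. z \<in> cball 0 r \<Longrightarrow> norm (eval_fps A z) \<le> norm (eval_fps A z0)"
    using continuous_attains_sup[OF compact_cball _ cont] by blast
  have "norm (eval_fps A z) \<le> norm (eval_fps A z0)" if "z \<in> ball 0 1" for z
  proof (cases "z = 0")
    case False
    then have \<tau>: "log_nome z \<in> UHP" using that by (intro log_nome_UHP) auto
    then obtain \<tau>' where \<tau>': "Im \<tau>' \<ge> 1 / 2" "eval_nome A \<tau>' = eval_nome A (log_nome z)"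
      using MF_0_reduce[OF \<tau>] A by blast
    have "nome \<tau>' \<in> cball 0 r" using \<tau>'(1) by (simp add: norm_nome r_def)
    from z0(2)[OF this] \<tau>'(2) show ?thesis using False by (simp add: eval_nome_def nome_log_nome)
  qed (use z0 r in auto)
  then have "eval_fps A constant_on ball 0 1"
    using hol z0(1) r by (intro maximum_modulus_principle[where U = "ball 0 1" and \<xi> = z0]) auto
  then obtain c where c: "\<And>z. z \<in> ball 0 1 \<Longrightarrow> eval_fps A z = c" by (auto simp: constant_on_def)
  have "A = fps_const c"
    by (rule eval_nome_inject) (use disc c norm_nome_UHP in \<open>auto simp: eval_nome_def\<close>)
  then show ?thesis by simp
qed

lemma Delta_nonzero: "Delta_fps \<noteq> 0"
  using Delta_fps_nth(2) by auto

text \<open>A^12 \<Delta>^(-k) has weight 0, so it is constant, and it vanishes at the cusp.\<close>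

lemma MF_negative_weight:
  assumes A: "A \<in> MF k" and k: "k < 0"
  shows "A = 0"
proof (rule ccontr)
  assume "A \<noteq> 0"
  define B where "B = A ^ 12 * Delta_fps ^ nat (- k)"
  have "B \<in> MF (int 12 * k + int (nat (- k)) * 12)"
    unfolding B_def by (intro MF_mult MF_power A Delta_fps_MF)
  then have "B \<in> MF 0" using k by simp
  then have "B = fps_const (B $ 0)" by (rule MF_weight_0_const)
  moreover have "B $ 0 = 0" using k Delta_fps_nth(1) unfolding B_def by (simp add: zero_power)
  ultimately have "B = 0" by simp
  then show False using \<open>A \<noteq> 0\<close> Delta_nonzero by (simp add: B_def)
qed

text \<open>\<Delta> has a simple zero at q = 0 and no other, so the quotient is (A / q)
  exp(-\<open>delta_log\<close>), again a series on the unit disc.\<close>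

lemma MF_divide_Delta:
  assumes A: "A \<in> MF k" and A0: "A $ 0 = 0"
  obtains B where "B \<in> MF (k - 12)" "A = Delta_fps * B"
proof -
  have disc: "A \<in> unit_disc_fps" using A by auto
  define A1 where "A1 = fps_shift 1 A"
  have AX: "A = fps_X * A1" unfolding A1_def using A0 by (intro fps_ext) (auto simp: fps_X_mult_nth)
  have "A1 \<in> unit_disc_fps" using disc by (simp add: unit_disc_fps_def A1_def)
  then have "eval_fps A1 holomorphic_on ball 0 1"
    by (intro holomorphic_on_eval_fps) (use unit_disc_fps_radius[of A1] in auto)
  then have "(\<lambda>z. eval_fps A1 z * exp (- eval_fps delta_log z)) holomorphic_on ball 0 1"
    by (intro holomorphic_on_mult exp_delta_log_holomorphic)
  then obtain B where B: "B \<in> unit_disc_fps" "\<And>z. norm z < 1 \<Longrightarrow> eval_fps B z = eval_fps A1 z * exp (- eval_fps delta_log z)"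
    using unit_disc_fps_exists by blast
  have eq: "A = Delta_fps * B"
  proof (rule eval_nome_inject)
    fix \<tau> assume \<tau>: "\<tau> \<in> UHP"
    have "eval_nome A \<tau> = nome \<tau> * eval_nome A1 \<tau>"
      unfolding AX using \<open>A1 \<in> unit_disc_fps\<close> \<tau> by (subst eval_nome_mult) auto
    also have "\<dots> = eval_nome Delta_fps \<tau> * eval_nome B \<tau>"
    proof -
      have "eval_nome B \<tau> = eval_nome A1 \<tau> * exp (- eval_nome delta_log \<tau>)"
        using B(2)[OF norm_nome_UHP[OF \<tau>]] by (simp add: eval_nome_def)
      then show ?thesis unfolding eval_nome_Delta[OF \<tau>] by (simp add: exp_minus)
    qed
    also have "\<dots> = eval_nome (Delta_fps * B) \<tau>" using B(1) \<tau> by (subst eval_nome_mult) auto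
    finally show "eval_nome A \<tau> = eval_nome (Delta_fps * B) \<tau>" .
  qed (use disc B in auto)
  have "eval_nome B (- 1 / \<tau>) = \<tau> powi (k - 12) * eval_nome B \<tau>" if \<tau>: "\<tau> \<in> UHP" for \<tau>
  proof -
    note \<tau>0 = UHP_nonzero[OF \<tau>] and D0 = eval_nome_Delta_nonzero[OF \<tau>]
    have "eval_nome A x = eval_nome Delta_fps x * eval_nome B x" if "x \<in> UHP" for x
      unfolding eq using B(1) that by (subst eval_nome_mult) auto
    with MF_transformation[OF A \<tau>] MF_transformation[OF Delta_fps_MF \<tau>]
    have "\<tau> powi 12 * eval_nome Delta_fps \<tau> * eval_nome B (- 1 / \<tau>) = \<tau> powi k * (eval_nome Delta_fps \<tau> * eval_nome B \<tau>)"
      using UHP_minus_inverse[OF \<tau>] \<tau> by metis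
    moreover have "\<tau> powi k = \<tau> powi 12 * \<tau> powi (k - 12)" using \<tau>0 by (simp add: power_int_diff)
    ultimately show ?thesis using \<tau>0 D0 by (simp add: mult_ac)
  qed
  then have "B \<in> MF (k - 12)" using B(1) by (simp add: MF_def)
  then show ?thesis using eq by (rule that)
qed

lemma MF_order_bound:
  assumes "A \<in> MF k" "fps_X ^ m dvd A" "k < 12 * int m"
  shows "A = 0"
  using assms
proof (induction m arbitrary: A k)
  case 0
  then show ?case by (intro MF_negative_weight) auto
next
  case (Suc m)
  have "A $ 0 = 0" using Suc.prems(2) unfolding fps_X_power_dvd_iff by blast
  then obtain B where B: "B \<in> MF (k - 12)" "A = Delta_fps * B" using MF_divide_Delta Suc.prems(1) by blast
  \<comment> \<open>Since \<Delta> = q + ..., the coefficient i + 1 of \<Delta> B equals the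
    coefficient i of B once the earlier ones vanish.\<close>
  have "fps_X ^ m dvd B" unfolding fps_X_power_dvd_iff
  proof (intro allI impI)
    fix i assume "i < m"
    then show "B $ i = 0"
    proof (induction i rule: less_induct)
      case (less i)
      have "0 = A $ Suc i" using Suc.prems(2) less.prems unfolding fps_X_power_dvd_iff by simp
      also have "\<dots> = (\<Sum>j\<in>{0..Suc i}. Delta_fps $ j * B $ (Suc i - j))" unfolding B(2) by (simp only: fps_mult_nth)
      also have "\<dots> = (\<Sum>j\<in>{1}. Delta_fps $ j * B $ (Suc i - j))"
      proof (rule sum.mono_neutral_right)
        show "\<forall>j\<in>{0..Suc i} - {1}. Delta_fps $ j * B $ (Suc i - j) = 0"
        proof
          fix j assume j: "j \<in> {0..Suc i} - {1}"
          show "Delta_fps $ j * B $ (Suc i - j) = 0"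
          proof (cases j)
            case (Suc l)
            then have "Suc i - j < i" using j by auto
            then show ?thesis using less by auto
          qed (simp add: Delta_fps_nth)
        qed
      qed auto
      also have "\<dots> = B $ i" using Delta_fps_nth(2) by simp
      finally show ?case by simp
    qed
  qed
  then have "B = 0" using Suc.prems(3) B(1) by (intro Suc.IH) auto
  then show ?case using B(2) by simp
qed

section \<open>Ramanujan's identities\<close>

lemma sigma_fps_nth: "sigma_fps $ 0 = 0" "sigma_fps $ Suc 0 = 1"
  by (simp_all add: sigma_fps_def divisor_sigma_def)

lemma E2_fps_nth: "E2_fps $ 0 = 1" "E2_fps $ Suc 0 = - 24"
  by (simp_all add: E2_fps_def sigma_fps_nth fps_mult_nth_1)

lemma E4_fps_nth: "E4_fps $ 0 = 1" "E4_fps $ Suc 0 = 240"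
  by (simp_all add: E4_fps_def E2_fps_nth power2_eq_square fps_mult_nth_1)

lemma E6_fps_nth: "E6_fps $ 0 = 1" "E6_fps $ Suc 0 = - 504"
  by (simp_all add: E6_fps_def E4_fps_nth E2_fps_nth fps_mult_nth_1)

lemma theta_E2: "fps_theta E2_fps = fps_const (1 / 12) * (E2_fps\<^sup>2 - E4_fps)"
proof -
  have "E2_fps\<^sup>2 - E4_fps = fps_const 12 * fps_theta E2_fps" by (simp add: E4_fps_def numeral_fps_const)
  then show ?thesis by (simp add: mult.assoc[symmetric])
qed

lemma theta_E4: "fps_theta E4_fps = fps_const (1 / 3) * (E2_fps * E4_fps - E6_fps)"
proof -
  have "E2_fps * E4_fps - E6_fps = fps_const 3 * fps_theta E4_fps" by (simp add: E6_fps_def numeral_fps_const)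
  then show ?thesis by (simp add: mult.assoc[symmetric])
qed

text \<open>The Serre derivative of E6 plus E4^2 / 2 has weight 8 and constant term 0, so it
  vanishes by the valence bound.\<close>

lemma theta_E6: "fps_theta E6_fps = fps_const (1 / 2) * (E2_fps * E6_fps - E4_fps\<^sup>2)"
proof -
  have 1: "serre (of_int 6) E6_fps \<in> MF (6 + 2)" by (rule MF_serre[OF E6_fps_MF])
  have "E4_fps ^ 2 \<in> MF (int 2 * 4)" by (rule MF_power[OF E4_fps_MF])
  then have "fps_const (1 / 2) * E4_fps\<^sup>2 \<in> MF (6 + 2)" using MF_cmult by simp
  with 1 have "serre (of_int 6) E6_fps + fps_const (1 / 2) * E4_fps\<^sup>2 \<in> MF 8" using MF_add by fastforce
  moreover have "fps_X ^ 1 dvd serre (of_int 6) E6_fps + fps_const (1 / 2) * E4_fps\<^sup>2"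
    unfolding fps_X_power_dvd_iff by (simp add: serre_def E6_fps_nth E2_fps_nth E4_fps_nth power2_eq_square)
  ultimately have "serre (of_int 6) E6_fps + fps_const (1 / 2) * E4_fps\<^sup>2 = 0" by (rule MF_order_bound) simp
  then show ?thesis by (simp add: serre_def algebra_simps)
qed

text \<open>Weight 12 and order 2 force zero: the constant terms cancel, and at q one has 3 * 240 +
  2 * 504 = 1728.\<close>

lemma E4_cubed_minus_E6_squared: "E4_fps ^ 3 - E6_fps ^ 2 = 1728 * Delta_fps"
proof -
  have "E4_fps ^ 3 \<in> MF (int 3 * 4)" "E6_fps ^ 2 \<in> MF (int 2 * 6)"
    by (intro MF_power E4_fps_MF E6_fps_MF)+
  then have "E4_fps ^ 3 - E6_fps ^ 2 - fps_const 1728 * Delta_fps \<in> MF 12"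
    using MF_diff MF_cmult[OF Delta_fps_MF] by simp
  moreover have "fps_X ^ 2 dvd E4_fps ^ 3 - E6_fps ^ 2 - fps_const 1728 * Delta_fps"
    unfolding fps_X_power_dvd_iff numeral_2_eq_2 less_Suc_eq
    using Delta_fps_nth by (auto simp: power3_eq_cube E6_fps_nth E4_fps_nth fps_mult_nth_1)
  ultimately have "E4_fps ^ 3 - E6_fps ^ 2 - fps_const 1728 * Delta_fps = 0" by (rule MF_order_bound) simp
  then show ?thesis by (simp add: numeral_fps_const)
qed

section \<open>Quasimodular forms of depth 1\<close>

definition QMF :: "int \<Rightarrow> complex fps set" where
  "QMF w = {A + E2_fps * B | A B. A \<in> MF w \<and> B \<in> MF (w - 2)}"

lemma QMFI: "A \<in> MF w \<Longrightarrow> B \<in> MF (w - 2) \<Longrightarrow> A + E2_fps * B \<in> QMF w"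
  unfolding QMF_def by blast

lemma QMFE:
  assumes "F \<in> QMF w"
  obtains A B where "A \<in> MF w" "B \<in> MF (w - 2)" "F = A + E2_fps * B"
  using assms unfolding QMF_def by blast

lemma MF_subset_QMF: "MF w \<subseteq> QMF w"
  using QMFI[OF _ MF_0] by fastforce

lemma QMF_unit_disc: "F \<in> QMF w \<Longrightarrow> F \<in> unit_disc_fps"
  by (auto elim!: QMFE)

lemma QMF_add:
  assumes "F \<in> QMF w" "G \<in> QMF w"
  shows "F + G \<in> QMF w"
proof -
  obtain A B where F: "A \<in> MF w" "B \<in> MF (w - 2)" "F = A + E2_fps * B" using assms(1) by (rule QMFE)
  obtain C D where G: "C \<in> MF w" "D \<in> MF (w - 2)" "G = C + E2_fps * D" using assms(2) by (rule QMFE)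
  have "F + G = (A + C) + E2_fps * (B + D)" by (simp add: F G algebra_simps)
  then show ?thesis using QMFI[OF MF_add[OF F(1) G(1)] MF_add[OF F(2) G(2)]] by simp
qed

lemma QMF_mult:
  assumes "F \<in> QMF w" "C \<in> MF k"
  shows "C * F \<in> QMF (k + w)"
proof -
  obtain A B where F: "A \<in> MF w" "B \<in> MF (w - 2)" "F = A + E2_fps * B" using assms(1) by (rule QMFE)
  have "C * B \<in> MF (k + w - 2)" using MF_mult[OF assms(2) F(2)] by (simp add: algebra_simps)
  moreover have "C * F = C * A + E2_fps * (C * B)" by (simp add: F algebra_simps)
  ultimately show ?thesis using QMFI MF_mult[OF assms(2) F(1)] by metis
qed

lemma QMF_cmult: "F \<in> QMF w \<Longrightarrow> fps_const c * F \<in> QMF w"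
  using QMF_mult[OF _ MF_const, of F w c] by simp

lemma QMF_diff:
  assumes "F \<in> QMF w" "G \<in> QMF w"
  shows "F - G \<in> QMF w"
proof -
  have "fps_const (- 1) * G = - G" by (simp flip: fps_const_neg)
  then show ?thesis using QMF_add[OF assms(1) QMF_cmult[OF assms(2), of "- 1"]] by simp
qed

text \<open>With parameter weight minus depth, w - 1, the E2^2 B terms cancel: the derivative of E2
  contributes 1/12 and the weight of B contributes (w - 2)/12. So the depth does not rise.\<close>

lemma QMF_serre:
  assumes "F \<in> QMF w"
  shows "serre (of_int w - 1) F \<in> QMF (w + 2)"
proof -
  obtain A B where F: "A \<in> MF w" "B \<in> MF (w - 2)" "F = A + E2_fps * B" using assms by (rule QMFE)
  define e where "e = fps_const (1 / 12 :: complex)"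
  define k where "k = fps_const (of_int w / 12 :: complex)"
  have "serre (of_int w) A \<in> MF (w + 2)" by (rule MF_serre[OF F(1)])
  moreover have "e * (E4_fps * B) \<in> MF (w + 2)"
    using MF_cmult[OF MF_mult[OF E4_fps_MF F(2)]] by (simp add: e_def algebra_simps)
  ultimately have 1: "serre (of_int w) A - e * (E4_fps * B) \<in> MF (w + 2)" by (rule MF_diff)
  have "serre (of_int (w - 2)) B \<in> MF (w + 2 - 2)" using MF_serre[OF F(2)] by simp
  moreover have "e * A \<in> MF (w + 2 - 2)" unfolding e_def using MF_cmult[OF F(1)] by simp
  ultimately have 2: "e * A + serre (of_int (w - 2)) B \<in> MF (w + 2 - 2)" by (rule MF_add[rotated])
  have s1: "serre (of_int w - 1) F = fps_theta F - (k - e) * E2_fps * F"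
    by (simp add: serre_def k_def e_def diff_divide_distrib)
  have s2: "serre (of_int w) A = fps_theta A - k * E2_fps * A" by (simp add: serre_def k_def)
  have s3: "serre (of_int (w - 2)) B = fps_theta B - (k - e - e) * E2_fps * B"
    by (simp add: serre_def k_def e_def diff_divide_distrib)
  have t: "fps_theta E2_fps = e * (E2_fps * E2_fps - E4_fps)" by (simp add: theta_E2 e_def power2_eq_square)
  have "serre (of_int w - 1) F = (serre (of_int w) A - e * (E4_fps * B)) + E2_fps * (e * A + serre (of_int (w - 2)) B)"
    unfolding s1 s2 s3 unfolding F(3) fps_theta_add fps_theta_mult t by (simp add: algebra_simps)
  then show ?thesis using QMFI[OF 1 2] by simp
qed

section \<open>The order bound from a Wronskian\<close>

lemma fps_theta_X_power: "fps_theta (fps_X ^ n) = of_nat n * fps_X ^ n"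
  by (induction n) (simp_all add: fps_theta_mult algebra_simps)

lemma fps_X_power_dvd_theta: "fps_X ^ n dvd A \<Longrightarrow> fps_X ^ n dvd fps_theta A"
  by (simp add: fps_X_power_dvd_iff)

text \<open>Divided by A^2 the equation says that theta(B/A) = -c, but q d/dq of a Laurent series
  has no constant term. The proof compares lowest coefficients instead of forming the quotient; for
  equal orders the leading part of the Wronskian vanishes, which leaves c times a square.\<close>

lemma wronskian_zero:
  fixes A B :: "complex fps"
  assumes eq: "fps_const c * (A * A) + A * fps_theta B - B * fps_theta A = 0" and c: "c \<noteq> 0"
  shows "A = 0"
proof (rule ccontr)
  assume A0: "A \<noteq> 0"
  have B0: "B \<noteq> 0" using eq A0 c by auto
  define r s where "r = subdegree A" and "s = subdegree B"
  define a b where "a = fps_shift r A" and "b = fps_shift s B"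
  have A: "A = fps_X ^ r * a" and B: "B = fps_X ^ s * b"
    unfolding a_def b_def r_def s_def by (metis subdegree_decompose mult.commute)+
  have ab: "a $ 0 \<noteq> 0" "b $ 0 \<noteq> 0" using A0 B0 by (simp_all add: a_def b_def r_def s_def)
  define T where "T = (of_nat s - of_nat r) * (a * b) + a * fps_theta b - b * fps_theta a"
  have T0: "T $ 0 = (of_nat s - of_nat r) * (a $ 0 * b $ 0)" by (simp add: T_def)
  have "fps_const c * (A * A) + A * fps_theta B - B * fps_theta A
      = fps_const c * (fps_X ^ r * fps_X ^ r * (a * a)) + fps_X ^ r * fps_X ^ s * T"
    unfolding A B T_def fps_theta_mult fps_theta_X_power by (simp add: algebra_simps)
  with eq have eq': "fps_const c * (fps_X ^ r * fps_X ^ r * (a * a)) + fps_X ^ r * fps_X ^ s * T = 0" by simp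
  show False
  proof (cases "s < r")
    case True
    then have rs: "fps_X ^ r = fps_X ^ s * (fps_X ^ (r - s) :: complex fps)" by (simp flip: power_add)
    have "fps_X ^ r * fps_X ^ s * (fps_const c * (fps_X ^ (r - s) * (a * a)) + T) = 0"
      using eq' by (subst (asm) (2) rs) (simp add: algebra_simps)
    then have "fps_const c * (fps_X ^ (r - s) * (a * a)) + T = 0" by simp
    then have "(fps_const c * (fps_X ^ (r - s) * (a * a)) + T) $ 0 = 0" by simp
    then have "T $ 0 = 0" using True by (simp add: startsby_zero_power)
    then show False using T0 ab True by simp
  next
    case False
    then have rs: "fps_X ^ s = fps_X ^ r * (fps_X ^ (s - r) :: complex fps)" by (simp flip: power_add)
    have "fps_X ^ r * fps_X ^ r * (fps_const c * (a * a) + fps_X ^ (s - r) * T) = 0"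
      using eq' unfolding rs by (simp add: algebra_simps)
    then have "fps_const c * (a * a) + fps_X ^ (s - r) * T = 0" by simp
    then have "(fps_const c * (a * a)) $ 0 + (fps_X ^ (s - r) * T) $ 0 = 0" by (metis fps_add_nth fps_zero_nth)
    moreover have "(fps_X ^ (s - r) * T) $ 0 = 0" using T0 False by (cases "s = r") (simp_all add: startsby_zero_power)
    ultimately have "(fps_const c * (a * a)) $ 0 = 0" by (simp only: add_0_right)
    then show False using c ab by simp
  qed
qed

text \<open>The Wronskian of the two components of the vector-valued form attached to a quasimodular
  form \<open>F = A + E2 B\<close> is modular of weight \<open>2 w\<close>, which bounds the order of \<open>F\<close> at infinity.\<close>

lemma QMF_order_bound:
  assumes F: "F \<in> QMF w" and X: "fps_X ^ m dvd F" and w: "w < 6 * int m"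
  shows "F = 0"
proof -
  obtain A B where AB: "A \<in> MF w" "B \<in> MF (w - 2)" "F = A + E2_fps * B" using F by (rule QMFE)
  define e where "e = fps_const (1 / 12 :: complex)"
  define k where "k = fps_const (of_int w / 12 :: complex)"
  define W where "W = e * (F * F) + F * fps_theta B - B * fps_theta F"
  have s2: "serre (of_int w) A = fps_theta A - k * E2_fps * A" by (simp add: serre_def k_def)
  have s3: "serre (of_int (w - 2)) B = fps_theta B - (k - e - e) * E2_fps * B"
    by (simp add: serre_def k_def e_def diff_divide_distrib)
  have t: "fps_theta E2_fps = e * (E2_fps * E2_fps - E4_fps)" by (simp add: theta_E2 e_def power2_eq_square)
  \<comment> \<open>After substituting F = A + E2 B every occurrence of E2 outside the Serre
    derivatives cancels, which exhibits W as modular of weight 2 w.\<close>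
  have W_eq: "W = A * serre (of_int (w - 2)) B - B * serre (of_int w) A + e * (E4_fps * (B * B) + A * A)"
    unfolding W_def s2 s3 AB(3) fps_theta_add fps_theta_mult t by (simp add: algebra_simps)
  have "A * serre (of_int (w - 2)) B \<in> MF (2 * w)"
    using MF_mult[OF AB(1) MF_serre[OF AB(2)]] by (simp add: algebra_simps)
  moreover have "B * serre (of_int w) A \<in> MF (2 * w)"
    using MF_mult[OF AB(2) MF_serre[OF AB(1)]] by (simp add: algebra_simps)
  moreover have "E4_fps * (B * B) \<in> MF (2 * w)"
    using MF_mult[OF E4_fps_MF MF_mult[OF AB(2) AB(2)]] by (simp add: algebra_simps)
  moreover have "A * A \<in> MF (2 * w)" using MF_mult[OF AB(1) AB(1)] by simp
  ultimately have "W \<in> MF (2 * w)" unfolding W_eq e_def by (intro MF_add MF_diff MF_cmult)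
  \<comment> \<open>Each summand of W contains F or its derivative as a factor, so W inherits the
    order m, and 2 w < 12 m.\<close>
  moreover have "fps_X ^ m dvd W" unfolding W_def
    using X fps_X_power_dvd_theta[OF X] by (intro dvd_diff dvd_add) auto
  ultimately have "W = 0" using w by (intro MF_order_bound[of W "2 * w" m]) auto
  then show ?thesis unfolding W_def e_def by (rule wronskian_zero) simp
qed

section \<open>The Kaneko-Zagier equation\<close>

lemma fps_mult_nth_if_dvd:
  fixes A C :: "'a :: comm_ring_1 fps"
  assumes "fps_X ^ n dvd A"
  shows "(C * A) $ n = C $ 0 * A $ n"
proof -
  obtain B where B: "A = fps_X ^ n * B" using assms by (elim dvdE)
  have CA: "C * A = fps_X ^ n * (C * B)" by (simp only: B mult_ac)
  show ?thesis unfolding CA unfolding B fps_X_power_mult_nth by simp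
qed

lemma serre_nth:
  assumes "fps_X ^ n dvd A"
  shows "serre k A $ n = (of_nat n - k / 12) * A $ n"
  unfolding serre_def mult.assoc
  by (simp add: fps_mult_nth_if_dvd[OF assms] E2_fps_nth left_diff_distrib)

lemma fps_X_power_dvd_serre:
  assumes "fps_X ^ n dvd A"
  shows "fps_X ^ n dvd serre k A"
  unfolding serre_def using assms fps_X_power_dvd_theta[OF assms] by (intro dvd_diff dvd_mult) auto

text \<open>Both parameters are weight minus depth, for weights 6 n and 6 n + 2. The constant is (n
  - (6 n + 1)/12) (n - (6 n - 1)/12), so that the coefficients of q^n agree for a series of order
  n.\<close>

definition kaneko_zagier :: "nat \<Rightarrow> complex fps \<Rightarrow> bool" where
  "kaneko_zagier n G \<longleftrightarrow> serre (6 * of_nat n + 1) (serre (6 * of_nat n - 1) G)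
     = fps_const ((36 * of_nat n ^ 2 - 1) / 144) * (E4_fps * G)"

lemma extremal_imp_kaneko_zagier:
  assumes G: "G \<in> QMF (6 * int n)" and X: "fps_X ^ n dvd G"
  shows "kaneko_zagier n G"
proof -
  define L where "L = serre (6 * of_nat n + 1) (serre (6 * of_nat n - 1) G) - fps_const ((36 * of_nat n ^ 2 - 1) / 144) * (E4_fps * G)"
  have "serre (6 * of_nat n - 1) G \<in> QMF (6 * int n + 2)" using QMF_serre[OF G] by simp
  moreover have "of_int (6 * int n + 2) - 1 = (6 * of_nat n + 1 :: complex)" "6 * int n + 2 + 2 = 6 * int n + 4" by simp_all
  ultimately have "serre (6 * of_nat n + 1) (serre (6 * of_nat n - 1) G) \<in> QMF (6 * int n + 4)"
    using QMF_serre by metis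
  moreover have "fps_const ((36 * of_nat n ^ 2 - 1) / 144) * (E4_fps * G) \<in> QMF (6 * int n + 4)"
    using QMF_cmult[OF QMF_mult[OF G E4_fps_MF]] by (simp add: add.commute)
  ultimately have "L \<in> QMF (6 * int n + 4)" unfolding L_def by (rule QMF_diff)
  moreover have "fps_X ^ Suc n dvd L" unfolding fps_X_power_dvd_iff
  proof (intro allI impI)
    have "fps_X ^ n dvd L" unfolding L_def by (intro dvd_diff fps_X_power_dvd_serre dvd_mult X)
    moreover have "L $ n = 0"
    proof -
      have "(E4_fps * G) $ n = G $ n" by (simp add: fps_mult_nth_if_dvd[OF X] E4_fps_nth)
      then show ?thesis unfolding L_def
        by (simp add: serre_nth X fps_X_power_dvd_serre) (simp add: field_simps power2_eq_square)
    qed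
    ultimately show "L $ i = 0" if "i < Suc n" for i using that by (auto simp: fps_X_power_dvd_iff less_Suc_eq)
  qed
  ultimately have "L = 0" by (rule QMF_order_bound) simp
  then show ?thesis unfolding L_def kaneko_zagier_def by simp
qed

text \<open>The indicial equation is r (r - n) = 0, whereas the difference of the two solutions
  would have an order r > n.\<close>

lemma kaneko_zagier_unique:
  assumes G: "kaneko_zagier n G" "fps_X ^ n dvd G" and H: "kaneko_zagier n H" "fps_X ^ n dvd H" and "G $ n = H $ n"
  shows "G = H"
proof (rule ccontr)
  define F where "F = G - H"
  assume "G \<noteq> H"
  then have F0: "F \<noteq> 0" by (simp add: F_def)
  have sd: "serre k G - serre k H = serre k (G - H)" for k G H
    by (simp add: serre_def fps_theta_diff algebra_simps)
  have kz: "serre (6 * of_nat n + 1) (serre (6 * of_nat n - 1) F) = fps_const ((36 * of_nat n ^ 2 - 1) / 144) * (E4_fps * F)"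
    using G(1) H(1) unfolding kaneko_zagier_def F_def sd[symmetric] by (simp add: algebra_simps)
  define r where "r = subdegree F"
  have Fr: "F $ r \<noteq> 0" using F0 by (simp add: r_def)
  have X: "fps_X ^ r dvd F" unfolding fps_X_power_dvd_iff r_def using nth_less_subdegree_zero by blast
  have "F $ i = 0" if "i \<le> n" for i
    using that G(2) H(2) assms(5) unfolding F_def fps_X_power_dvd_iff by (cases "i = n") auto
  then have "r > n" using Fr by (metis not_le)
  have "(E4_fps * F) $ r = F $ r" by (simp add: fps_mult_nth_if_dvd[OF X] E4_fps_nth)
  then have "(of_nat r - (6 * of_nat n + 1) / 12) * ((of_nat r - (6 * of_nat n - 1) / 12) * F $ r)
     = (36 * of_nat n ^ 2 - 1) / 144 * F $ r"
    using arg_cong[OF kz, of "\<lambda>f. f $ r"] by (simp add: serre_nth X fps_X_power_dvd_serre)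
  then have "(of_nat r - (6 * of_nat n + 1) / 12) * (of_nat r - (6 * of_nat n - 1) / 12) = (36 * of_nat n ^ 2 - 1) / (144 :: complex)"
    using Fr by (metis mult.assoc mult_right_cancel)
  then have "of_nat r * (of_nat r - of_nat n) = (0 :: complex)"
    by (simp add: field_simps power2_eq_square)
  then show False using \<open>r > n\<close> by simp
qed

section \<open>Integral power series\<close>

definition int_fps :: "complex fps \<Rightarrow> bool" where
  "int_fps A \<longleftrightarrow> (\<forall>n. A $ n \<in> \<int>)"

lemma int_fps_nth: "int_fps A \<Longrightarrow> A $ n \<in> \<int>"
  by (simp add: int_fps_def)

lemma int_fps_0 [simp]: "int_fps 0" and int_fps_1 [simp]: "int_fps 1"
  and int_fps_numeral [simp]: "int_fps (numeral k)" and int_fps_X [simp]: "int_fps fps_X"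
  by (auto simp: int_fps_def fps_numeral_nth fps_X_nth fps_one_nth)

lemma int_fps_add: "int_fps A \<Longrightarrow> int_fps B \<Longrightarrow> int_fps (A + B)"
  and int_fps_diff: "int_fps A \<Longrightarrow> int_fps B \<Longrightarrow> int_fps (A - B)"
  and int_fps_uminus: "int_fps A \<Longrightarrow> int_fps (- A)"
  and int_fps_mult: "int_fps A \<Longrightarrow> int_fps B \<Longrightarrow> int_fps (A * B)"
  and int_fps_theta: "int_fps A \<Longrightarrow> int_fps (fps_theta A)"
  by (auto simp: int_fps_def fps_mult_nth intro!: Ints_sum)

lemma int_fps_power: "int_fps A \<Longrightarrow> int_fps (A ^ n)"
  by (induction n) (auto intro: int_fps_mult)

lemmas int_fps_intros = int_fps_add int_fps_diff int_fps_uminus int_fps_mult int_fps_theta int_fps_power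
  int_fps_0 int_fps_1 int_fps_numeral int_fps_X

lemma int_fps_compose: "int_fps A \<Longrightarrow> int_fps B \<Longrightarrow> int_fps (A oo B)"
  unfolding int_fps_def fps_compose_nth using int_fps_power[of B] by (auto simp: int_fps_def intro!: Ints_sum Ints_mult)

lemma int_fps_inverse:
  assumes A: "int_fps A" "A $ 0 = 1" and AB: "A * B = 1"
  shows "int_fps B"
  unfolding int_fps_def
proof
  fix n show "B $ n \<in> \<int>"
  proof (induction n rule: less_induct)
    case (less n)
    have "(1 :: complex fps) $ n = (\<Sum>i\<in>{0..n}. A $ i * B $ (n - i))"
      unfolding AB[symmetric] by (simp only: fps_mult_nth)
    also have "\<dots> = B $ n + (\<Sum>i\<in>{Suc 0..n}. A $ i * B $ (n - i))"
      by (subst sum.atLeast_Suc_atMost) (simp_all add: A(2))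
    finally have "B $ n = (1 :: complex fps) $ n - (\<Sum>i\<in>{Suc 0..n}. A $ i * B $ (n - i))" by simp
    also have "\<dots> \<in> \<int>"
      using less int_fps_nth[OF A(1)] int_fps_nth[OF int_fps_1] by (intro Ints_diff Ints_sum Ints_mult) auto
    finally show ?case .
  qed
qed

text \<open>T = (sqrt(1 + 4 k C) - 1) / (2 k) exists by the binomial series. Its integrality follows
  from the quadratic equation read as a recursion: since T has no constant term, the coefficient n
  of T^2 only involves earlier coefficients.\<close>

lemma int_fps_quadratic_root:
  assumes C: "int_fps C" "C $ 0 = 0" and k: "k > 0"
  obtains T where "int_fps T" "T $ 0 = 0" "T + of_nat k * (T * T) = C"
proof -
  define U where "U = fps_const (4 * of_nat k) * C"
  define S where "S = fps_binomial (1 / 2) oo U"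
  have U0: "U $ 0 = 0" using C by (simp add: U_def)
  have "S * S = (fps_binomial (1 / 2) * fps_binomial (1 / 2)) oo U"
    unfolding S_def by (rule fps_compose_mult_distrib[OF U0, symmetric])
  also have "fps_binomial (1 / 2) * fps_binomial (1 / 2) = (fps_binomial (1 / 2 + 1 / 2) :: complex fps)"
    by (rule fps_binomial_add_mult[symmetric])
  also have "\<dots> = 1 + fps_X" by (simp add: fps_binomial_1)
  finally have SS: "S * S = 1 + U" using U0 by (simp add: fps_compose_add_distrib)
  define T where "T = fps_const (1 / (2 * of_nat k)) * (S - 1)"
  have S: "S = 1 + fps_const (2 * of_nat k) * T" using k by (simp add: T_def mult.assoc[symmetric])
  have T0: "T $ 0 = 0" by (simp add: T_def S_def fps_binomial_nth)
  have "fps_const (4 * of_nat k) * (T + of_nat k * (T * T)) = S * S - 1"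
  proof -
    have "fps_const (2 * of_nat k :: complex) = 2 * of_nat k" "fps_const (4 * of_nat k :: complex) = 4 * of_nat k"
      by (simp_all add: numeral_fps_const fps_of_nat[symmetric])
    then show ?thesis unfolding S by (simp add: algebra_simps)
  qed
  then have "fps_const (4 * of_nat k) * (T + of_nat k * (T * T)) = fps_const (4 * of_nat k) * C"
    by (simp add: SS U_def)
  then have eq: "T + of_nat k * (T * T) = C" using k by simp
  have "T $ n \<in> \<int>" for n
  proof (induction n rule: less_induct)
    case (less n)
    have "T $ n = C $ n - of_nat k * (T * T) $ n"
      using arg_cong[OF eq, of "\<lambda>f. f $ n"] by (simp add: fps_of_nat[symmetric] eq_diff_eq)
    moreover have "(T * T) $ n \<in> \<int>" unfolding fps_mult_nth
    proof (rule Ints_sum)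
      fix i assume i: "i \<in> {0..n}"
      show "T $ i * T $ (n - i) \<in> \<int>"
      proof (cases "i = 0 \<or> i = n")
        case False
        then show ?thesis using i less[of i] less[of "n - i"] by (intro Ints_mult) auto
      qed (use T0 in auto)
    qed
    ultimately show ?case using int_fps_nth[OF C(1)] by (auto intro: Ints_diff Ints_mult)
  qed
  then show ?thesis using that[of T] T0 eq by (simp add: int_fps_def)
qed

lemma int_fps_sigma: "int_fps sigma_fps"
  by (auto simp: int_fps_def sigma_fps_def)

lemma int_fps_E2: "int_fps E2_fps" and int_fps_E4: "int_fps E4_fps" and int_fps_E6: "int_fps E6_fps"
proof -
  show 2: "int_fps E2_fps" unfolding E2_fps_def by (intro int_fps_intros int_fps_sigma)
  show 4: "int_fps E4_fps" unfolding E4_fps_def by (intro int_fps_intros 2)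
  show "int_fps E6_fps" unfolding E6_fps_def by (intro int_fps_intros 2 4)
qed

definition E4_aux :: "complex fps" where
  "E4_aux = 12 * sigma_fps ^ 2 + 6 * fps_theta sigma_fps - sigma_fps"

lemma E4_fps_eq: "E4_fps = 1 + 48 * E4_aux"
  unfolding E4_fps_def E2_fps_def E4_aux_def
  by (simp add: fps_theta_diff fps_theta_mult power2_eq_square algebra_simps)

lemma int_fps_E4_aux: "int_fps E4_aux"
  unfolding E4_aux_def by (intro int_fps_intros int_fps_sigma)

text \<open>The congruence \<open>E4 = 1 (mod 48)\<close> makes the fourth root of \<open>E4\<close> integral.\<close>

lemma E4_root_exists: "\<exists>R. int_fps R \<and> R $ 0 = 1 \<and> R ^ 4 = E4_fps"
proof -
  \<comment> \<open>Two nested square roots: E4 = 1 + 16 (3 \<open>E4_aux\<close>) is the square of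
    1 + 8 T, and 1 + 8 T is the square of 1 + 4 V.\<close>
  have "int_fps (3 * E4_aux)" "(3 * E4_aux) $ 0 = 0"
    by (intro int_fps_intros int_fps_E4_aux) (simp add: E4_aux_def sigma_fps_nth power2_eq_square)
  then obtain T where T: "int_fps T" "T $ 0 = 0" "T + of_nat 4 * (T * T) = 3 * E4_aux"
    by (rule int_fps_quadratic_root[where k = 4]) auto
  obtain V where V: "int_fps V" "V $ 0 = 0" "V + of_nat 2 * (V * V) = T"
    using T(1,2) by (rule int_fps_quadratic_root[where k = 2]) auto
  define R where "R = 1 + 4 * V"
  have "int_fps R" unfolding R_def by (intro int_fps_intros V)
  moreover have "R $ 0 = 1" by (simp add: R_def V)
  moreover have "R ^ 4 = E4_fps"
  proof -
    have RR: "R * R = 1 + 8 * T" unfolding R_def V(3)[symmetric] by (simp add: algebra_simps)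
    have "R ^ 4 = (R * R) * (R * R)" by (simp add: power4_eq_xxxx mult.assoc)
    also have "\<dots> = 1 + 16 * (T + of_nat 4 * (T * T))" unfolding RR by (simp add: algebra_simps)
    also have "\<dots> = E4_fps" unfolding T(3) E4_fps_eq by simp
    finally show ?thesis .
  qed
  ultimately show ?thesis by blast
qed

definition E4_root :: "complex fps" where
  "E4_root = (SOME R. int_fps R \<and> R $ 0 = 1 \<and> R ^ 4 = E4_fps)"

lemma E4_root: "int_fps E4_root" "E4_root $ 0 = 1" "E4_root ^ 4 = E4_fps"
  using someI_ex[OF E4_root_exists] unfolding E4_root_def by blast+

definition E4_root_inv :: "complex fps" where
  "E4_root_inv = inverse E4_root"

lemma E4_root_inv: "E4_root * E4_root_inv = 1" "E4_root_inv $ 0 = 1" "int_fps E4_root_inv"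
proof -
  show 1: "E4_root * E4_root_inv = 1"
    unfolding E4_root_inv_def using E4_root(2) by (simp add: inverse_mult_eq_1')
  show "E4_root_inv $ 0 = 1" unfolding E4_root_inv_def using E4_root(2) by simp
  show "int_fps E4_root_inv" using int_fps_inverse[OF E4_root(1,2) 1] .
qed

section \<open>Integrality of the discriminant\<close>

text \<open>This is (E6 - 1) / 72 written as an integral polynomial in \<open>sigma_fps\<close>,
  \<open>E4_aux\<close> and their derivatives.\<close>

definition E6_aux :: "complex fps" where
  "E6_aux = 4 * (2 * sigma_fps ^ 2 + fps_theta sigma_fps) - sigma_fps - 16 * sigma_fps * E4_aux - 2 * fps_theta E4_aux"

lemma Delta_fps_eq:
  "Delta_fps = 4 * E4_aux ^ 2 + 64 * E4_aux ^ 3 + 4 * sigma_fps * fps_theta sigma_fps + fps_theta (fps_theta sigma_fps)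
     - sigma_fps ^ 2 + 8 * sigma_fps * (2 * sigma_fps ^ 2 + fps_theta sigma_fps) - 3 * E6_aux ^ 2" (is "_ = ?D")
proof -
  define S S1 S2 A where "S = sigma_fps" and "S1 = fps_theta S" and "S2 = fps_theta S1" and "A = E4_aux"
  have A_eq: "A = 12 * S ^ 2 + 6 * S1 - S" by (simp add: A_def E4_aux_def S_def S1_def)
  have tA: "fps_theta A = 24 * S * S1 + 6 * S2 - S1"
    unfolding A_eq by (simp add: fps_theta_add fps_theta_diff fps_theta_mult power2_eq_square S1_def[symmetric] S2_def[symmetric] algebra_simps)
  have E6: "E6_fps = 1 + 72 * E6_aux"
  proof -
    have "E6_fps = (1 - 24 * S) * (1 + 48 * A) - 144 * fps_theta A"
      unfolding E6_fps_def E2_fps_def E4_fps_eq S_def[symmetric] A_def[symmetric]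
      by (simp add: fps_theta_add fps_theta_mult)
    also have "\<dots> = 1 + 24 * (2 * A - S - 48 * S * A - 6 * fps_theta A)" by (simp add: algebra_simps)
    also have "\<dots> = 1 + 72 * E6_aux" unfolding E6_aux_def S_def[symmetric] S1_def[symmetric] A_def[symmetric]
      unfolding A_eq by (simp add: algebra_simps power2_eq_square)
    finally show ?thesis .
  qed
  define B where "B = E6_aux"
  have B_eq: "B = 4 * (2 * S ^ 2 + S1) - S - 16 * S * A - 2 * (24 * S * S1 + 6 * S2 - S1)"
    unfolding B_def E6_aux_def tA[symmetric] S_def[symmetric] S1_def[symmetric] A_def[symmetric] ..
  have "1728 * Delta_fps = E4_fps ^ 3 - E6_fps ^ 2" by (rule E4_cubed_minus_E6_squared[symmetric])
  also have "\<dots> = (1 + 48 * A) ^ 3 - (1 + 72 * B) ^ 2" by (simp only: E4_fps_eq E6 A_def B_def)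
  \<comment> \<open>The higher terms carry 1728 by themselves: 3 * 48^2 = 4 * 1728, 48^3 = 64 * 1728
    and 72^2 = 3 * 1728. Only 144 (A - B) needs a further factor 12, which appears once A and B are
    expanded in S and its derivatives.\<close>
  also have "\<dots> = 1728 * (4 * A ^ 2 + 64 * A ^ 3 - 3 * B ^ 2) + 144 * (A - B)"
    by (simp add: algebra_simps power2_eq_square power3_eq_cube)
  also have "144 * (A - B) = 1728 * (4 * S * S1 + S2 - S ^ 2 + 8 * S * (2 * S ^ 2 + S1))"
    unfolding B_eq unfolding A_eq by (simp add: algebra_simps power2_eq_square)
  finally have "1728 * Delta_fps = 1728 * ?D"
    unfolding S_def S1_def S2_def A_def B_def by (simp only: algebra_simps)
  then show ?thesis by (subst (asm) mult_left_cancel) simp_all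
qed

lemma int_fps_Delta: "int_fps Delta_fps"
proof -
  have "int_fps E6_aux" unfolding E6_aux_def by (intro int_fps_intros int_fps_sigma int_fps_E4_aux)
  then show ?thesis unfolding Delta_fps_eq by (intro int_fps_intros int_fps_sigma int_fps_E4_aux)
qed

section \<open>The hypergeometric expression of the extremal forms\<close>

definition j_inv :: "complex fps" where
  "j_inv = Delta_fps * E4_root_inv ^ 12"

text \<open>E6 / E4 is the logarithmic derivative of 1/j, as \<open>theta_j_inv\<close>
  shows.\<close>

definition E6_E4_quot :: "complex fps" where
  "E6_E4_quot = E6_fps * E4_root_inv ^ 4"

lemma j_inv_nth: "j_inv $ 0 = 0" "j_inv $ 1 = 1"
  using Delta_fps_nth E4_root_inv(2) by (simp_all add: j_inv_def fps_mult_nth_1 fps_power_zeroth)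

lemma int_fps_j_inv: "int_fps j_inv"
  unfolding j_inv_def by (intro int_fps_intros int_fps_Delta E4_root_inv)

lemma E4_mult_root_inv: "E4_fps * E4_root_inv ^ 4 = 1"
  unfolding E4_root(3)[symmetric] power_mult_distrib[symmetric] E4_root_inv(1) by simp

lemma fps_theta_power: "fps_theta (A ^ n) = of_nat n * A ^ n * B" if "fps_theta A = A * B"
proof (induction n)
  case (Suc n)
  then show ?case using that by (simp add: fps_theta_mult algebra_simps)
qed simp

text \<open>The constant 1/12 as an atom, so that identities between series reduce to ring
  normalisation with the single rule 12 * \<open>fps_12th\<close> = 1.\<close>

definition fps_12th :: "complex fps" where "fps_12th = fps_const (1 / 12)"

lemma fps_12th: "12 * fps_12th = 1"
  by (simp add: fps_12th_def numeral_fps_const)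

lemma theta_E4_root: "fps_theta E4_root = E4_root * (fps_12th * (E2_fps - E6_E4_quot))"
proof -
  have "fps_theta (E4_root ^ 4) = 4 * E4_root ^ 3 * fps_theta E4_root"
    by (simp add: fps_theta_mult power4_eq_xxxx power3_eq_cube algebra_simps)
  then have "4 * E4_root ^ 3 * fps_theta E4_root = fps_const (1 / 3) * (E2_fps * E4_fps - E6_fps)"
    unfolding E4_root(3) theta_E4 by simp
  then have "(4 * E4_root ^ 3) * fps_theta E4_root = (4 * fps_12th) * (E2_fps * E4_fps - E6_fps)"
    by (simp add: fps_12th_def numeral_fps_const)
  also have "E6_fps = E6_E4_quot * E4_fps"
    unfolding E6_E4_quot_def using E4_mult_root_inv by (simp add: mult_ac)
  also have "(4 * fps_12th) * (E2_fps * E4_fps - E6_E4_quot * E4_fps) = (4 * E4_root ^ 3) * (E4_root * (fps_12th * (E2_fps - E6_E4_quot)))"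
    unfolding E4_root(3)[symmetric] by (simp add: algebra_simps power4_eq_xxxx power3_eq_cube)
  finally show ?thesis using E4_root(2) by (subst (asm) mult_left_cancel) auto
qed

lemma theta_E4_root_inv: "fps_theta E4_root_inv = E4_root_inv * (- (fps_12th * (E2_fps - E6_E4_quot)))"
proof -
  have "fps_theta (E4_root * E4_root_inv) = 0" by (simp add: E4_root_inv(1))
  then have "E4_root * (fps_theta E4_root_inv + E4_root_inv * (fps_12th * (E2_fps - E6_E4_quot))) = 0"
    unfolding fps_theta_mult theta_E4_root by (simp add: algebra_simps)
  moreover have "E4_root \<noteq> 0" using E4_root(2) by auto
  ultimately show ?thesis by (simp add: eq_neg_iff_add_eq_0)
qed

lemma theta_j_inv: "fps_theta j_inv = j_inv * E6_E4_quot"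
proof -
  have "fps_theta j_inv = j_inv * (E2_fps - (12 * fps_12th) * (E2_fps - E6_E4_quot))"
    unfolding j_inv_def fps_theta_mult fps_theta_Delta fps_theta_power[OF theta_E4_root_inv]
    by (simp add: algebra_simps)
  then show ?thesis by (simp add: fps_12th)
qed

lemma theta_E6_E4_quot:
  "fps_theta E6_E4_quot = fps_12th * (2 * E2_fps * E6_E4_quot - 6 * E4_fps + 4 * E6_E4_quot ^ 2)"
proof -
  have half: "fps_const (1 / 2) = 6 * fps_12th" by (simp add: fps_12th_def numeral_fps_const)
  have "fps_theta E6_E4_quot = 6 * fps_12th * (E2_fps * E6_E4_quot - E4_fps * (E4_fps * E4_root_inv ^ 4))
     - 4 * fps_12th * E6_E4_quot * (E2_fps - E6_E4_quot)"
    unfolding E6_E4_quot_def fps_theta_mult theta_E6 half fps_theta_power[OF theta_E4_root_inv]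
    by (simp add: algebra_simps power2_eq_square)
  then show ?thesis unfolding E4_mult_root_inv by (simp add: algebra_simps power2_eq_square)
qed

text \<open>Eliminates E6: the second-order equation contains the quotient only through its square,
  which leaves E4 times a polynomial in 1/j.\<close>

lemma E6_E4_quot_squared: "E6_E4_quot ^ 2 = E4_fps * (1 - 1728 * j_inv)"
proof -
  have K: "E4_fps ^ 3 * E4_root_inv ^ 12 = 1"
    using arg_cong[OF E4_mult_root_inv, of "\<lambda>x. x ^ 3"] by (simp add: power_mult_distrib flip: power_mult)
  have "E4_fps * (1 - 1728 * j_inv) = E4_fps * ((E4_fps ^ 3 - 1728 * Delta_fps) * E4_root_inv ^ 12)"
    unfolding j_inv_def left_diff_distrib K by (simp add: mult.assoc)
  also have "E4_fps ^ 3 - 1728 * Delta_fps = E6_fps ^ 2" unfolding E4_cubed_minus_E6_squared[symmetric] by simp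
  also have "E4_fps * (E6_fps ^ 2 * E4_root_inv ^ 12) = (E4_fps * E4_root_inv ^ 4) * (E6_fps * E4_root_inv ^ 4) ^ 2"
    by (simp add: power_mult_distrib flip: power_mult power_add)
  finally show ?thesis unfolding E4_mult_root_inv E6_E4_quot_def by simp
qed

lemma theta_compose_j_inv: "fps_theta (H oo j_inv) = (fps_theta H oo j_inv) * E6_E4_quot"
proof -
  have "fps_theta (H oo j_inv) = (fps_deriv H oo j_inv) * fps_theta j_inv"
    unfolding fps_theta_def by (simp add: fps_compose_deriv j_inv_nth mult_ac)
  also have "\<dots> = ((fps_X * fps_deriv H) oo j_inv) * E6_E4_quot"
    unfolding theta_j_inv using j_inv_nth by (simp add: fps_compose_mult_distrib mult_ac)
  finally show ?thesis by (simp add: fps_theta_def)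
qed

section \<open>The hypergeometric series and its differential equation\<close>

definition hyp_fps :: "nat \<Rightarrow> nat \<Rightarrow> nat \<Rightarrow> complex fps" where
  "hyp_fps a b n = Abs_fps (\<lambda>m. of_nat (hyp_num a b m) / of_nat (hyp_den n m))"

lemma hyp_fps_nth_0 [simp]: "hyp_fps a b n $ 0 = 1"
  by (simp add: hyp_fps_def hyp_num_def hyp_den_def)

lemma hyp_fps_Suc:
  "of_nat (Suc m) * of_nat (n + 1 + m) * hyp_fps a b n $ Suc m
     = 12 * of_nat (a + 12 * m) * of_nat (b + 12 * m) * hyp_fps a b n $ m"
proof -
  have "hyp_num a b (Suc m) = 12 * (a + 12 * m) * (b + 12 * m) * hyp_num a b m"
    "hyp_den n (Suc m) = Suc m * (n + 1 + m) * hyp_den n m"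
    by (simp_all add: hyp_num_def hyp_den_def algebra_simps)
  then have num: "(of_nat (hyp_num a b (Suc m)) :: complex) = 12 * of_nat (a + 12 * m) * of_nat (b + 12 * m) * of_nat (hyp_num a b m)"
    and den: "(of_nat (hyp_den n (Suc m)) :: complex) = of_nat (Suc m) * of_nat (n + 1 + m) * of_nat (hyp_den n m)"
    by (simp_all only: of_nat_mult of_nat_numeral)
  have "p * q * (y * N / (p * q * D)) = y * (N / D)" if "p \<noteq> 0" "q \<noteq> 0" for p q y N D :: complex
    using that by simp
  moreover have "(of_nat (Suc m) :: complex) \<noteq> 0" "(of_nat (n + 1 + m) :: complex) \<noteq> 0" unfolding of_nat_eq_0_iff by simp_all
  ultimately show ?thesis unfolding hyp_fps_def fps_nth_Abs_fps num den by blast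
qed

lemma int_hyp_fps_iff: "hyp_fps a b n $ m \<in> \<int> \<longleftrightarrow> hyp_den n m dvd hyp_num a b m"
proof
  assume "hyp_fps a b n $ m \<in> \<int>"
  then obtain k :: int where "of_nat (hyp_num a b m) / of_nat (hyp_den n m) = (of_int k :: complex)"
    by (auto simp: hyp_fps_def elim!: Ints_cases)
  then have "of_nat (hyp_num a b m) = (of_int k * of_nat (hyp_den n m) :: complex)"
    using hyp_den_pos[of n m] by (simp add: field_simps)
  then have "int (hyp_num a b m) = k * int (hyp_den n m)" by (metis of_int_eq_iff of_int_mult of_int_of_nat_eq)
  then have "int (hyp_den n m) dvd int (hyp_num a b m)" by simp
  then show "hyp_den n m dvd hyp_num a b m" by simp
next
  assume "hyp_den n m dvd hyp_num a b m"
  then show "hyp_fps a b n $ m \<in> \<int>" using hyp_den_pos[of n m] by (auto simp: hyp_fps_def elim!: dvdE)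
qed

definition hyp_first :: "nat \<Rightarrow> complex fps" where
  "hyp_first n = hyp_fps (6 * n + 1) (6 * n + 5) n"

definition hyp_second :: "nat \<Rightarrow> complex fps" where
  "hyp_second n = hyp_fps (6 * n + 13) (6 * n + 5) n"

text \<open>(\<alpha> + theta) F with \<alpha> = (6 n + 1)/12: the hypergeometric factor of the
  Serre derivative, and by contiguity \<alpha> times F with \<alpha> raised by 1.\<close>

definition hyp_first_shift :: "nat \<Rightarrow> complex fps" where
  "hyp_first_shift n = fps_const ((6 * of_nat n + 1) / 12) * hyp_first n + fps_theta (hyp_first n)"

text \<open>The equation theta (theta + n) F = 1728 x (theta + \<alpha>) (theta + \<beta>) F with
  \<beta> = \<alpha> + 1/3 and n = 2 \<alpha> - 1/6, rewritten in terms of (theta + \<alpha>) F to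
  match the second Serre derivative. Here \<open>c\<close> is \<alpha>.\<close>

lemma hyp_first_ode:
  fixes n :: nat
  defines "c \<equiv> (6 * of_nat n + 1) / 12 :: complex"
  shows "(1 - 1728 * fps_X) * (fps_const (c + 1 / 3) * hyp_first_shift n + fps_theta (hyp_first_shift n)) - fps_const (1 / 2) * hyp_first_shift n
    = fps_const (c * (c - 1 / 6)) * hyp_first n" (is "?L = ?R")
proof (rule fps_ext)
  fix m
  define h where "h = (\<lambda>m. hyp_first n $ m)"
  have Z: "hyp_first_shift n $ m = (c + of_nat m) * h m" for m
    by (simp add: hyp_first_shift_def h_def c_def distrib_right)
  define V where "V = fps_const (c + 1 / 3) * hyp_first_shift n + fps_theta (hyp_first_shift n)"
  have V: "V $ m = (c + 1 / 3 + of_nat m) * ((c + of_nat m) * h m)" for m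
    by (simp add: V_def Z distrib_right)
  have L: "?L $ m = V $ m - 1728 * (fps_X * V) $ m - 1 / 2 * hyp_first_shift n $ m" for m
    unfolding V_def[symmetric] by (simp add: left_diff_distrib mult.assoc numeral_fps_const)
  show "?L $ m = ?R $ m"
  proof (cases m)
    case 0
    have "?L $ m = (c + 1 / 3) * (c * h 0) - 1 / 2 * (c * h 0)" unfolding L unfolding V Z by (simp add: 0 )
    also have "\<dots> = c * (c - 1 / 6) * h 0" by (simp add: algebra_simps)
    finally show ?thesis by (simp add: 0 h_def)
  next
    case (Suc l)
    have rec: "of_nat (Suc l) * of_nat (n + 1 + l) * h (Suc l)
       = 12 * of_nat (6 * n + 1 + 12 * l) * of_nat (6 * n + 5 + 12 * l) * h l"
      unfolding h_def hyp_first_def by (rule hyp_fps_Suc)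
    have "1728 * ((c + 1 / 3 + of_nat l) * ((c + of_nat l) * h l)) = 12 * of_nat (6 * n + 1 + 12 * l) * of_nat (6 * n + 5 + 12 * l) * h l"
      by (simp add: c_def field_simps)
    also have "\<dots> = of_nat (Suc l) * of_nat (n + 1 + l) * h (Suc l)" by (rule rec[symmetric])
    also have "\<dots> = (c + 1 / 3 + of_nat (Suc l)) * ((c + of_nat (Suc l)) * h (Suc l)) - 1 / 2 * ((c + of_nat (Suc l)) * h (Suc l)) - c * (c - 1 / 6) * h (Suc l)"
      by (simp add: c_def field_simps)
    finally have "?L $ m = c * (c - 1 / 6) * h (Suc l)" unfolding L unfolding V Z Suc by (simp add: V algebra_simps)
    then show ?thesis by (simp add: Suc h_def)
  qed
qed

lemma hyp_first_ode_compose: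
  fixes n :: nat
  defines "N \<equiv> of_nat n :: complex fps"
  defines "a \<equiv> (6 * N - 1) * fps_12th"
  shows "(1 - 1728 * j_inv) * ((N - a + 4 * fps_12th) * (hyp_first_shift n oo j_inv) + (fps_theta (hyp_first_shift n) oo j_inv))
     - 6 * fps_12th * (hyp_first_shift n oo j_inv) = (N - a) * (N - a - 2 * fps_12th) * (hyp_first n oo j_inv)"
proof -
  define c :: complex where "c = (6 * of_nat n + 1) / 12"
  have N: "N = fps_const (of_nat n)" by (simp add: N_def fps_of_nat)
  have Na: "N - a = fps_const c" unfolding a_def N fps_12th_def c_def numeral_fps_const fps_const_1_eq_1[symmetric]
    by (simp add: field_simps)
  have "N - a + 4 * fps_12th = fps_const (c + 1 / 3)" "6 * fps_12th = fps_const (1 / 2)"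
    "(N - a) * (N - a - 2 * fps_12th) = fps_const (c * (c - 1 / 6))"
    unfolding Na fps_12th_def by (simp_all add: numeral_fps_const)
  moreover have "1 - 1728 * j_inv = (1 - 1728 * fps_X) oo j_inv"
    using j_inv_nth by (simp add: fps_compose_sub_distrib fps_compose_mult_distrib numeral_fps_const)
  ultimately show ?thesis
    using arg_cong[OF hyp_first_ode[of n, folded c_def], of "\<lambda>f. f oo j_inv"] j_inv_nth(1)
    by (simp add: fps_compose_sub_distrib fps_compose_add_distrib fps_compose_mult_distrib)
qed

section \<open>Solving the equation, and quasimodularity of the solution\<close>

text \<open>The power E4^((6 n - 1)/4) is split into two factors because the exponent is negative
  for n = 0.\<close>

definition extremal_first :: "nat \<Rightarrow> complex fps" where
  "extremal_first n = E4_root ^ (6 * n) * E4_root_inv * j_inv ^ n * (hyp_first n oo j_inv)"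

text \<open>The power of E4 has weight 6 n - 1, exactly the parameter of the Serre derivative, so E2
  cancels and only derivatives with respect to u remain. The second derivative then reduces to
  \<open>hyp_first_ode_compose\<close>.\<close>

lemma serre_extremal_first:
  "serre (6 * of_nat n - 1) (extremal_first n) = E4_root ^ (6 * n) * E4_root_inv * j_inv ^ n * E6_E4_quot * (hyp_first_shift n oo j_inv)"
  and kaneko_zagier_extremal_first: "kaneko_zagier n (extremal_first n)"
proof -
  define M where "M = E4_root ^ (6 * n) * E4_root_inv * j_inv ^ n"
  define e where "e = fps_12th"
  define N where "N = (of_nat n :: complex fps)"
  define a where "a = (6 * N - 1) * e"
  define Q where "Q = E6_E4_quot"
  define y where "y = hyp_first n oo j_inv"
  define z where "z = hyp_first_shift n oo j_inv"
  define w where "w = fps_theta (hyp_first_shift n) oo j_inv"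
  have N: "N = fps_const (of_nat n)" by (simp add: N_def fps_of_nat)
  have c1: "fps_const ((6 * of_nat n - 1) / 12) = a" and c2: "fps_const ((6 * of_nat n + 1) / 12) = a + 2 * e"
    and Na: "fps_const ((6 * of_nat n + 1) / 12) = N - a"
    unfolding a_def N e_def fps_12th_def numeral_fps_const fps_const_1_eq_1[symmetric] by (simp_all add: field_simps)
  have tM: "fps_theta M = M * (a * (E2_fps - Q) + N * Q)"
    unfolding M_def fps_theta_mult fps_theta_power[OF theta_E4_root] fps_theta_power[OF theta_j_inv] theta_E4_root_inv
      a_def N_def Q_def e_def by (simp add: algebra_simps)
  have ty: "fps_theta y = (fps_theta (hyp_first n) oo j_inv) * Q" unfolding y_def Q_def by (rule theta_compose_j_inv)
  have z: "z = (N - a) * y + (fps_theta (hyp_first n) oo j_inv)"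
    unfolding z_def y_def hyp_first_shift_def Na using j_inv_nth(1)
    by (simp add: fps_compose_add_distrib fps_compose_mult_distrib flip: Na)
  have extremal_first: "extremal_first n = M * y" by (simp add: extremal_first_def M_def y_def)
  have s1: "serre (6 * of_nat n - 1) (extremal_first n) = M * Q * z"
    unfolding serre_def c1 extremal_first fps_theta_mult tM ty z by (simp add: algebra_simps)
  then show "serre (6 * of_nat n - 1) (extremal_first n) = E4_root ^ (6 * n) * E4_root_inv * j_inv ^ n * E6_E4_quot * (hyp_first_shift n oo j_inv)"
    by (simp add: M_def Q_def z_def)
  have tz: "fps_theta z = w * Q" unfolding z_def w_def Q_def by (rule theta_compose_j_inv)
  have tQ: "fps_theta Q = e * (2 * E2_fps * Q - 6 * E4_fps + 4 * Q ^ 2)"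
    unfolding Q_def e_def by (rule theta_E6_E4_quot)
  have QQ: "Q ^ 2 = E4_fps * (1 - 1728 * j_inv)" unfolding Q_def by (rule E6_E4_quot_squared)
  have "serre (6 * of_nat n + 1) (M * Q * z) = M * (Q ^ 2 * ((N - a + 4 * e) * z + w) - E4_fps * (6 * e * z))"
    unfolding serre_def c2 fps_theta_mult tM tQ tz by (simp add: algebra_simps power2_eq_square)
  also have "\<dots> = M * E4_fps * ((1 - 1728 * j_inv) * ((N - a + 4 * e) * z + w) - 6 * e * z)"
    unfolding QQ by (simp add: algebra_simps)
  also have "(1 - 1728 * j_inv) * ((N - a + 4 * e) * z + w) - 6 * e * z = (N - a) * (N - a - 2 * e) * y"
    unfolding z_def w_def y_def e_def N_def a_def by (rule hyp_first_ode_compose)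
  also have "M * E4_fps * ((N - a) * (N - a - 2 * e) * y) = (N - a) * (N - a - 2 * e) * (E4_fps * (M * y))"
    by (simp only: mult_ac)
  also have "(N - a) * (N - a - 2 * e) = fps_const ((36 * of_nat n ^ 2 - 1) / 144)"
    unfolding Na[symmetric] e_def fps_12th_def by (simp add: numeral_fps_const field_simps power2_eq_square)
  finally show "kaneko_zagier n (extremal_first n)" unfolding kaneko_zagier_def s1 unfolding extremal_first .
qed

lemma j_inv_power_mult:
  fixes A :: "complex fps"
  shows "fps_X ^ n dvd A * j_inv ^ n * B" and "(A * j_inv ^ n * B) $ n = A $ 0 * B $ 0"
proof -
  define v where "v = fps_shift 1 j_inv"
  have j: "j_inv = fps_X * v" unfolding v_def using j_inv_nth(1) by (intro fps_ext) (auto simp: fps_X_mult_nth)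
  have v0: "v $ 0 = 1" using j_inv_nth(2) by (simp add: v_def)
  have eq: "A * j_inv ^ n * B = fps_X ^ n * (A * v ^ n * B)" unfolding j by (simp add: power_mult_distrib mult_ac)
  show "fps_X ^ n dvd A * j_inv ^ n * B" unfolding eq by (rule dvd_triv_left)
  show "(A * j_inv ^ n * B) $ n = A $ 0 * B $ 0"
    unfolding eq fps_X_power_mult_nth using v0 by (simp add: fps_power_zeroth)
qed

lemma extremal_first_order: "fps_X ^ n dvd extremal_first n" "extremal_first n $ n = 1"
  unfolding extremal_first_def using j_inv_power_mult[where n = n and A = "E4_root ^ (6 * n) * E4_root_inv" and B = "hyp_first n oo j_inv"]
  by (simp_all add: fps_power_zeroth E4_root(2) E4_root_inv(2) hyp_first_def)

lemma E4_mult_quot: "E4_fps * E6_E4_quot = E6_fps"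
  unfolding E6_E4_quot_def using E4_mult_root_inv by (simp add: mult.left_commute)

text \<open>The series solves the equation formally, so its quasimodularity needs an argument.
  \<open>G\<close> is built from the previous form, with c the leading coefficient of its Serre
  derivative; it has order n + 1, satisfies the next equation as an extremal form, and after scaling
  equals the next series by uniqueness.\<close>

lemma extremal_first_in_QMF: "extremal_first n \<in> QMF (6 * int n)"
proof (induction n)
  case 0
  have 1: "1 \<in> QMF (6 * int 0)" using MF_subset_QMF[of 0] by auto
  have "kaneko_zagier 0 1" by (rule extremal_imp_kaneko_zagier[OF 1]) simp
  then have "extremal_first 0 = 1" using kaneko_zagier_extremal_first[of 0] extremal_first_order(2)[of 0] by (intro kaneko_zagier_unique[of 0]) auto
  then show ?case using 1 by simp
next
  case (Suc n)
  define M where "M = E4_root ^ (6 * n) * E4_root_inv"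
  define c where "c = ((6 * of_nat n + 1) / 12 :: complex)"
  define G where "G = E4_fps * serre (6 * of_nat n - 1) (extremal_first n) - fps_const c * (E6_fps * extremal_first n)"
  have "serre (6 * of_nat n - 1) (extremal_first n) \<in> QMF (6 * int n + 2)" using QMF_serre[OF Suc] by simp
  from QMF_mult[OF this E4_fps_MF] have "E4_fps * serre (6 * of_nat n - 1) (extremal_first n) \<in> QMF (6 * int (Suc n))"
    by (simp add: algebra_simps)
  moreover have "fps_const c * (E6_fps * extremal_first n) \<in> QMF (6 * int (Suc n))"
    using QMF_cmult[OF QMF_mult[OF Suc E6_fps_MF]] by (simp add: algebra_simps)
  ultimately have G: "G \<in> QMF (6 * int (Suc n))" unfolding G_def by (rule QMF_diff)
  have z: "hyp_first_shift n oo j_inv = fps_const c * (hyp_first n oo j_inv) + j_inv * (fps_deriv (hyp_first n) oo j_inv)"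
    unfolding hyp_first_shift_def c_def fps_theta_def using j_inv_nth(1)
    by (simp add: fps_compose_add_distrib fps_compose_mult_distrib)
  have "E4_fps * serre (6 * of_nat n - 1) (extremal_first n) = E6_fps * (M * j_inv ^ n * (hyp_first_shift n oo j_inv))"
    unfolding serre_extremal_first E4_mult_quot[symmetric] M_def by (simp only: mult_ac)
  \<comment> \<open>The terms c F cancel and leave u times the derivative of F: this is the extra
    order, with leading coefficient \<open>hyp_first n $ 1\<close>.\<close>
  then have "G = (E6_fps * M) * j_inv ^ Suc n * (fps_deriv (hyp_first n) oo j_inv)"
    unfolding G_def extremal_first_def M_def[symmetric] z by (simp add: algebra_simps)
  then have X: "fps_X ^ Suc n dvd G" and "G $ Suc n = (E6_fps * M) $ 0 * (fps_deriv (hyp_first n) oo j_inv) $ 0"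
    using j_inv_power_mult[where n = "Suc n" and A = "E6_fps * M" and B = "fps_deriv (hyp_first n) oo j_inv"] by simp_all
  then have Gn: "G $ Suc n = hyp_first n $ 1"
    by (simp add: M_def fps_power_zeroth E4_root(2) E4_root_inv(2) E6_fps_nth)
  have h0: "hyp_first n $ 1 \<noteq> 0"
  proof -
    have "hyp_num (6 * n + 1) (6 * n + 5) 1 \<noteq> 0" "hyp_den n 1 \<noteq> 0" by (simp_all add: hyp_num_def hyp_den_def)
    then show ?thesis unfolding hyp_first_def hyp_fps_def fps_nth_Abs_fps divide_eq_0_iff of_nat_eq_0_iff by blast
  qed
  define G' where "G' = fps_const (1 / hyp_first n $ 1) * G"
  have G': "G' \<in> QMF (6 * int (Suc n))" "fps_X ^ Suc n dvd G'" "G' $ Suc n = 1"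
    unfolding G'_def using QMF_cmult[OF G] dvd_mult[OF X] Gn h0 by auto
  have "extremal_first (Suc n) = G'"
    using extremal_imp_kaneko_zagier[OF G'(1,2)] G'(2,3) kaneko_zagier_extremal_first extremal_first_order[of "Suc n"]
    by (intro kaneko_zagier_unique[of "Suc n"]) auto
  then show ?case using G'(1) by simp
qed

section \<open>Transfer of integrality through u = 1/j\<close>

text \<open>The constant term of H is the coefficient of q^n. Subtracting it and shifting H raises
  the power of u by one, which is why n varies in the induction.\<close>

lemma int_fps_compose_j_inv_imp:
  assumes "int_fps (j_inv ^ n * (H oo j_inv))"
  shows "H $ m \<in> \<int>"
  using assms
proof (induction m arbitrary: n H)
  case 0
  then show ?case using int_fps_nth[OF 0, of n] j_inv_power_mult(2)[where n = n and A = 1 and B = "H oo j_inv"] by simp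
next
  case (Suc m)
  have H0: "H $ 0 \<in> \<int>" using int_fps_nth[OF Suc.prems, of n] j_inv_power_mult(2)[where n = n and A = 1 and B = "H oo j_inv"] by simp
  have "H = fps_const (H $ 0) + fps_X * fps_shift 1 H" by (intro fps_ext) (auto simp: fps_X_mult_nth)
  then have "H oo j_inv = (fps_const (H $ 0) + fps_X * fps_shift 1 H) oo j_inv" by (rule arg_cong)
  also have "\<dots> = fps_const (H $ 0) + j_inv * (fps_shift 1 H oo j_inv)"
    using j_inv_nth(1) by (simp add: fps_compose_add_distrib fps_compose_mult_distrib)
  finally have "j_inv ^ Suc n * (fps_shift 1 H oo j_inv) = j_inv ^ n * (H oo j_inv) - fps_const (H $ 0) * j_inv ^ n"
    by (simp add: algebra_simps)
  moreover have "int_fps (fps_const (H $ 0))" using H0 by (auto simp: int_fps_def)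
  ultimately have "int_fps (j_inv ^ Suc n * (fps_shift 1 H oo j_inv))"
    using Suc.prems by (auto intro!: int_fps_intros int_fps_j_inv)
  from Suc.IH[OF this] show ?case by simp
qed

lemma int_fps_iff_compose_j_inv:
  assumes B: "int_fps B" "B $ 0 = 1"
  shows "int_fps (B * j_inv ^ n * (H oo j_inv)) \<longleftrightarrow> int_fps H"
proof
  assume "int_fps H"
  then show "int_fps (B * j_inv ^ n * (H oo j_inv))"
    by (intro int_fps_intros int_fps_compose int_fps_j_inv B)
next
  assume int: "int_fps (B * j_inv ^ n * (H oo j_inv))"
  have BB: "B * inverse B = 1" using B(2) by (simp add: inverse_mult_eq_1')
  have "int_fps (inverse B * (B * j_inv ^ n * (H oo j_inv)))"
    by (intro int_fps_mult int int_fps_inverse[OF B BB])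
  also have "inverse B * (B * j_inv ^ n * (H oo j_inv)) = (B * inverse B) * (j_inv ^ n * (H oo j_inv))" by (simp only: mult_ac)
  finally have "int_fps (j_inv ^ n * (H oo j_inv))" unfolding BB by simp
  then show "int_fps H" using int_fps_compose_j_inv_imp unfolding int_fps_def by blast
qed

section \<open>Extremal forms in the other weights\<close>

text \<open>The factor inverts the leading coefficient n - (6 n - 1)/12 of the Serre
  derivative.\<close>

definition extremal_second :: "nat \<Rightarrow> complex fps" where
  "extremal_second n = fps_const (12 / (6 * of_nat n + 1)) * serre (6 * of_nat n - 1) (extremal_first n)"

text \<open>Multiplying by \<alpha> + m extends the first progression by one term; splitting off its
  initial term instead shifts its start from 6 n + 1 to 6 n + 13.\<close>

lemma hyp_first_shift_eq: "hyp_first_shift n = fps_const ((6 * of_nat n + 1) / 12) * hyp_second n"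
proof (rule fps_ext)
  fix m
  have "(6 * n + 1 + 12 * m) * hyp_num (6 * n + 1) (6 * n + 5) m = (6 * n + 1) * hyp_num (6 * n + 13) (6 * n + 5) m"
  proof -
    have "(\<Prod>i<m. 6 * n + 1 + 12 * i) * (6 * n + 1 + 12 * m) = (\<Prod>i<Suc m. 6 * n + 1 + 12 * i)" by simp
    also have "\<dots> = (6 * n + 1) * (\<Prod>i<m. 6 * n + 13 + 12 * i)" by (subst prod.lessThan_Suc_shift) (simp add: algebra_simps)
    finally have *: "(\<Prod>i<m. 6 * n + 1 + 12 * i) * (6 * n + 1 + 12 * m) = (6 * n + 1) * (\<Prod>i<m. 6 * n + 13 + 12 * i)" .
    have **: "(6 * n + 1 + 12 * m) * (12 ^ m * ((\<Prod>i<m. 6 * n + 1 + 12 * i) * y)) = ((6 * n + 1) * (\<Prod>i<m. 6 * n + 13 + 12 * i)) * (12 ^ m * y)" for y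
      unfolding *[symmetric] by (simp only: mult_ac)
    show ?thesis unfolding hyp_num_def ** by (simp only: mult_ac)
  qed
  then have "of_nat ((6 * n + 1 + 12 * m) * hyp_num (6 * n + 1) (6 * n + 5) m) = (of_nat ((6 * n + 1) * hyp_num (6 * n + 13) (6 * n + 5) m) :: complex)"
    by (rule arg_cong)
  then have "(6 * of_nat n + 1 + 12 * of_nat m) * of_nat (hyp_num (6 * n + 1) (6 * n + 5) m) = ((6 * of_nat n + 1) * of_nat (hyp_num (6 * n + 13) (6 * n + 5) m) :: complex)"
    by (simp only: of_nat_mult of_nat_add of_nat_numeral of_nat_1)
  moreover have "x / 12 * (X / D) + M * (X / D) = x / 12 * (Y / D)" if "(x + 12 * M) * X = x * Y" for x M X Y D :: complex
  proof -
    have "x / 12 * (X / D) + M * (X / D) = (x + 12 * M) * X / (12 * D)" by (cases "D = 0") (simp_all add: field_simps)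
    then show ?thesis unfolding that by simp
  qed
  ultimately show "hyp_first_shift n $ m = (fps_const ((6 * of_nat n + 1) / 12) * hyp_second n) $ m"
    unfolding hyp_first_shift_def hyp_first_def hyp_second_def hyp_fps_def by simp
qed

lemma extremal_second_eq: "extremal_second n = (E4_root ^ (6 * n) * E4_root_inv * E6_E4_quot) * j_inv ^ n * (hyp_second n oo j_inv)"
proof -
  have "12 / x * (x / 12) = 1" if "x \<noteq> 0" for x :: complex using that by simp
  moreover have "6 * of_nat n + 1 \<noteq> (0 :: complex)"
    by (metis add_gr_0 less_numeral_extra(3) of_nat_1 of_nat_add of_nat_eq_0_iff of_nat_mult of_nat_numeral zero_less_one)
  ultimately have "fps_const (12 / (6 * of_nat n + 1)) * fps_const ((6 * of_nat n + 1) / 12) = (1 :: complex fps)"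
    unfolding fps_const_mult by (metis fps_const_1_eq_1)
  then show ?thesis unfolding extremal_second_def serre_extremal_first hyp_first_shift_eq using j_inv_nth(1)
    by (simp add: fps_compose_mult_distrib mult_ac)
qed

lemma E6_E4_quot_props: "int_fps E6_E4_quot" "E6_E4_quot $ 0 = 1"
  unfolding E6_E4_quot_def
  by (intro int_fps_intros int_fps_E6 E4_root_inv) (simp add: fps_power_zeroth E4_root_inv(2) E6_fps_nth)

lemma extremal_second_order: "fps_X ^ n dvd extremal_second n" "extremal_second n $ n = 1"
  unfolding extremal_second_eq using j_inv_power_mult[where n = n and A = "E4_root ^ (6 * n) * E4_root_inv * E6_E4_quot" and B = "hyp_second n oo j_inv"]
  by (simp_all add: fps_power_zeroth E4_root(2) E4_root_inv(2) hyp_second_def E6_E4_quot_props)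

lemma extremal_second_in_QMF: "extremal_second n \<in> QMF (6 * int n + 2)"
  unfolding extremal_second_def using QMF_cmult QMF_serre[OF extremal_first_in_QMF, of n] by simp

lemma int_fps_extremal_first_iff: "int_fps (extremal_first n) \<longleftrightarrow> (\<forall>m. hyp_den n m dvd hyp_num (6 * n + 1) (6 * n + 5) m)"
proof -
  have "int_fps (extremal_first n) \<longleftrightarrow> int_fps (hyp_first n)" unfolding extremal_first_def
    by (rule int_fps_iff_compose_j_inv)
       (intro int_fps_intros E4_root E4_root_inv, simp add: fps_power_zeroth E4_root(2) E4_root_inv(2))
  then show ?thesis by (simp add: int_fps_def hyp_first_def int_hyp_fps_iff)
qed

lemma int_fps_extremal_second_iff: "int_fps (extremal_second n) \<longleftrightarrow> (\<forall>m. hyp_den n m dvd hyp_num (6 * n + 13) (6 * n + 5) m)"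
proof -
  have "int_fps (extremal_second n) \<longleftrightarrow> int_fps (hyp_second n)" unfolding extremal_second_eq
    by (rule int_fps_iff_compose_j_inv)
       (intro int_fps_intros E4_root E4_root_inv E6_E4_quot_props, simp add: fps_power_zeroth E4_root(2) E4_root_inv(2) E6_E4_quot_props)
  then show ?thesis by (simp add: int_fps_def hyp_second_def int_hyp_fps_iff)
qed

lemma int_fps_E4_extremal_first_iff: "int_fps (E4_fps * extremal_first n) \<longleftrightarrow> int_fps (extremal_first n)"
proof
  assume "int_fps (E4_fps * extremal_first n)"
  then have "int_fps (E4_root_inv ^ 4 * (E4_fps * extremal_first n))"
    by (rule int_fps_mult[OF int_fps_power[OF E4_root_inv(3)]])
  also have "E4_root_inv ^ 4 * (E4_fps * extremal_first n) = (E4_fps * E4_root_inv ^ 4) * extremal_first n" by (simp only: mult_ac)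
  finally show "int_fps (extremal_first n)" by (simp add: E4_mult_root_inv)
qed (intro int_fps_mult int_fps_E4)

text \<open>\<open>extremal r n\<close> is the extremal quasimodular form of weight \<open>6 n + r\<close>.\<close>

definition extremal :: "nat \<Rightarrow> nat \<Rightarrow> complex fps" where
  "extremal r n = (if r = 0 then extremal_first n else if r = 2 then extremal_second n else E4_fps * extremal_first n)"

lemma extremal_props:
  assumes "r \<in> {0, 2, 4}"
  shows "extremal r n \<in> QMF (6 * int n + int r)" "fps_X ^ n dvd extremal r n" "extremal r n $ n = 1"
proof -
  have "E4_fps * extremal_first n \<in> QMF (6 * int n + 4)" using QMF_mult[OF extremal_first_in_QMF E4_fps_MF] by (simp add: add.commute)
  moreover have "(E4_fps * extremal_first n) $ n = 1" using extremal_first_order[of n] by (simp add: fps_mult_nth_if_dvd E4_fps_nth)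
  moreover have "fps_X ^ n dvd E4_fps * extremal_first n" using extremal_first_order(1) by (rule dvd_mult)
  ultimately show "extremal r n \<in> QMF (6 * int n + int r)" "fps_X ^ n dvd extremal r n" "extremal r n $ n = 1"
    using assms extremal_first_in_QMF[of n] extremal_second_in_QMF[of n] extremal_first_order[of n] extremal_second_order[of n] by (auto simp: extremal_def)
qed

text \<open>The difference has order at least n + 1, but its weight is below 6 (n + 1).\<close>

lemma extremal_unique:
  assumes r: "r \<in> {0, 2, 4}" and F: "F \<in> QMF (6 * int n + int r)" "fps_X ^ n dvd F" "F $ n = 1"
  shows "F = extremal r n"
proof -
  have "fps_X ^ Suc n dvd F - extremal r n"
    using F extremal_props[OF r, of n] unfolding fps_X_power_dvd_iff by (auto simp: less_Suc_eq)
  moreover have "F - extremal r n \<in> QMF (6 * int n + int r)" by (intro QMF_diff F extremal_props r)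
  ultimately have "F - extremal r n = 0" using r by (intro QMF_order_bound) auto
  then show ?thesis by simp
qed

text \<open>Low orders come from \<Delta>^i times a form with constant term 1. The weight leaves no
  room for this when 2 i > n, and a smaller power of \<Delta> times an extremal form supplies the
  remaining order.\<close>

lemma QMF_order_basis:
  assumes r: "r \<in> {0, 2, 4}" and i: "i \<le> n"
  obtains B where "B \<in> QMF (6 * int n + int r)" "fps_X ^ i dvd B" "B $ i = 1"
proof -
  have D: "fps_X ^ k dvd Delta_fps ^ k" "(Delta_fps ^ k) $ k = 1" for k
  proof -
    define v where "v = fps_shift 1 Delta_fps"
    have j: "Delta_fps = fps_X * v" unfolding v_def using Delta_fps_nth(1) by (intro fps_ext) (auto simp: fps_X_mult_nth)
    have v0: "v $ 0 = 1" using Delta_fps_nth(2) by (simp add: v_def)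
    show "fps_X ^ k dvd Delta_fps ^ k" "(Delta_fps ^ k) $ k = 1"
      unfolding j power_mult_distrib fps_X_power_mult_nth using v0 by (simp_all add: fps_power_zeroth)
  qed
  show ?thesis
  proof (cases "2 * i \<le> n")
    case True
    define m where "m = n - 2 * i"
    define C where "C = (if r = 0 then E6_fps ^ m else if r = 2 then E2_fps * E6_fps ^ m else E4_fps * E6_fps ^ m)"
    have E6: "E6_fps ^ m \<in> MF (6 * int m)" using MF_power[OF E6_fps_MF, of m] by (simp add: mult.commute)
    have "0 + E2_fps * E6_fps ^ m \<in> QMF (6 * int m + 2)" using E6 by (intro QMFI) auto
    moreover have "E4_fps * E6_fps ^ m \<in> QMF (6 * int m + 4)"
      using MF_mult[OF E4_fps_MF E6] MF_subset_QMF by (auto simp: add.commute)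
    ultimately have "C \<in> QMF (6 * int m + int r)" using r E6 MF_subset_QMF unfolding C_def by auto
    moreover have w: "int i * 12 + (6 * int m + int r) = 6 * int n + int r" using True by (simp add: m_def of_nat_diff)
    ultimately have QM: "Delta_fps ^ i * C \<in> QMF (6 * int n + int r)"
      unfolding w[symmetric] by (intro QMF_mult MF_power Delta_fps_MF)
    have "C $ 0 = 1" by (simp add: C_def fps_power_zeroth E6_fps_nth E4_fps_nth E2_fps_nth)
    then have "(C * Delta_fps ^ i) $ i = 1" using D[of i] by (simp add: fps_mult_nth_if_dvd)
    then have "(Delta_fps ^ i * C) $ i = 1" by (simp only: mult.commute)
    with QM show ?thesis using dvd_mult2[OF D(1)] that by blast
  next
    case False
    \<comment> \<open>\<open>k\<close> and \<open>m\<close> solve k + m = i, the order, and 2 k + m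
      = n, the weight.\<close>
    define k where "k = n - i"
    define m where "m = n - 2 * k"
    have km: "k + m = i" "2 * k + m = n" using False i by (auto simp: k_def m_def)
    have w: "int k * 12 + (6 * int m + int r) = 6 * int n + int r" using km by simp
    have "Delta_fps ^ k * extremal r m \<in> QMF (6 * int n + int r)"
      unfolding w[symmetric] by (intro QMF_mult MF_power Delta_fps_MF extremal_props r)
    moreover have "fps_X ^ i dvd Delta_fps ^ k * extremal r m"
      unfolding km(1)[symmetric] power_add by (intro mult_dvd_mono D extremal_props r)
    moreover have "(Delta_fps ^ k * extremal r m) $ i = 1"
    proof -
      obtain U V where U: "Delta_fps ^ k = fps_X ^ k * U" and V: "extremal r m = fps_X ^ m * V"
        using D(1)[of k] extremal_props(2)[OF r, of m] by (auto elim!: dvdE)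
      have "U $ 0 = 1" using D(2)[of k] unfolding U fps_X_power_mult_nth by simp
      moreover have "V $ 0 = 1" using extremal_props(3)[OF r, of m] unfolding V fps_X_power_mult_nth by simp
      moreover have "Delta_fps ^ k * extremal r m = fps_X ^ i * (U * V)"
        unfolding U V km(1)[symmetric] power_add by (simp only: mult_ac)
      ultimately show ?thesis by (simp add: fps_X_power_mult_nth)
    qed
    ultimately show ?thesis by (rule that)
  qed
qed

section \<open>Dimensions and the classification\<close>

definition qm_fun :: "complex fps \<Rightarrow> complex \<Rightarrow> complex" where
  "qm_fun A = (\<lambda>\<tau>. if \<tau> \<in> UHP then eval_nome A \<tau> else 0)"

lemma qm_fun_inject: "A \<in> unit_disc_fps \<Longrightarrow> B \<in> unit_disc_fps \<Longrightarrow> qm_fun A = qm_fun B \<Longrightarrow> A = B"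
  by (rule eval_nome_inject) (auto simp: qm_fun_def fun_eq_iff split: if_splits)

lemma QM_0_eq: "QM w 0 = qm_fun ` MF w"
proof (intro equalityI subsetI)
  fix F assume "F \<in> QM w 0"
  then obtain fs where fs: "\<forall>l\<le>0. modular_form (w - 2 * int l) (fs l)"
    "F = (\<lambda>\<tau>. if \<tau> \<in> UHP then (\<Sum>l\<le>0. E2 \<tau> ^ l * fs l \<tau>) else 0)"
    unfolding QM_def by blast
  have "(\<Sum>l\<le>0. E2 \<tau> ^ l * fs l \<tau>) = fs 0 \<tau>" for \<tau> by simp
  then have "modular_form w (fs 0)" "F = (\<lambda>\<tau>. if \<tau> \<in> UHP then fs 0 \<tau> else 0)" using fs(1) by (simp_all only: fs(2)) simp
  then show "F \<in> qm_fun ` MF w" unfolding modular_form_iff_MF qm_fun_def by (auto simp: fun_eq_iff image_iff)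
next
  fix F assume "F \<in> qm_fun ` MF w"
  then obtain A where A: "A \<in> MF w" "F = qm_fun A" by blast
  then have "modular_form w (eval_nome A)" unfolding modular_form_iff_MF by blast
  then show "F \<in> QM w 0" using A(2) unfolding QM_def qm_fun_def by (auto intro!: exI[of _ "\<lambda>_. eval_nome A"])
qed

lemma eval_nome_QMF:
  assumes "A \<in> MF w" "B \<in> MF (w - 2)" "\<tau> \<in> UHP"
  shows "eval_nome (A + E2_fps * B) \<tau> = eval_nome A \<tau> + E2 \<tau> * eval_nome B \<tau>"
proof -
  have "A \<in> unit_disc_fps" "B \<in> unit_disc_fps" using assms by auto
  then show ?thesis using assms(3) E2_fps_unit_disc
    by (simp add: eval_nome_add eval_nome_mult unit_disc_fps_mult E2_eq_eval_nome)
qed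

lemma QM_1_eq: "QM w 1 = qm_fun ` QMF w"
proof (intro equalityI subsetI)
  fix F assume "F \<in> QM w 1"
  then obtain fs where fs: "\<And>l. l \<le> 1 \<Longrightarrow> modular_form (w - 2 * int l) (fs l)"
    "F = (\<lambda>\<tau>. if \<tau> \<in> UHP then (\<Sum>l\<le>1. E2 \<tau> ^ l * fs l \<tau>) else 0)"
    unfolding QM_def by blast
  have "modular_form w (fs 0)" "modular_form (w - 2) (fs 1)" using fs(1)[of 0] fs(1)[of 1] by simp_all
  then obtain A B where AB: "A \<in> MF w" "\<And>\<tau>. \<tau> \<in> UHP \<Longrightarrow> fs 0 \<tau> = eval_nome A \<tau>"
    "B \<in> MF (w - 2)" "\<And>\<tau>. \<tau> \<in> UHP \<Longrightarrow> fs 1 \<tau> = eval_nome B \<tau>"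
    unfolding modular_form_iff_MF by blast
  have "F = qm_fun (A + E2_fps * B)" unfolding fs(2) qm_fun_def
    using AB(2,4) eval_nome_QMF[OF AB(1,3)] by (auto simp: fun_eq_iff)
  then show "F \<in> qm_fun ` QMF w" using QMFI[OF AB(1,3)] by blast
next
  fix F assume "F \<in> qm_fun ` QMF w"
  then obtain A B where AB: "A \<in> MF w" "B \<in> MF (w - 2)" "F = qm_fun (A + E2_fps * B)" by (auto elim!: QMFE)
  define fs where "fs = (\<lambda>l :: nat. if l = 0 then eval_nome A else eval_nome B)"
  have "modular_form w (eval_nome A)" "modular_form (w - 2) (eval_nome B)"
    using AB(1,2) unfolding modular_form_iff_MF by blast+
  then have "\<forall>l\<le>1. modular_form (w - 2 * int l) (fs l)" by (auto simp: fs_def le_Suc_eq)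
  moreover have "F = (\<lambda>\<tau>. if \<tau> \<in> UHP then (\<Sum>l\<le>1. E2 \<tau> ^ l * fs l \<tau>) else 0)"
    unfolding AB(3) qm_fun_def using eval_nome_QMF[OF AB(1,2)] by (auto simp: fun_eq_iff fs_def)
  ultimately show "F \<in> QM w 1" unfolding QM_def by blast
qed

text \<open>Convergence at every point of the half plane forces radius at least 1, so injectivity of
  \<open>eval_nome\<close> determines the coefficients.\<close>

lemma has_qexp_qm_fun_iff:
  assumes "A \<in> unit_disc_fps"
  shows "has_qexp (qm_fun A) a \<longleftrightarrow> a = fps_nth A"
proof
  assume a: "has_qexp (qm_fun A) a"
  have a_sums: "(\<lambda>n. a n * nome \<tau> ^ n) sums eval_nome A \<tau>" if "\<tau> \<in> UHP" for \<tau>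
    using a that unfolding has_qexp_def qm_fun_def by auto
  have disc: "Abs_fps a \<in> unit_disc_fps"
  proof (rule unit_disc_fpsI)
    fix z :: complex assume z: "norm z < 1"
    show "summable (\<lambda>n. Abs_fps a $ n * z ^ n)"
    proof (cases "z = 0")
      case False
      then show ?thesis using sums_summable[OF a_sums[OF log_nome_UHP[OF False z]]] by (simp add: nome_log_nome)
    qed (simp add: summable_0_powser)
  qed
  have "Abs_fps a = A"
    by (rule eval_nome_inject[OF disc assms]) (use a_sums in \<open>auto simp: eval_nome_def eval_fps_def sums_iff\<close>)
  then show "a = fps_nth A" by auto
next
  assume "a = fps_nth A"
  then show "has_qexp (qm_fun A) a" unfolding has_qexp_def qm_fun_def eval_nome_def
    using assms by (auto intro!: sums_eval_fps unit_disc_fps_radius norm_nome_UHP)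
qed

interpretation fun_space: vector_space "\<lambda>c (f :: complex \<Rightarrow> complex) x. c * f x"
  by unfold_locales (auto simp: fun_eq_iff algebra_simps)

lemma qm_fun_add: "A \<in> unit_disc_fps \<Longrightarrow> B \<in> unit_disc_fps \<Longrightarrow> qm_fun (A + B) = qm_fun A + qm_fun B"
  and qm_fun_cmult: "A \<in> unit_disc_fps \<Longrightarrow> qm_fun (fps_const c * A) = (\<lambda>x. c * qm_fun A x)"
  by (auto simp: qm_fun_def fun_eq_iff eval_nome_add eval_nome_mult)

section \<open>The dimension\<close>

text \<open>Forms of orders 0 to n are in echelon form, hence independent. They span because leading
  coefficients can be eliminated until the order exceeds n, where \<open>QMF_order_bound\<close>
  gives zero.\<close>

lemma QM_dim:
  assumes r: "r \<in> {0, 2, 4}"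
  shows "cdim (QM (6 * int n + int r) 1) = n + 1"
proof -
  define w where "w = 6 * int n + int r"
  have "\<exists>B. B \<in> QMF w \<and> fps_X ^ i dvd B \<and> B $ i = 1" if "i \<le> n" for i
    using QMF_order_basis[OF r that] unfolding w_def by blast
  then obtain b where b: "\<And>i. i \<le> n \<Longrightarrow> b i \<in> QMF w" "\<And>i. i \<le> n \<Longrightarrow> fps_X ^ i dvd b i" "\<And>i. i \<le> n \<Longrightarrow> b i $ i = 1"
    by metis
  have disc: "b i \<in> unit_disc_fps" if "i \<le> n" for i using b(1)[OF that] by (rule QMF_unit_disc)
  define S where "S = (\<lambda>i. qm_fun (b i)) ` {..n}"
  have inj: "inj_on (\<lambda>i. qm_fun (b i)) {..n}"
  proof (rule inj_onI)
    fix i j assume ij: "i \<in> {..n}" "j \<in> {..n}" "qm_fun (b i) = qm_fun (b j)"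
    then have "b i = b j" using disc by (auto intro: qm_fun_inject)
    then show "i = j" using b(2,3) ij unfolding fps_X_power_dvd_iff
      by (metis atMost_iff linorder_neqE_nat zero_neq_one)
  qed
  have fin: "finite S" by (simp add: S_def)
  have "fun_space.independent S"
  proof (rule ccontr)
    assume "\<not> fun_space.independent S"
    then obtain u v where v: "v \<in> S" "u v \<noteq> 0" and sum: "(\<Sum>v\<in>S. (\<lambda>x. u v * v x)) = 0"
      using fun_space.dependent_finite[OF fin] by blast
    define c where "c = (\<lambda>i. u (qm_fun (b i)))"
    define F where "F = (\<Sum>i\<le>n. fps_const (c i) * b i)"
    have disc_sum: "(\<Sum>i<k. fps_const (c i) * b i) \<in> unit_disc_fps \<and>
       qm_fun (\<Sum>i<k. fps_const (c i) * b i) = (\<Sum>i<k. (\<lambda>x. c i * qm_fun (b i) x))" if "k \<le> Suc n" for k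
      using that
    proof (induction k)
      case 0
      then show ?case by (simp add: qm_fun_def fun_eq_iff)
    next
      case (Suc k)
      then have bk: "b k \<in> unit_disc_fps" using disc by simp
      then have cbk: "fps_const (c k) * b k \<in> unit_disc_fps" by auto
      have IH: "(\<Sum>i<k. fps_const (c i) * b i) \<in> unit_disc_fps"
        "qm_fun (\<Sum>i<k. fps_const (c i) * b i) = (\<Sum>i<k. (\<lambda>x. c i * qm_fun (b i) x))" using Suc by auto
      show ?case unfolding sum.lessThan_Suc qm_fun_add[OF IH(1) cbk] qm_fun_cmult[OF bk] IH(2)
        using IH(1) cbk by auto
    qed
    have Fd: "F \<in> unit_disc_fps" and Fq: "qm_fun F = (\<Sum>i\<le>n. (\<lambda>x. c i * qm_fun (b i) x))"
      using disc_sum[of "Suc n"] by (simp_all add: F_def lessThan_Suc_atMost)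
    have "qm_fun F = 0" unfolding Fq using sum unfolding S_def c_def by (subst (asm) sum.reindex[OF inj]) simp
    also have "0 = qm_fun 0" by (simp add: qm_fun_def fun_eq_iff)
    finally have F0: "F = 0" using Fd by (intro qm_fun_inject) auto
    have "c i = 0" if "i \<le> n" for i using that
    proof (induction i rule: less_induct)
      case (less i)
      have "0 = F $ i" by (simp add: F0)
      also have "\<dots> = (\<Sum>j\<le>n. c j * b j $ i)" by (simp add: F_def fps_sum_nth)
      also have "\<dots> = (\<Sum>j\<in>{i}. c j * b j $ i)"
      proof (rule sum.mono_neutral_right)
        show "\<forall>j\<in>{..n} - {i}. c j * b j $ i = 0"
        proof
          fix j assume j: "j \<in> {..n} - {i}"
          show "c j * b j $ i = 0"
          proof (cases "j < i")
            case True
            then show ?thesis using less j by simp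
          next
            case False
            then have "i < j" using j by auto
            then show ?thesis using b(2)[of j] j unfolding fps_X_power_dvd_iff by simp
          qed
        qed
      qed (use less in auto)
      also have "\<dots> = c i" using b(3)[OF less.prems] by simp
      finally show ?case by simp
    qed
    then show False using v unfolding S_def c_def by auto
  qed
  moreover have "S \<subseteq> QM w 1" unfolding S_def QM_1_eq using b(1) by auto
  moreover have "QM w 1 \<subseteq> fun_space.span S"
  proof
    fix F assume "F \<in> QM w 1"
    then obtain A where A: "A \<in> QMF w" "F = qm_fun A" unfolding QM_1_eq by blast
    have "qm_fun A \<in> fun_space.span S" if "A \<in> QMF w" "fps_X ^ j dvd A" "j + k = Suc n" for A j k
      using that
    proof (induction k arbitrary: A j)
      case 0
      then have "A = 0" using r unfolding w_def by (intro QMF_order_bound[of A _ "Suc n"]) auto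
      then have "qm_fun A = 0" by (simp add: qm_fun_def fun_eq_iff)
      then show ?case by (simp only: fun_space.span_zero)
    next
      case (Suc k)
      then have j: "j \<le> n" by simp
      define C where "C = A - fps_const (A $ j) * b j"
      have C: "C \<in> QMF w" unfolding C_def by (intro QMF_diff QMF_cmult Suc.prems b j)
      have "fps_X ^ Suc j dvd C" unfolding C_def using Suc.prems(2) b(2,3)[OF j]
        unfolding fps_X_power_dvd_iff by (auto simp: less_Suc_eq)
      then have "qm_fun C \<in> fun_space.span S" using C Suc.prems by (intro Suc.IH[of C "Suc j"]) auto
      moreover have "(\<lambda>x. A $ j * qm_fun (b j) x) \<in> fun_space.span S"
        by (intro fun_space.span_scale fun_space.span_base) (use j in \<open>auto simp: S_def\<close>)
      ultimately have "qm_fun C + (\<lambda>x. A $ j * qm_fun (b j) x) \<in> fun_space.span S" by (rule fun_space.span_add)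
      also have "qm_fun C + (\<lambda>x. A $ j * qm_fun (b j) x) = qm_fun (C + fps_const (A $ j) * b j)"
        using disc[OF j] QMF_unit_disc[OF C] by (simp add: qm_fun_add qm_fun_cmult unit_disc_fps_mult)
      also have "C + fps_const (A $ j) * b j = A" by (simp add: C_def)
      finally show ?case .
    qed
    from this[OF A(1), of 0 "Suc n"] show "F \<in> fun_space.span S" by (simp add: A(2))
  qed
  ultimately have "fun_space.dim (QM w 1) = card S" by (intro fun_space.dim_unique) auto
  also have "card S = n + 1" unfolding S_def by (simp add: card_image[OF inj])
  finally show ?thesis unfolding cdim_def w_def .
qed

section \<open>Extremal forms and the classification\<close>

text \<open>At the fixed point \<i> the two transformation laws differ by the nonzero inhomogeneous
  term.\<close>

lemma E2_not_modular: "E2_fps \<notin> MF 2"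
proof
  assume "E2_fps \<in> MF 2"
  moreover have "\<i> \<in> UHP" by (simp add: UHP_def)
  ultimately show False using MF_transformation[of E2_fps 2 \<i>] E2_fps_transformation[of \<i>] by simp
qed

text \<open>The condition on n and r excludes the weights 0 and 4, whose candidates 1 and E4 are
  modular and hence of depth 0.\<close>

lemma normalized_extremal_iff:
  assumes r: "r \<in> {0, 2, 4}" and pos: "n > 0 \<or> r = 2"
  shows "normalized_extremal (6 * int n + int r) 1 F a \<longleftrightarrow> F = qm_fun (extremal r n) \<and> a = fps_nth (extremal r n)"
proof
  define w where "w = 6 * int n + int r"
  assume ne: "normalized_extremal (6 * int n + int r) 1 F a"
  then have F: "F \<in> QM w 1" "has_qexp F a" "\<forall>i<n. a i = 0" "a n = 1"
    unfolding normalized_extremal_def QM_dim[OF r] w_def by auto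
  then obtain A where A: "A \<in> QMF w" "F = qm_fun A" unfolding QM_1_eq by blast
  have a: "a = fps_nth A" using F(2) has_qexp_qm_fun_iff[OF QMF_unit_disc[OF A(1)]] A(2) by blast
  have "A = extremal r n"
    using A(1) F(3,4) unfolding a w_def by (intro extremal_unique r) (auto simp: fps_X_power_dvd_iff)
  then show "F = qm_fun (extremal r n) \<and> a = fps_nth (extremal r n)" using A a by simp
next
  define w where "w = 6 * int n + int r"
  define A where "A = extremal r n"
  assume "F = qm_fun (extremal r n) \<and> a = fps_nth (extremal r n)"
  then have F: "F = qm_fun A" "a = fps_nth A" by (auto simp: A_def)
  have A: "A \<in> QMF w" "fps_X ^ n dvd A" "A $ n = 1" unfolding A_def w_def using extremal_props[OF r] by auto
  have disc: "A \<in> unit_disc_fps" using A(1) by (rule QMF_unit_disc)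
  have "F \<in> QM w 1" unfolding QM_1_eq F(1) using A(1) by blast
  moreover have "F \<notin> QM w 0"
  proof
    assume "F \<in> QM w 0"
    then obtain B where B: "B \<in> MF w" "F = qm_fun B" unfolding QM_0_eq by blast
    then have "A = B" using F(1) disc by (intro qm_fun_inject) auto
    then have AM: "A \<in> MF w" using B by simp
    show False
    proof (cases "n = 0")
      case False
      \<comment> \<open>A modular form of weight w has order at most w / 12, and 6 n + r < 12 n for
        n > 0, so an extremal form has depth exactly 1.\<close>
      then have "A = 0" using AM A(2) r by (intro MF_order_bound[of A w n]) (auto simp: w_def)
      then show False using A(3) by simp
    next
      case True
      then have "r = 2" using pos by simp
      have "0 + E2_fps * 1 \<in> QMF 2" by (intro QMFI) auto
      then have "E2_fps = A" unfolding A_def using True \<open>r = 2\<close>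
        by (intro extremal_unique) (auto simp: E2_fps_nth)
      then show False using AM E2_not_modular True \<open>r = 2\<close> by (simp add: w_def)
    qed
  qed
  moreover have "F \<noteq> (\<lambda>_. 0)"
  proof
    assume "F = (\<lambda>_. 0)"
    then have "qm_fun A = qm_fun 0" using F(1) by (simp add: qm_fun_def fun_eq_iff)
    then have "A = 0" using disc by (intro qm_fun_inject) auto
    then show False using A(3) by simp
  qed
  moreover have "has_qexp F a" using has_qexp_qm_fun_iff[OF disc] F by blast
  moreover have "\<forall>i<n. a i = 0" "a n = 1" using A(2,3) unfolding F(2) fps_X_power_dvd_iff by auto
  ultimately show "normalized_extremal (6 * int n + int r) 1 F a"
    unfolding normalized_extremal_def QM_dim[OF r] w_def by auto
qed

lemma no_extremal_weight_4: "\<not> normalized_extremal 4 1 F a"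
proof
  assume ne: "normalized_extremal 4 1 F a"
  have "cdim (QM 4 1) = 1" using QM_dim[of 4 0] by simp
  then have F: "F \<in> QM 4 1" "F \<notin> QM 4 0" "has_qexp F a" "a 0 = 1"
    using ne unfolding normalized_extremal_def by auto
  then obtain A where A: "A \<in> QMF 4" "F = qm_fun A" unfolding QM_1_eq by blast
  have a: "a = fps_nth A" using F(3) has_qexp_qm_fun_iff[OF QMF_unit_disc[OF A(1)]] A(2) by blast
  have "A = extremal 4 0" using A(1) F(4) unfolding a by (intro extremal_unique) auto
  moreover have "E4_fps = extremal 4 0"
    using MF_subset_QMF E4_fps_MF by (intro extremal_unique) (auto simp: E4_fps_nth)
  ultimately show False using F(2) A(2) E4_fps_MF unfolding QM_0_eq by auto
qed

text \<open>Weights 6 n and 6 n + 4 share one criterion because E4 is invertible among integral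
  series; weight 6 n + 2 has its own.\<close>

lemma integral_extremal_iff:
  assumes r: "r \<in> {0, 2, 4}" and pos: "n > 0 \<or> r = 2"
  shows "(\<exists>F a. normalized_extremal (6 * int n + int r) 1 F a \<and> (\<forall>k. a k \<in> \<int>)) \<longleftrightarrow>
    (if r = 2 then n \<in> {0,1,2,3,5,6,11,13} else n \<in> {1,2,3,4,5,9,19})"
proof -
  have "(\<exists>F a. normalized_extremal (6 * int n + int r) 1 F a \<and> (\<forall>k. a k \<in> \<int>)) \<longleftrightarrow> int_fps (extremal r n)"
    unfolding normalized_extremal_iff[OF assms] int_fps_def by blast
  also have "\<dots> \<longleftrightarrow> (if r = 2 then int_fps (extremal_second n) else int_fps (extremal_first n))"
    using r by (auto simp: extremal_def int_fps_E4_extremal_first_iff)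
  also have "int_fps (extremal_second n) \<longleftrightarrow> n \<in> {0,1,2,3,5,6,11,13}"
    unfolding int_fps_extremal_second_iff using hyp_den_dvd_hyp_num_second hyp_second_only_if by blast
  also have "(if r = 2 then n \<in> {0,1,2,3,5,6,11,13} else int_fps (extremal_first n)) =
     (if r = 2 then n \<in> {0,1,2,3,5,6,11,13} else n \<in> {1,2,3,4,5,9,19})"
  proof (cases "r = 2")
    case False
    then have "n > 0" using pos by simp
    then have "int_fps (extremal_first n) \<longleftrightarrow> n \<in> {1,2,3,4,5,9,19}"
      unfolding int_fps_extremal_first_iff using hyp_den_dvd_hyp_num_first hyp_first_only_if by blast
    then show ?thesis by simp
  qed simp
  finally show ?thesis .
qed

theorem theorem1p2:
  shows "{w :: int. even w \<and> w \<ge> 2 \<and>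
           (\<exists>F a. normalized_extremal w 1 F a \<and> (\<forall>n. a n \<in> \<int>))}
         = {2,6,8,10,12,14,16,18,20,22,24,28,30,32,34,38,54,58,68,80,114,118}"
proof (intro equalityI subsetI)
  fix w :: int
  assume "w \<in> {w. even w \<and> w \<ge> 2 \<and> (\<exists>F a. normalized_extremal w 1 F a \<and> (\<forall>n. a n \<in> \<int>))}"
  then have w: "even w" "w \<ge> 2" and ex: "\<exists>F a. normalized_extremal w 1 F a \<and> (\<forall>n. a n \<in> \<int>)" by auto
  define n where "n = nat (w div 6)"
  define r where "r = nat (w mod 6)"
  have wnr: "w = 6 * int n + int r" using w(2) by (simp add: n_def r_def)
  have "w mod 6 = 0 \<or> w mod 6 = 2 \<or> w mod 6 = 4" using w(1) by presburger
  then have r: "r \<in> {0, 2, 4}" by (auto simp: r_def)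
  have "w \<noteq> 4" using ex no_extremal_weight_4 by auto
  then have "n > 0 \<or> r = 2" using w(2) wnr r by auto
  from integral_extremal_iff[OF r this] ex
  have "if r = 2 then n \<in> {0,1,2,3,5,6,11,13} else n \<in> {1,2,3,4,5,9,19}" unfolding wnr by blast
  then show "w \<in> {2,6,8,10,12,14,16,18,20,22,24,28,30,32,34,38,54,58,68,80,114,118}"
    using r unfolding wnr by (auto split: if_splits)
next
  fix w :: int
  assume w: "w \<in> {2,6,8,10,12,14,16,18,20,22,24,28,30,32,34,38,54,58,68,80,114,118}"
  define n where "n = nat (w div 6)"
  define r where "r = nat (w mod 6)"
  have wnr: "w = 6 * int n + int r" using w by (auto simp: n_def r_def)
  have r: "r \<in> {0, 2, 4}" "n > 0 \<or> r = 2" using w by (auto simp: n_def r_def)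
  have "if r = 2 then n \<in> {0,1,2,3,5,6,11,13} else n \<in> {1,2,3,4,5,9,19}"
    using w by (auto simp: n_def r_def)
  with integral_extremal_iff[OF r] have "\<exists>F a. normalized_extremal w 1 F a \<and> (\<forall>n. a n \<in> \<int>)"
    unfolding wnr by blast
  moreover have "even w \<and> w \<ge> 2" using w by auto
  ultimately show "w \<in> {w. even w \<and> w \<ge> 2 \<and> (\<exists>F a. normalized_extremal w 1 F a \<and> (\<forall>n. a n \<in> \<int>))}" by blast
qed

end
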